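(* Fix an integer $r\ge1$. Suppose that $\Phi_r(t)\to\infty$ as $t\to\infty$ and that at least one of the following two conditions holds: (i) for every $\theta>0$, $\displaystyle \frac{\Phi_r(t_0+h)}{\Phi_r(t_0)}\to 1$ as $t_0\to\infty$, where $h=\dfrac{t_0}{r\Phi_r(t_0)}\,\theta$; (ii) $\displaystyle \frac{\Phi_{r+1}(t)}{\Phi_r^2(t)}\to 0$ as $t\to\infty$. Let $f(n_0)=\dfrac{n_0}{r\Phi_r(n_0)}$ and $\widehat{\mathcal{B}}_r(\theta)=\mathcal{B}_r((n_0,n_0+f(n_0)\theta])$ for $\theta\ge0$, where $n_0\in\mathbb{N}$. Then, as $n_0\to\infty$, the process $\widehat{\mathcal{B}}_r$ converges in distribution to a Poisson process of unit rate.
   Context: Setting (discrete-time infinite occupancy scheme). Let $p_1\ge p_2\ge\cdots>0$ with $\sum_{j\ge1}p_j=1$. Balls $1,2,\ldots$ are thrown one at a time at times $1,2,\ldots$, and each ball independently falls in box $j$ with probability $p_j$. Let $\mathcal{P}_j(n)$ be the number of balls in box $j$ after $n$ balls have been allocated, let $\widetilde{\beta}_{jr}=\min\{n\in\mathbb{N}:\mathcal{P}_j(n)=r\}$ be the time when box $j$ receives its $r$th ball, and let $\mathcal{B}_r=\sum_{j\ge1}\delta_{\widetilde{\beta}_{jr}}$ be the point process (on $\mathbb{N}$) of discrete-time $r$-records, where $\delta_n$ is the unit mass at $n$. For $r\ge1$ and real $t\ge0$, $\Phi_r(t)=\sum_{j\ge1}e^{-tp_j}\frac{(tp_j)^r}{r!}$.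 Convergence in distribution of point processes on $\mathbb{R}_+=[0,\infty)$ is weak convergence in the space of locally finite point measures on $\mathbb{R}_+$ with the vague topology, equivalently weak convergence of the counting processes in the Skorokhod space $D(\mathbb{R}_+)$ with the $J_1$-topology. *)

theory Defs
  imports "HOL-Probability.Probability"
begin

section \<open>Point measures on the half-line and the vague topology\<close>

abbreviation borel_halfline :: "real measure" where
  "borel_halfline \<equiv> restrict_space borel {0..}"

text \<open>The sum of the unit masses at the points \<open>x i\<close> for \<open>i \<in> I\<close>, as a Borel measure on
  the half-line; coinciding points are counted with multiplicity.\<close>

definition dirac_sum :: "'i set \<Rightarrow> ('i \<Rightarrow> real) \<Rightarrow> real measure" where
  "dirac_sum I x = distr (count_space I) borel_halfline x"

text \<open>A locally finite family of points is countable, so index sets of natural numbers suffice.\<close>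

definition point_measures :: "real measure set" where
  "point_measures =
     {dirac_sum I x | (I :: nat set) x. (\<forall>i\<in>I. 0 \<le> x i) \<and> (\<forall>b. finite {i \<in> I. x i \<le> b})}"

definition test_functions :: "(real \<Rightarrow> real) set" where
  "test_functions = {f. continuous_on {0..} f \<and> (\<exists>b. \<forall>x\<ge>b. f x = 0)}"

text \<open>The coarsest topology making \<open>\<mu> \<mapsto> \<integral> f d\<mu>\<close> continuous for every continuous function \<open>f\<close> of
  compact support on the half-line.\<close>

definition vague_topology :: "real measure topology" where
  "vague_topology = topology_generated_by
     {{\<mu> \<in> point_measures. (\<integral>x. f x \<partial>\<mu>) \<in> U} | f U. f \<in> test_functions \<and> open U}"

lemma topspace_vague_topology: "topspace vague_topology = point_measures"
proof -
  have "(\<lambda>_. 0) \<in> test_functions"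
    by (auto simp: test_functions_def)
  then have "point_measures \<in>
      {{\<mu> \<in> point_measures. (\<integral>x. f x \<partial>\<mu>) \<in> U} | f U. f \<in> test_functions \<and> open U}"
    by (intro CollectI exI[of _ "\<lambda>_. 0"] exI[of _ UNIV]) auto
  then show ?thesis
    unfolding vague_topology_def topology_generated_by_topspace by blast
qed

section \<open>Convergence in distribution\<close>

definition borel_of :: "'c topology \<Rightarrow> 'c measure" where
  "borel_of T = sigma (topspace T) {U. openin T U}"

definition converges_in_distribution ::
  "'c topology \<Rightarrow> 'a measure \<Rightarrow> (nat \<Rightarrow> 'a \<Rightarrow> 'c) \<Rightarrow> 'b measure \<Rightarrow> ('b \<Rightarrow> 'c) \<Rightarrow> bool" where
  "converges_in_distribution T M Y N Z \<longleftrightarrow>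
     (\<forall>n. Y n \<in> M \<rightarrow>\<^sub>M borel_of T) \<and> Z \<in> N \<rightarrow>\<^sub>M borel_of T \<and>
     (\<forall>F. continuous_map T euclideanreal F \<and> bounded (F ` topspace T) \<longrightarrow>
        (\<lambda>n. \<integral>\<omega>. F (Y n \<omega>) \<partial>M) \<longlonglongrightarrow> (\<integral>\<omega>. F (Z \<omega>) \<partial>N))"

section \<open>Poisson processes and counting processes\<close>

definition poisson_process :: "real \<Rightarrow> 'b measure \<Rightarrow> ('b \<Rightarrow> real measure) \<Rightarrow> bool" where
  "poisson_process c N \<eta> \<longleftrightarrow>
     prob_space N \<and> \<eta> \<in> N \<rightarrow>\<^sub>M borel_of vague_topology \<and>
     (\<forall>A \<in> sets borel_halfline. bounded A \<longrightarrow>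
        (\<forall>k. measure N {\<omega> \<in> space N. emeasure (\<eta> \<omega>) A = of_nat k} =
               exp (- (c * measure lborel A)) * (c * measure lborel A) ^ k / fact k)) \<and>
     (\<forall>(I :: nat set) A. finite I \<and> disjoint_family_on A I \<and>
        (\<forall>i\<in>I. A i \<in> sets borel_halfline \<and> bounded (A i)) \<longrightarrow>
        prob_space.indep_vars N (\<lambda>_. borel) (\<lambda>i \<omega>. emeasure (\<eta> \<omega>) (A i)) I)"

text \<open>The measure on the half-line that a counting path \<open>c\<close> (nondecreasing and right-continuous
  on \<open>{0..}\<close>) is the distribution function of, see the lemma below.\<close>

definition counting_measure :: "(real \<Rightarrow> real) \<Rightarrow> real measure" where
  "counting_measure c =
     restrict_space (interval_measure (\<lambda>t. if t < 0 then 0 else c t)) {0..}"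

lemma emeasure_counting_measure:
  assumes mono: "\<And>s t. 0 \<le> s \<Longrightarrow> s \<le> t \<Longrightarrow> c s \<le> c t"
    and nonneg: "0 \<le> c 0"
    and right_cont: "\<And>t. 0 \<le> t \<Longrightarrow> continuous (at_right t) c"
    and t: "0 \<le> t"
  shows "emeasure (counting_measure c) {0..t} = ennreal (c t)"
proof -
  define G where "G = (\<lambda>t. if t < 0 then 0 else c t)"
  have c_nonneg: "0 \<le> c t" if "0 \<le> t" for t
    using mono[of 0 t] nonneg that by simp
  have G_mono: "G x \<le> G y" if "x \<le> y" for x y
    using that mono[of x y] c_nonneg[of y] by (auto simp: G_def)
  have G_cont: "continuous (at_right a) G" for a
  proof (cases "a < 0")
    case True
    have "\<forall>\<^sub>F x in at_right a. x < 0"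
      using True eventually_at_right_field by blast
    then have "\<forall>\<^sub>F x in at_right a. G x = 0"
      by eventually_elim (simp add: G_def)
    then show ?thesis
      using True by (simp add: continuous_within G_def tendsto_eventually)
  next
    case False
    have "\<forall>\<^sub>F x in at_right a. a < x"
      by (simp add: eventually_at_right_less)
    then have "\<forall>\<^sub>F x in at_right a. c x = G x"
      by (rule eventually_mono) (use False in \<open>auto simp: G_def\<close>)
    moreover have "(c \<longlongrightarrow> c a) (at_right a)"
      using right_cont[of a] False by (simp add: continuous_within)
    ultimately have "(G \<longlongrightarrow> c a) (at_right a)"
      using tendsto_cong by metis
    then show ?thesis
      using False by (simp add: continuous_within G_def)
  qed
  define \<mu> where "\<mu> = interval_measure G"
  have Ioc: "emeasure \<mu> {a<..t} = ennreal (c t)" if "a < 0" for a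
    using emeasure_interval_measure_Ioc[OF _ G_mono G_cont, of a t] that t
    by (simp add: \<mu>_def G_def)
  have sets: "sets \<mu> = sets borel"
    by (simp add: \<mu>_def)
  have Int: "(\<Inter>n. {- 1 / real (Suc n)<..t}) = {0..t}"
  proof (intro equalityI subsetI)
    fix x assume x: "x \<in> (\<Inter>n. {- 1 / real (Suc n)<..t})"
    have "(\<lambda>n. - 1 / real (Suc n)) \<longlonglongrightarrow> 0"
      using tendsto_minus[OF LIMSEQ_inverse_real_of_nat] by (simp add: inverse_eq_divide)
    then have "0 \<le> x"
      by (rule LIMSEQ_le_const2) (use x in \<open>auto intro!: exI[of _ 0] less_imp_le\<close>)
    then show "x \<in> {0..t}" using x by auto
  next
    fix x assume x: "x \<in> {0..t}"
    have "- 1 / real (Suc n) < x" for n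
      by (rule order.strict_trans2[of _ 0]) (use x in simp_all)
    then show "x \<in> (\<Inter>n. {- 1 / real (Suc n)<..t})"
      using x by simp
  qed
  have "(\<lambda>n. emeasure \<mu> {- 1 / real (Suc n)<..t}) \<longlonglongrightarrow>
      emeasure \<mu> (\<Inter>n. {- 1 / real (Suc n)<..t})"
  proof (rule Lim_emeasure_decseq)
    show "range (\<lambda>n. {- 1 / real (Suc n)<..t}) \<subseteq> sets \<mu>"
      by (auto simp: sets)
    show "decseq (\<lambda>n. {- 1 / real (Suc n)<..t})"
    proof (rule decseq_SucI)
      fix n
      have "- 1 / real (Suc n) \<le> - 1 / real (Suc (Suc n))"
        by (simp add: field_simps)
      then show "{- 1 / real (Suc (Suc n))<..t} \<subseteq> {- 1 / real (Suc n)<..t}"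
        by auto
    qed
    show "emeasure \<mu> {- 1 / real (Suc n)<..t} \<noteq> \<infinity>" for n
      using Ioc[of "- 1 / real (Suc n)"] by simp
  qed
  moreover have "emeasure \<mu> {- 1 / real (Suc n)<..t} = ennreal (c t)" for n
    by (rule Ioc) simp
  ultimately have "emeasure \<mu> {0..t} = ennreal (c t)"
    unfolding Int by (simp add: LIMSEQ_const_iff)
  then show ?thesis
    unfolding counting_measure_def G_def[symmetric] \<mu>_def[symmetric]
    by (subst emeasure_restrict_space) (auto simp: sets \<mu>_def)
qed

section \<open>The occupancy scheme\<close>

text \<open>Boxes are numbered from \<open>0\<close>; balls are numbered from \<open>1\<close>, and \<open>X i\<close> is the box that receives
  ball \<open>i\<close>.\<close>

locale occupancy_scheme = prob_space M for M :: "'a measure" +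
  fixes p :: "nat \<Rightarrow> real" and X :: "nat \<Rightarrow> 'a \<Rightarrow> nat"
  assumes p_decreasing: "decseq p"
    and p_pos: "\<And>j. 0 < p j"
    and p_sums: "p sums 1"
    and balls_indep: "indep_vars (\<lambda>_. count_space UNIV) X {1..}"
    and balls_distr: "\<And>i j. 1 \<le> i \<Longrightarrow> prob {\<omega> \<in> space M. X i \<omega> = j} = p j"

definition occupancy :: "(nat \<Rightarrow> 'a \<Rightarrow> nat) \<Rightarrow> nat \<Rightarrow> nat \<Rightarrow> 'a \<Rightarrow> nat" where
  "occupancy X j n \<omega> = card {i \<in> {1..n}. X i \<omega> = j}"

definition record_time :: "(nat \<Rightarrow> 'a \<Rightarrow> nat) \<Rightarrow> nat \<Rightarrow> nat \<Rightarrow> 'a \<Rightarrow> nat" where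
  "record_time X r j \<omega> = (LEAST n. occupancy X j n \<omega> = r)"

text \<open>On the null event that box \<open>j\<close> never receives \<open>r\<close> balls, it contributes no point.\<close>

definition records :: "(nat \<Rightarrow> 'a \<Rightarrow> nat) \<Rightarrow> nat \<Rightarrow> 'a \<Rightarrow> real measure" where
  "records X r \<omega> =
     dirac_sum {j. \<exists>n. occupancy X j n \<omega> = r} (\<lambda>j. real (record_time X r j \<omega>))"

definition Phi :: "(nat \<Rightarrow> real) \<Rightarrow> nat \<Rightarrow> real \<Rightarrow> real" where
  "Phi p r t = (\<Sum>j. exp (- t * p j) * (t * p j) ^ r / fact r)"

definition record_scale :: "(nat \<Rightarrow> real) \<Rightarrow> nat \<Rightarrow> real \<Rightarrow> real" where
  "record_scale p r t = t / (real r * Phi p r t)"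

definition scaled_records ::
  "(nat \<Rightarrow> real) \<Rightarrow> (nat \<Rightarrow> 'a \<Rightarrow> nat) \<Rightarrow> nat \<Rightarrow> nat \<Rightarrow> 'a \<Rightarrow> real \<Rightarrow> real" where
  "scaled_records p X r n0 \<omega> \<theta> =
     measure (records X r \<omega>) {real n0<..real n0 + record_scale p r (real n0) * \<theta>}"

end

theory Submission
  imports Defs
begin

text \<open>
  Seen on the scale of the theorem, the records form a random subset of a fine lattice: after
  \<open>n0\<close> balls, site \<open>k\<close> is occupied if ball \<open>n0 + k + 1\<close> is an \<open>r\<close>-record. Given the first \<open>n\<close>
  balls, the next one is an \<open>r\<close>-record with probability \<open>hazard (r - 1) n\<close>, the total mass \<open>p j\<close>
  of the boxes that hold exactly \<open>r - 1\<close> balls. If this random number were a constant \<open>q\<close>, the sites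
  would be independent coin tosses, which is how a unit rate Poisson process looks when only the
  occupied cells of the lattice are observed. So it suffices that the hazard is nearly constant,
  over the whole time window and in the \<open>L1\<close> sense.

  The mean of the hazard is close to \<open>intensity r n = r * Phi p r n / n\<close>, the inverse of the time
  scale. Its variance has two sources. Distinct boxes are so close to independent that they add only
  \<open>O(Phi p r n)\<close> to the variance of \<open>n * hazard / r\<close>; a box paired with itself adds
  \<open>O(Phi p (r + 1) n)\<close>. Relative to the squared mean, the former is negligible because \<open>Phi p r\<close> tends to
  infinity, the latter because \<open>Phi p (r + 1) / (Phi p r)^2\<close> tends to \<open>0\<close>, which is condition (ii)
  (\<open>hazard_L1_concentration\<close>). Condition (i) implies condition (ii), because a large
  \<open>Phi p (r + 1)\<close> forces a visible drop of \<open>Phi p r\<close> over one time window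
  (\<open>second_condition_of_first\<close>); a matching estimate forward in time shows that under (ii)
  the intensity is nearly constant over a window (\<open>intensity_window\<close>).

  Replacing the sites by coin tosses one at a time turns the \<open>L1\<close> estimate into closeness of the
  laws of the occupied sites in any bounded window (\<open>bernoulli_comparison\<close>). To pass from there to
  weak convergence in the vague topology (\<open>poisson_convergence_criterion\<close>), a bounded continuous
  functional \<open>F\<close> is replaced by its supremum over all lattice configurations with the given
  sites in the window. This depends on finitely many sites, dominates \<open>F\<close>, and
  along the Poisson process converges to \<open>F\<close> when the mesh tends to \<open>0\<close> and the window grows.
\<close>

section \<open>Point measures\<close>

definition locally_finite :: "'i set \<Rightarrow> ('i \<Rightarrow> real) \<Rightarrow> bool" where
  "locally_finite I x \<longleftrightarrow> (\<forall>i\<in>I. 0 \<le> x i) \<and> (\<forall>b. finite {i \<in> I. x i \<le> b})"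

lemma point_measuresI: "locally_finite (I :: nat set) x \<Longrightarrow> dirac_sum I x \<in> point_measures"
  unfolding point_measures_def locally_finite_def by blast

lemma point_measuresE:
  assumes "\<mu> \<in> point_measures"
  obtains I :: "nat set" and x where "\<mu> = dirac_sum I x" "locally_finite I x"
  using assms unfolding point_measures_def locally_finite_def by blast

lemma locally_finite_bounded:
  assumes "locally_finite I x" "bounded A"
  shows "finite {i \<in> I. x i \<in> A}"
proof -
  obtain b where "\<forall>y\<in>A. \<bar>y\<bar> \<le> b" using assms(2) unfolding bounded_real by auto
  then have "{i \<in> I. x i \<in> A} \<subseteq> {i \<in> I. x i \<le> b}" by force
  then show ?thesis using assms(1) finite_subset unfolding locally_finite_def by blast
qed

lemma measurable_points:
  "locally_finite I x \<Longrightarrow> x \<in> count_space I \<rightarrow>\<^sub>M borel_halfline"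
  by (auto simp: locally_finite_def space_restrict_space)

lemma emeasure_dirac_sum:
  assumes "locally_finite I x" "A \<in> sets borel_halfline" "bounded A"
  shows "emeasure (dirac_sum I x) A = of_nat (card {i \<in> I. x i \<in> A})"
proof -
  have eq: "x -` A \<inter> space (count_space I) = {i \<in> I. x i \<in> A}" by auto
  show ?thesis
    unfolding dirac_sum_def
    by (subst emeasure_distr[OF measurable_points[OF assms(1)] assms(2)], subst eq,
        subst emeasure_count_space_finite) (use locally_finite_bounded[OF assms(1,3)] in auto)
qed

lemma dirac_sum_reindex:
  assumes "bij_betw h J I" "locally_finite I x"
  shows "dirac_sum J (x \<circ> h) = dirac_sum I x"
proof -
  have "dirac_sum I x = distr (distr (count_space J) (count_space I) h) borel_halfline x"
    unfolding dirac_sum_def using distr_bij_count_space[OF assms(1)] by simp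
  also have "\<dots> = dirac_sum J (x \<circ> h)"
    unfolding dirac_sum_def
    by (rule distr_distr) (use measurable_points[OF assms(2)] assms(1) in \<open>auto simp: bij_betw_def\<close>)
  finally show ?thesis by simp
qed

lemma integral_dirac_sum:
  assumes x: "locally_finite I x" and g: "g \<in> test_functions"
    and J: "finite J" "J \<subseteq> I" "\<And>i. i \<in> I - J \<Longrightarrow> g (x i) = 0"
  shows "(\<integral>y. g y \<partial>dirac_sum I x) = (\<Sum>i\<in>J. g (x i))"
proof -
  have [measurable]: "g \<in> borel_measurable borel_halfline"
    using g by (auto simp: test_functions_def intro: borel_measurable_continuous_on_restrict)
  have sub: "{i \<in> I. g (x i) \<noteq> 0} \<subseteq> J" using J(3) by auto
  have "(\<integral>y. g y \<partial>dirac_sum I x) = (\<integral>i. g (x i) \<partial>count_space I)"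
    unfolding dirac_sum_def by (rule integral_distr[OF measurable_points[OF x]]) measurable
  also have "\<dots> = (\<Sum>i | i \<in> I \<and> g (x i) \<noteq> 0. g (x i))"
    by (rule lebesgue_integral_count_space_finite_support) (rule finite_subset[OF sub J(1)])
  also have "\<dots> = (\<Sum>i\<in>J. g (x i))"
    by (rule sum.mono_neutral_left) (use J sub in auto)
  finally show ?thesis .
qed

text \<open>The number of points up to \<open>t\<close>, as a function of \<open>t\<close>, is a distribution function of the measure:
  both measures give \<open>{a<..b}\<close> the difference of two such numbers, and these intervals determine a
  measure that is finite on each of them.\<close>

lemma counting_measure_of_points:
  assumes x: "locally_finite I x"
  shows "counting_measure (\<lambda>t. real (card {i \<in> I. x i \<le> t})) = dirac_sum I x"
proof -
  define G where "G t = (if t < 0 then 0 else real (card {i \<in> I. x i \<le> t}))" for t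
  have fin: "finite {i \<in> I. x i \<le> t}" for t
    using x by (simp add: locally_finite_def)
  have G_eq: "G t = real (card {i \<in> I. x i \<le> t})" for t
  proof (cases "t < 0")
    case True
    have none: "{i \<in> I. x i \<le> t} = {}"
    proof -
      have "\<not> x i \<le> t" if "i \<in> I" for i
        using x that True unfolding locally_finite_def by (meson not_le order.strict_trans1 order.trans)
      then show ?thesis by auto
    qed
    show ?thesis unfolding none using True by (simp add: G_def)
  qed (simp add: G_def)
  have mono: "G s \<le> G t" if "s \<le> t" for s t
    unfolding G_eq of_nat_le_iff by (rule card_mono[OF fin]) (use that in auto)
  have right_cont: "continuous (at_right a) G" for a
  proof -
    define B where "B = x ` {i \<in> I. x i \<le> a + 1 \<and> a < x i}"
    have finB: "finite B" unfolding B_def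
      by (rule finite_imageI, rule finite_subset[OF _ fin[of "a + 1"]]) auto
    \<comment> \<open>the nearest point to the right of \<open>a\<close>; the cap \<open>a + 1\<close> leaves finitely many candidates\<close>
    define c where "c = Min (insert (a + 1) B)"
    have c: "a < c" unfolding c_def using finB by (auto simp: B_def)
    have "G t = G a" if "a < t" "t < c" for t
    proof -
      have "{i \<in> I. x i \<le> t} = {i \<in> I. x i \<le> a}"
      proof (intro equalityI subsetI)
        fix i assume i: "i \<in> {i \<in> I. x i \<le> t}"
        show "i \<in> {i \<in> I. x i \<le> a}"
        proof (rule ccontr)
          assume *: "i \<notin> {i \<in> I. x i \<le> a}"
          have "t < a + 1" using that finB by (auto simp: c_def)
          then have "x i \<in> B" using * i by (auto simp: B_def)
          then have "c \<le> x i" unfolding c_def by (intro Min_le) (use finB in auto)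
          then show False using i that by auto
        qed
      qed (use that in auto)
      then show ?thesis by (simp add: G_eq)
    qed
    then have "\<forall>\<^sub>F t in at_right a. G t = G a"
      using eventually_at_right_field c by blast
    then show ?thesis
      by (simp add: continuous_within tendsto_eventually)
  qed
  have "interval_measure G = distr (count_space I) borel x"
  proof (rule measure_eqI_generator_eq)
    show "Int_stable (range (\<lambda>(a, b). {a<..b::real}))"
      by (auto simp: Int_stable_def)
    show "range (\<lambda>(a, b). {a<..b::real}) \<subseteq> Pow UNIV" by simp
    show "emeasure (interval_measure G) A = emeasure (distr (count_space I) borel x) A"
      if A_range: "A \<in> range (\<lambda>(a, b). {a<..b})" for A
    proof -
      obtain a b where A: "A = {a<..b}" using A_range by auto
      have eq: "x -` A \<inter> I = {i \<in> I. x i \<le> b} - {i \<in> I. x i \<le> a}" by (auto simp: A)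
      have "emeasure (distr (count_space I) borel x) A = of_nat (card (x -` A \<inter> I))"
      proof -
        have "finite (x -` A \<inter> I)" unfolding eq using fin by blast
        moreover have "A \<in> sets borel" by (simp add: A)
        ultimately show ?thesis by (simp add: emeasure_distr)
      qed
      also have "\<dots> = emeasure (interval_measure G) A"
      proof (cases "a \<le> b")
        case True
        then have "card (x -` A \<inter> I) = card {i \<in> I. x i \<le> b} - card {i \<in> I. x i \<le> a}"
          unfolding eq by (intro card_Diff_subset) (use fin in auto)
        moreover have "card {i \<in> I. x i \<le> a} \<le> card {i \<in> I. x i \<le> b}"
          by (rule card_mono[OF fin]) (use True in auto)
        ultimately have "ennreal (G b - G a) = ennreal (real (card (x -` A \<inter> I)))"
          unfolding G_eq by (simp add: of_nat_diff)
        then show ?thesis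
          unfolding A using True by (simp add: emeasure_interval_measure_Ioc mono right_cont ennreal_of_nat_eq_real_of_nat)
      qed (auto simp: A)
      finally show ?thesis by simp
    qed
    show "sets (interval_measure G) = sigma_sets UNIV (range (\<lambda>(a, b). {a<..b}))"
      and "sets (distr (count_space I) borel x) = sigma_sets UNIV (range (\<lambda>(a, b). {a<..b}))"
      by (simp_all add: borel_sigma_sets_Ioc)
    show "range (\<lambda>n. {- real n<..real n}) \<subseteq> range (\<lambda>(a, b). {a<..b})"
      by auto
    show "(\<Union>n. {- real n<..real n}) = UNIV"
    proof -
      have "\<exists>n. - real n < y \<and> y \<le> real n" for y
      proof -
        obtain n where "\<bar>y\<bar> < real n" using reals_Archimedean2 by blast
        then have "- real n < y \<and> y \<le> real n" by linarith
        then show ?thesis by blast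
      qed
      then show ?thesis by auto
    qed
    show "emeasure (interval_measure G) {- real n<..real n} \<noteq> \<infinity>" for n
      by (simp add: emeasure_interval_measure_Ioc mono right_cont)
  qed
  moreover have "restrict_space (distr (count_space I) borel x) {0..} = dirac_sum I x"
    unfolding dirac_sum_def
    by (rule restrict_distr) (use x in \<open>auto simp: locally_finite_def Pi_iff\<close>)
  ultimately show ?thesis
    unfolding counting_measure_def G_def by simp
qed

section \<open>Vague convergence\<close>

text \<open>Convergence of all test integrals is convergence in the vague topology: it gives the claim for
  the subbasic open sets, and the property passes to finite intersections and to unions.\<close>

lemma eventually_vague_open:
  assumes lim: "\<And>g. g \<in> test_functions \<Longrightarrow> (\<lambda>n. \<integral>y. g y \<partial>\<mu> n) \<longlonglongrightarrow> (\<integral>y. g y \<partial>\<nu>)"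
    and pm: "\<And>n. \<mu> n \<in> point_measures" and U: "openin vague_topology U" and \<nu>: "\<nu> \<in> U"
  shows "\<forall>\<^sub>F n in sequentially. \<mu> n \<in> U"
  using U[unfolded vague_topology_def, THEN openin_topology_generated_by] \<nu>
proof (induction rule: generate_topology_on.induct)
  case Empty
  then show ?case by simp
next
  case (Int a b)
  then show ?case by (auto intro: eventually_conj)
next
  case (UN K)
  then obtain k where "k \<in> K" "\<nu> \<in> k" by auto
  with UN.IH[of k] show ?case by (auto elim: eventually_mono)
next
  case (Basis s)
  then obtain g V where s: "s = {\<mu> \<in> point_measures. (\<integral>y. g y \<partial>\<mu>) \<in> V}"
    and g: "g \<in> test_functions" and V: "open V" by auto
  have "\<forall>\<^sub>F n in sequentially. (\<integral>y. g y \<partial>\<mu> n) \<in> V"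
    using topological_tendstoD[OF lim[OF g] V] Basis s by auto
  then show ?case using pm by (simp add: s)
qed

lemma vague_continuous_tendsto:
  assumes F: "continuous_map vague_topology euclideanreal F"
    and lim: "\<And>g. g \<in> test_functions \<Longrightarrow> (\<lambda>n. \<integral>y. g y \<partial>\<mu> n) \<longlonglongrightarrow> (\<integral>y. g y \<partial>\<nu>)"
    and pm: "\<And>n. \<mu> n \<in> point_measures" "\<nu> \<in> point_measures"
  shows "(\<lambda>n. F (\<mu> n)) \<longlonglongrightarrow> F \<nu>"
proof (rule topological_tendstoI)
  fix V :: "real set" assume V: "open V" "F \<nu> \<in> V"
  have "openin vague_topology {\<mu> \<in> topspace vague_topology. F \<mu> \<in> V}"
    using F V(1) by (simp add: continuous_map_def)
  from eventually_vague_open[OF lim pm(1) this] show "\<forall>\<^sub>F n in sequentially. F (\<mu> n) \<in> V"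
    using V(2) pm(2) by (auto simp: topspace_vague_topology elim: eventually_mono)
qed

section \<open>Lattice configurations\<close>

abbreviation cell :: "real \<Rightarrow> nat \<Rightarrow> real set" where
  "cell \<delta> k \<equiv> {real k * \<delta><..real (Suc k) * \<delta>}"

lemma bounded_cell: "bounded (cell \<delta> k)"
  by (rule bounded_subset[OF bounded_closed_interval[of "real k * \<delta>" "real (Suc k) * \<delta>"]]) auto

lemma cell_sets:
  assumes "0 < \<delta>"
  shows "cell \<delta> k \<in> sets borel_halfline"
proof -
  have "0 \<le> real k * \<delta>" using assms by simp
  then have "cell \<delta> k \<subseteq> {0..}" by auto
  then show ?thesis by (simp add: sets_restrict_space_iff)
qed

lemma measure_cell: "0 < \<delta> \<Longrightarrow> measure lborel (cell \<delta> k) = \<delta>"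
  by (simp add: algebra_simps)

lemma cell_unique:
  assumes "0 < \<delta>" "y \<in> cell \<delta> k" "y \<in> cell \<delta> k'"
  shows "k = k'"
proof -
  have "real k * \<delta> < real (Suc k') * \<delta>" "real k' * \<delta> < real (Suc k) * \<delta>"
    using assms(2,3) unfolding greaterThanAtMost_iff by linarith+
  then have "real k < real (Suc k')" "real k' < real (Suc k)"
    using mult_less_cancel_right_pos[OF assms(1)] by blast+
  then show ?thesis by linarith
qed

lemma cell_exists:
  assumes "0 < \<delta>" "0 < y"
  obtains k where "y \<in> cell \<delta> k"
proof
  have "0 < y / \<delta>" using assms by simp
  then have "1 \<le> \<lceil>y / \<delta>\<rceil>" by linarith
  then have "real (Suc (nat \<lceil>y / \<delta>\<rceil> - 1)) = of_int \<lceil>y / \<delta>\<rceil>"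
    by (simp add: of_nat_diff)
  then have "y / \<delta> \<le> real (Suc (nat \<lceil>y / \<delta>\<rceil> - 1))" "real (nat \<lceil>y / \<delta>\<rceil> - 1) < y / \<delta>"
    by linarith+
  then show "y \<in> cell \<delta> (nat \<lceil>y / \<delta>\<rceil> - 1)"
    using assms(1) by (simp_all add: field_simps)
qed

text \<open>Site \<open>k\<close> carries the right end point of \<open>cell \<delta> k\<close>; site \<open>0\<close> carries \<open>\<delta>\<close> and not \<open>0\<close> because the
  first ball that is counted after time \<open>n0\<close> is ball \<open>n0 + 1\<close>.\<close>

definition lattice_points :: "real \<Rightarrow> nat set \<Rightarrow> real measure" where
  "lattice_points \<delta> S = dirac_sum S (\<lambda>k. real (Suc k) * \<delta>)"

lemma locally_finite_lattice:
  assumes "0 < \<delta>"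
  shows "locally_finite S (\<lambda>k. real (Suc k) * \<delta>)"
  unfolding locally_finite_def
proof (intro conjI ballI allI)
  fix b
  have "{k \<in> S. real (Suc k) * \<delta> \<le> b} \<subseteq> {..nat \<lceil>b / \<delta>\<rceil>}"
  proof
    fix k assume k: "k \<in> {k \<in> S. real (Suc k) * \<delta> \<le> b}"
    then have "real k * \<delta> \<le> b" using assms by (auto simp: algebra_simps)
    then have "real k \<le> b / \<delta>" using assms by (simp add: field_simps)
    then show "k \<in> {..nat \<lceil>b / \<delta>\<rceil>}" by simp linarith
  qed
  then show "finite {k \<in> S. real (Suc k) * \<delta> \<le> b}" by (rule finite_subset) simp
qed (use assms in auto)

lemma lattice_points_in_point_measures: "0 < \<delta> \<Longrightarrow> lattice_points \<delta> S \<in> point_measures"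
  unfolding lattice_points_def by (intro point_measuresI locally_finite_lattice)

text \<open>A configuration without multiple points is recovered from its occupied cells as the mesh tends
  to \<open>0\<close>. A test function sees finitely many points; once the mesh is below their smallest
  distance they occupy distinct cells, and passing to the right end point of the cell moves
  each of them by less than the mesh. Injectivity of \<open>x\<close> enters because a cell with two points is
  recorded only once, positivity because no cell contains \<open>0\<close>.\<close>

lemma lattice_points_vague_limit:
  fixes I :: "nat set"
  assumes x: "locally_finite I x" "\<And>i. i \<in> I \<Longrightarrow> 0 < x i" "inj_on x I"
    and \<delta>: "\<And>n. 0 < \<delta> n" "\<delta> \<longlonglongrightarrow> 0"
    and m: "filterlim (\<lambda>n. real (m n) * \<delta> n) at_top sequentially"
    and S: "\<And>n k. k < m n \<Longrightarrow> k \<in> S n \<longleftrightarrow> (\<exists>i\<in>I. x i \<in> cell (\<delta> n) k)"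
    and g: "g \<in> test_functions"
  shows "(\<lambda>n. \<integral>y. g y \<partial>lattice_points (\<delta> n) (S n)) \<longlonglongrightarrow> (\<integral>y. g y \<partial>dirac_sum I x)"
proof -
  obtain B where B: "\<And>y. y \<ge> B \<Longrightarrow> g y = 0" using g by (auto simp: test_functions_def)
  have gc: "continuous_on {0..} g" using g by (simp add: test_functions_def)
  define J where "J = {i \<in> I. x i \<le> B}"
  have finJ: "finite J" using x(1) by (simp add: J_def locally_finite_def)
  have Jpos: "0 < x i" if "i \<in> J" for i using x(2) that by (simp add: J_def)
  define idx where "idx n i = (SOME k. x i \<in> cell (\<delta> n) k)" for n i
  have idx_cell: "x i \<in> cell (\<delta> n) (idx n i)" if "i \<in> J" for n i
    unfolding idx_def by (rule someI_ex) (use cell_exists[OF \<delta>(1)[of n] Jpos[OF that]] in blast)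
  have idx: "real (idx n i) * \<delta> n < x i" "x i \<le> real (Suc (idx n i)) * \<delta> n" if "i \<in> J" for n i
    using idx_cell[OF that, of n] by simp_all
  have near: "(\<lambda>n. real (Suc (idx n i)) * \<delta> n) \<longlonglongrightarrow> x i" if "i \<in> J" for i
  proof (rule tendsto_sandwich)
    show "\<forall>\<^sub>F n in sequentially. x i \<le> real (Suc (idx n i)) * \<delta> n"
      using idx(2)[OF that] by simp
    show "\<forall>\<^sub>F n in sequentially. real (Suc (idx n i)) * \<delta> n \<le> x i + \<delta> n"
      using idx(1)[OF that] by (auto simp: algebra_simps intro!: always_eventually less_imp_le)
    show "(\<lambda>n. x i + \<delta> n) \<longlonglongrightarrow> x i" using tendsto_add[OF tendsto_const \<delta>(2), of "x i"] by simp
  qed simp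
  have inj: "\<forall>\<^sub>F n in sequentially. inj_on (idx n) J"
  proof -
    have "\<forall>\<^sub>F n in sequentially. \<forall>i\<in>J. \<forall>j\<in>J. i \<noteq> j \<longrightarrow> idx n i \<noteq> idx n j"
    proof (intro eventually_ball_finite finJ ballI)
      fix i j assume ij: "i \<in> J" "j \<in> J"
      show "\<forall>\<^sub>F n in sequentially. i \<noteq> j \<longrightarrow> idx n i \<noteq> idx n j"
      proof (cases "i = j")
        case False
        then have "x i \<noteq> x j" using x(3) ij by (auto simp: inj_on_def J_def)
        then have "\<forall>\<^sub>F n in sequentially. \<delta> n < \<bar>x i - x j\<bar>"
          using order_tendstoD(2)[OF \<delta>(2), of "\<bar>x i - x j\<bar>"] by simp
        then show ?thesis
        proof eventually_elim
          case (elim n)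
          show ?case
          proof (intro impI notI)
            assume "idx n i = idx n j"
            then have "\<bar>x i - x j\<bar> < \<delta> n"
              using idx[OF ij(1), of n] idx[OF ij(2), of n] by (simp add: algebra_simps abs_less_iff)
            with elim show False by simp
          qed
        qed
      qed simp
    qed
    then show ?thesis by eventually_elim (auto simp: inj_on_def)
  qed
  have "\<forall>\<^sub>F n in sequentially. (\<integral>y. g y \<partial>lattice_points (\<delta> n) (S n)) =
      (\<Sum>i\<in>J. g (real (Suc (idx n i)) * \<delta> n))"
    using inj filterlim_at_top_dense[THEN iffD1, OF m, rule_format, of B]
  proof eventually_elim
    case (elim n)
    have lt: "idx n i < m n" if "i \<in> J" for i
    proof -
      have "real (idx n i) * \<delta> n < real (m n) * \<delta> n"
        using idx(1)[OF that, of n] elim(2) that by (simp add: J_def)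
      then show ?thesis using \<delta>(1)[of n] by (simp add: mult_less_cancel_right_pos)
    qed
    have "(\<integral>y. g y \<partial>lattice_points (\<delta> n) (S n)) =
        (\<Sum>k\<in>idx n ` J. g (real (Suc k) * \<delta> n))"
      unfolding lattice_points_def
    proof (rule integral_dirac_sum[OF locally_finite_lattice[OF \<delta>(1)] g])
      show "finite (idx n ` J)" using finJ by simp
      show "idx n ` J \<subseteq> S n"
      proof
        fix k assume "k \<in> idx n ` J"
        then obtain i where i: "i \<in> J" "k = idx n i" by auto
        then show "k \<in> S n" unfolding i(2)
          by (subst S[OF lt[OF i(1)]]) (use idx[OF i(1), of n] in \<open>auto simp: J_def\<close>)
      qed
      fix k assume k: "k \<in> S n - idx n ` J"
      show "g (real (Suc k) * \<delta> n) = 0"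
      proof (rule ccontr)
        assume "g (real (Suc k) * \<delta> n) \<noteq> 0"
        then have small: "real (Suc k) * \<delta> n < B" using B linorder_not_le by blast
        then have "real (Suc k) * \<delta> n < real (m n) * \<delta> n" using elim(2) by simp
        then have "k < m n" using \<delta>(1)[of n] by (simp add: mult_less_cancel_right_pos)
        from S[OF this] k obtain i where i: "i \<in> I" "real k * \<delta> n < x i" "x i \<le> real (Suc k) * \<delta> n"
          by auto
        then have "i \<in> J" using small by (simp add: J_def)
        moreover have "k = idx n i"
          using cell_unique[OF \<delta>(1) _ idx_cell[OF \<open>i \<in> J\<close>]] i(2,3) by simp
        ultimately show False using k by simp
      qed
    qed
    then show ?case by (simp add: sum.reindex[OF elim(1)])
  qed
  moreover have "(\<lambda>n. \<Sum>i\<in>J. g (real (Suc (idx n i)) * \<delta> n)) \<longlonglongrightarrow> (\<Sum>i\<in>J. g (x i))"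
  proof (rule tendsto_sum)
    fix i assume i: "i \<in> J"
    show "(\<lambda>n. g (real (Suc (idx n i)) * \<delta> n)) \<longlonglongrightarrow> g (x i)"
      by (rule continuous_on_tendsto_compose[OF gc near[OF i]])
        (use Jpos[OF i] \<delta>(1) in \<open>auto intro!: always_eventually less_imp_le\<close>)
  qed
  moreover have "(\<integral>y. g y \<partial>dirac_sum I x) = (\<Sum>i\<in>J. g (x i))"
    by (rule integral_dirac_sum[OF x(1) g finJ]) (use B in \<open>auto simp: J_def\<close>)
  ultimately show ?thesis by (simp add: tendsto_cong)
qed

text \<open>A test function vanishes beyond some bound, so its integral depends on finitely many sites. Hence
  membership of a lattice configuration in an open set is decided by an initial segment of sites.\<close>

lemma lattice_points_cylinder:
  assumes \<delta>: "0 < \<delta>" and U: "openin vague_topology U" and S: "lattice_points \<delta> S \<in> U"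
  shows "\<exists>m. \<forall>S'. (\<forall>k<m. k \<in> S' \<longleftrightarrow> k \<in> S) \<longrightarrow> lattice_points \<delta> S' \<in> U"
  using U[unfolded vague_topology_def, THEN openin_topology_generated_by] S
proof (induction rule: generate_topology_on.induct)
  case Empty
  then show ?case by simp
next
  case (Int a b)
  then obtain m m' where "\<forall>S'. (\<forall>k<m. k \<in> S' \<longleftrightarrow> k \<in> S) \<longrightarrow> lattice_points \<delta> S' \<in> a"
    "\<forall>S'. (\<forall>k<m'. k \<in> S' \<longleftrightarrow> k \<in> S) \<longrightarrow> lattice_points \<delta> S' \<in> b" by auto
  then show ?case by (intro exI[of _ "max m m'"]) auto
next
  case (UN K)
  then obtain k where k: "k \<in> K" "lattice_points \<delta> S \<in> k" by auto
  then obtain m where "\<forall>S'. (\<forall>k<m. k \<in> S' \<longleftrightarrow> k \<in> S) \<longrightarrow> lattice_points \<delta> S' \<in> k"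
    using UN.IH[OF k] by auto
  then show ?case using k(1) by (intro exI[of _ m]) auto
next
  case (Basis s)
  then obtain g V where s: "s = {\<mu> \<in> point_measures. (\<integral>y. g y \<partial>\<mu>) \<in> V}"
    and g: "g \<in> test_functions" by auto
  obtain B where B: "\<And>y. y \<ge> B \<Longrightarrow> g y = 0" using g by (auto simp: test_functions_def)
  define m where "m = nat \<lceil>B / \<delta>\<rceil>"
  have zero: "g (real (Suc k) * \<delta>) = 0" if "m \<le> k" for k
  proof (rule B)
    have "B / \<delta> \<le> real (Suc k)" using that unfolding m_def by linarith
    then show "B \<le> real (Suc k) * \<delta>" using \<delta> by (simp add: field_simps)
  qed
  have int: "(\<integral>y. g y \<partial>lattice_points \<delta> S') = (\<Sum>k\<in>S' \<inter> {..<m}. g (real (Suc k) * \<delta>))" for S'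
    unfolding lattice_points_def
    by (rule integral_dirac_sum[OF locally_finite_lattice[OF \<delta>] g]) (use zero in auto)
  have "lattice_points \<delta> S' \<in> s" if "\<forall>k<m. k \<in> S' \<longleftrightarrow> k \<in> S" for S'
  proof -
    have "S' \<inter> {..<m} = S \<inter> {..<m}" using that by auto
    then have "(\<integral>y. g y \<partial>lattice_points \<delta> S') = (\<integral>y. g y \<partial>lattice_points \<delta> S)"
      by (simp add: int)
    then show ?thesis using Basis s lattice_points_in_point_measures[OF \<delta>] by simp
  qed
  then show ?case by blast
qed

lemma measurable_vagueI:
  assumes "\<And>\<omega>. \<omega> \<in> space M \<Longrightarrow> Y \<omega> \<in> point_measures"
    and "\<And>U. openin vague_topology U \<Longrightarrow> {\<omega> \<in> space M. Y \<omega> \<in> U} \<in> sets M"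
  shows "Y \<in> M \<rightarrow>\<^sub>M borel_of vague_topology"
  unfolding borel_of_def
proof (rule measurable_measure_of)
  show "{U. openin vague_topology U} \<subseteq> Pow (topspace vague_topology)"
    by (auto dest: openin_subset)
  show "Y \<in> space M \<rightarrow> topspace vague_topology"
    using assms(1) by (auto simp: topspace_vague_topology)
  show "Y -` U \<inter> space M \<in> sets M" if "U \<in> {U. openin vague_topology U}" for U
    using assms(2)[of U] that by (simp add: vimage_def Int_def conj_commute)
qed

text \<open>The vague topology is generated by uncountably many sets, so measurability cannot be read off
  from the generators. But the preimage of an open set is a union of cylinders, and
  there are only countably many cylinders, one for each finite list of truth values.\<close>

lemma measurable_lattice_points:
  assumes \<delta>: "0 < \<delta>" and \<xi>[measurable]: "\<And>k. Measurable.pred M (\<lambda>\<omega>. \<xi> k \<omega>)"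
  shows "(\<lambda>\<omega>. lattice_points \<delta> {k. \<xi> k \<omega>}) \<in> M \<rightarrow>\<^sub>M borel_of vague_topology"
proof (rule measurable_vagueI)
  fix U assume U: "openin vague_topology U"
  define L where "L = {l :: bool list. \<forall>S. (\<forall>k<length l. k \<in> S \<longleftrightarrow> l ! k) \<longrightarrow> lattice_points \<delta> S \<in> U}"
  have "{\<omega> \<in> space M. lattice_points \<delta> {k. \<xi> k \<omega>} \<in> U} =
      {\<omega> \<in> space M. \<exists>l\<in>L. \<forall>k\<in>{..<length l}. \<xi> k \<omega> \<longleftrightarrow> l ! k}" (is "?l = ?r")
  proof (intro equalityI subsetI)
    fix \<omega> assume \<omega>: "\<omega> \<in> ?l"
    then obtain m where m: "\<forall>S'. (\<forall>k<m. k \<in> S' \<longleftrightarrow> k \<in> {k. \<xi> k \<omega>}) \<longrightarrow> lattice_points \<delta> S' \<in> U"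
      using lattice_points_cylinder[OF \<delta> U, of "{k. \<xi> k \<omega>}"] by auto
    then have "map (\<lambda>k. \<xi> k \<omega>) [0..<m] \<in> L" by (simp add: L_def)
    then show "\<omega> \<in> ?r" using \<omega> by (auto intro!: bexI[of _ "map (\<lambda>k. \<xi> k \<omega>) [0..<m]"])
  next
    fix \<omega> assume "\<omega> \<in> ?r"
    then show "\<omega> \<in> ?l" by (auto simp: L_def)
  qed
  also have "\<dots> \<in> sets M" by measurable
  finally show "{\<omega> \<in> space M. lattice_points \<delta> {k. \<xi> k \<omega>} \<in> U} \<in> sets M" .
qed (rule lattice_points_in_point_measures[OF \<delta>])

section \<open>Comparison of adapted indicator sequences\<close>

lemma integral_of_bool: "(\<integral>\<omega>. of_bool (P \<omega>) \<partial>M) = measure M {\<omega> \<in> space M. P \<omega>}"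
proof -
  have "(\<integral>\<omega>. of_bool (P \<omega>) \<partial>M) = (\<integral>\<omega>. indicator {\<omega> \<in> space M. P \<omega>} \<omega> \<partial>M)"
    by (rule Bochner_Integration.integral_cong) (auto simp: indicator_def)
  also have "\<dots> = measure M ({\<omega> \<in> space M. P \<omega>} \<inter> space M)"
    by (rule Bochner_Integration.integral_indicator)
  also have "{\<omega> \<in> space M. P \<omega>} \<inter> space M = {\<omega> \<in> space M. P \<omega>}" by auto
  finally show ?thesis .
qed

lemma measurable_map_coordinates:
  fixes js :: "'i list"
  shows "(\<lambda>f. map f js) \<in>
    (PiM (set js) (\<lambda>_. count_space UNIV) :: ('i \<Rightarrow> 'c :: countable) measure) \<rightarrow>\<^sub>M count_space UNIV"
  (is "_ \<in> ?P \<rightarrow>\<^sub>M _")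
  unfolding measurable_count_space_eq_countable[OF countableI_type]
proof (intro conjI ballI)
  fix l :: "'c list"
  have [measurable]: "(\<lambda>f. f (js ! k)) \<in> ?P \<rightarrow>\<^sub>M count_space UNIV" if "k < length js" for k
    by (rule measurable_component_singleton) (use that in simp)
  have "{f \<in> space ?P. length js = length l \<and> (\<forall>k\<in>{..<length js}. f (js ! k) = l ! k)}
      \<in> sets ?P" by measurable
  also have "{f \<in> space ?P. length js = length l \<and> (\<forall>k\<in>{..<length js}. f (js ! k) = l ! k)}
      = (\<lambda>f. map f js) -` {l} \<inter> space ?P"
    by (auto simp: list_eq_iff_nth_eq)
  finally show "(\<lambda>f. map f js) -` {l} \<inter> space ?P \<in> sets ?P" .
qed simp

lemma (in prob_space) expectation_map_list_times:
  fixes Z :: "'i \<Rightarrow> 'a \<Rightarrow> 'c :: countable"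
  assumes ind: "indep_vars (\<lambda>_. count_space UNIV) Z I"
    and js: "set js \<subseteq> I" and i: "i \<in> I" "i \<notin> set js"
    and \<phi>: "\<And>l. \<bar>\<phi> l\<bar> \<le> (B :: real)" and \<psi>: "\<And>c. \<bar>\<psi> c\<bar> \<le> (C :: real)"
  shows "expectation (\<lambda>\<omega>. \<phi> (map (\<lambda>j. Z j \<omega>) js) * \<psi> (Z i \<omega>)) =
    expectation (\<lambda>\<omega>. \<phi> (map (\<lambda>j. Z j \<omega>) js)) * expectation (\<lambda>\<omega>. \<psi> (Z i \<omega>))"
proof -
  let ?P = "\<lambda>J. PiM J (\<lambda>_. count_space UNIV) :: ('i \<Rightarrow> 'c) measure"
  have m1: "(\<lambda>f. \<phi> (map f js)) \<in> ?P (set js) \<rightarrow>\<^sub>M borel"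
    by (rule measurable_compose[OF measurable_map_coordinates]) simp
  have m2: "(\<lambda>f. \<psi> (f i)) \<in> ?P {i} \<rightarrow>\<^sub>M borel"
    by (rule measurable_compose[OF measurable_component_singleton]) simp_all
  have "indep_var borel ((\<lambda>f. \<phi> (map f js)) \<circ> (\<lambda>\<omega>. restrict (\<lambda>i. Z i \<omega>) (set js)))
      borel ((\<lambda>f. \<psi> (f i)) \<circ> (\<lambda>\<omega>. restrict (\<lambda>i. Z i \<omega>) {i}))"
    by (rule indep_var_compose[OF indep_var_restrict[OF ind] m1 m2]) (use js i in auto)
  moreover have "(\<lambda>f. \<phi> (map f js)) \<circ> (\<lambda>\<omega>. restrict (\<lambda>i. Z i \<omega>) (set js)) =
      (\<lambda>\<omega>. \<phi> (map (\<lambda>j. Z j \<omega>) js))"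
    by (auto simp: fun_eq_iff intro!: arg_cong[of _ _ \<phi>])
  moreover have "(\<lambda>f. \<psi> (f i)) \<circ> (\<lambda>\<omega>. restrict (\<lambda>i. Z i \<omega>) {i}) = (\<lambda>\<omega>. \<psi> (Z i \<omega>))"
    by (auto simp: fun_eq_iff)
  ultimately have iv: "indep_var borel (\<lambda>\<omega>. \<phi> (map (\<lambda>j. Z j \<omega>) js)) borel (\<lambda>\<omega>. \<psi> (Z i \<omega>))"
    by simp
  have "integrable M (\<lambda>\<omega>. \<phi> (map (\<lambda>j. Z j \<omega>) js))"
    by (rule integrable_const_bound[of _ B, OF _ indep_var_rv1[OF iv]]) (simp add: \<phi>)
  moreover have "integrable M (\<lambda>\<omega>. \<psi> (Z i \<omega>))"
    by (rule integrable_const_bound[of _ C, OF _ indep_var_rv2[OF iv]]) (simp add: \<psi>)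
  ultimately show ?thesis by (rule indep_var_lebesgue_integral[OF iv])
qed

lemma measurable_map_list:
  fixes Z :: "'i \<Rightarrow> 'a \<Rightarrow> 'c :: countable"
  assumes "\<And>k. k \<in> set js \<Longrightarrow> Z k \<in> M \<rightarrow>\<^sub>M count_space UNIV"
  shows "(\<lambda>\<omega>. map (\<lambda>k. Z k \<omega>) js) \<in> M \<rightarrow>\<^sub>M count_space UNIV"
proof -
  have "(\<lambda>\<omega>. restrict (\<lambda>k. Z k \<omega>) (set js)) \<in> M \<rightarrow>\<^sub>M PiM (set js) (\<lambda>_. count_space UNIV)"
    by (rule measurable_restrict) (rule assms)
  from measurable_compose[OF this measurable_map_coordinates] show ?thesis
    by (simp cong: map_cong)
qed

lemma (in prob_space) integrable_map_list:
  fixes \<phi> :: "bool list \<Rightarrow> real"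
  assumes "\<And>k. Measurable.pred M (\<xi> k)" "\<And>l. \<bar>\<phi> l\<bar> \<le> B"
  shows "integrable M (\<lambda>\<omega>. \<phi> (map (\<lambda>i. \<xi> i \<omega>) [0..<m]))"
proof (rule integrable_const_bound[of _ B])
  show "(\<lambda>\<omega>. \<phi> (map (\<lambda>i. \<xi> i \<omega>) [0..<m])) \<in> borel_measurable M"
    by (rule measurable_compose[OF measurable_map_list]) (use assms in auto)
qed (use assms in auto)

text \<open>Replace the indicators by Bernoulli variables one at a time, the last one first. Conditionally on
  the earlier sites, \<open>G\<close> is an affine function of the last indicator with slope at most
  \<open>2 * B\<close>, so replacing its conditional probability \<open>H k\<close> by \<open>q\<close> costs at most
  \<open>2 * B\<close> times the mean of \<open>\<bar>H k - q\<bar>\<close>. Afterwards only the function \<open>G'\<close> of the earlier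
  indicators is left, again bounded by \<open>B\<close>.\<close>

lemma bernoulli_comparison:
  fixes \<xi> :: "nat \<Rightarrow> 'a \<Rightarrow> bool" and \<zeta> :: "nat \<Rightarrow> 'b \<Rightarrow> bool" and G :: "bool list \<Rightarrow> real"
  assumes M: "prob_space M" and N: "prob_space N"
    and \<xi>[measurable]: "\<And>k. Measurable.pred M (\<xi> k)"
    and \<zeta>[measurable]: "\<And>k. Measurable.pred N (\<zeta> k)"
    and H: "\<And>k. k < m \<Longrightarrow> integrable M (H k)"
    and cond: "\<And>k \<phi> c. k < m \<Longrightarrow> (\<And>l. \<bar>\<phi> l\<bar> \<le> c) \<Longrightarrow>
      (\<integral>\<omega>. \<phi> (map (\<lambda>i. \<xi> i \<omega>) [0..<k]) * of_bool (\<xi> k \<omega>) \<partial>M) =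
      (\<integral>\<omega>. \<phi> (map (\<lambda>i. \<xi> i \<omega>) [0..<k]) * H k \<omega> \<partial>M)"
    and bern: "\<And>k \<phi> c. k < m \<Longrightarrow> (\<And>l. \<bar>\<phi> l\<bar> \<le> c) \<Longrightarrow>
      (\<integral>\<omega>. \<phi> (map (\<lambda>i. \<zeta> i \<omega>) [0..<k]) * of_bool (\<zeta> k \<omega>) \<partial>N) =
      (\<integral>\<omega>. \<phi> (map (\<lambda>i. \<zeta> i \<omega>) [0..<k]) \<partial>N) * q"
    and q: "0 \<le> q" "q \<le> 1" and G: "\<And>l. \<bar>G l\<bar> \<le> B"
  shows "\<bar>(\<integral>\<omega>. G (map (\<lambda>i. \<xi> i \<omega>) [0..<m]) \<partial>M) - (\<integral>\<omega>. G (map (\<lambda>i. \<zeta> i \<omega>) [0..<m]) \<partial>N)\<bar>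
    \<le> 2 * B * (\<Sum>k<m. \<integral>\<omega>. \<bar>H k \<omega> - q\<bar> \<partial>M)"
  using \<xi> \<zeta> H cond bern G
proof (induction m arbitrary: G)
  case 0
  interpret M: prob_space M by fact
  interpret N: prob_space N by fact
  show ?case by (simp add: M.prob_space N.prob_space)
next
  case (Suc m)
  interpret M: prob_space M by fact
  interpret N: prob_space N by fact
  define D where "D l = G (l @ [True]) - G (l @ [False])" for l
  define G' where "G' l = q * D l + G (l @ [False])" for l
  have G_False: "\<bar>G (l @ [False])\<bar> \<le> B" for l by (rule Suc.prems(6))
  have B0: "0 \<le> B" using order.trans[OF abs_ge_zero Suc.prems(6)] .
  have D: "\<bar>D l\<bar> \<le> 2 * B" for l
    unfolding D_def using Suc.prems(6)[of "l @ [True]"] Suc.prems(6)[of "l @ [False]"] by linarith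
  have G': "\<bar>G' l\<bar> \<le> B" for l
  proof -
    have "G' l = q * G (l @ [True]) + (1 - q) * G (l @ [False])"
      by (simp add: G'_def D_def algebra_simps)
    also have "\<bar>\<dots>\<bar> \<le> q * B + (1 - q) * B"
      using Suc.prems(6) q
      by (intro order.trans[OF abs_triangle_ineq] add_mono) (auto simp: abs_mult intro: mult_left_mono)
    finally show ?thesis by (simp add: algebra_simps)
  qed
  let ?p = "\<lambda>\<omega>. map (\<lambda>i. \<xi> i \<omega>) [0..<m]" and ?r = "\<lambda>\<omega>. map (\<lambda>i. \<zeta> i \<omega>) [0..<m]"
  have split: "G (map f [0..<Suc m]) = D (map f [0..<m]) * of_bool (f m) + G (map f [0..<m] @ [False])"
    for f :: "nat \<Rightarrow> bool"
    by (cases "f m") (simp_all add: D_def)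
  have intM: "integrable M (\<lambda>\<omega>. \<phi> (?p \<omega>))" if "\<And>l. \<bar>\<phi> l\<bar> \<le> c" for \<phi> :: "bool list \<Rightarrow> real" and c
    by (rule M.integrable_map_list) (use Suc.prems that in auto)
  have intN: "integrable N (\<lambda>\<omega>. \<phi> (?r \<omega>))" if "\<And>l. \<bar>\<phi> l\<bar> \<le> c" for \<phi> :: "bool list \<Rightarrow> real" and c
    by (rule N.integrable_map_list) (use Suc.prems that in auto)
  have [measurable]: "Measurable.pred M (\<xi> m)" "Measurable.pred N (\<zeta> m)"
    using Suc.prems(1,2) by auto
  have Hm: "integrable M (H m)" using Suc.prems by simp
  have DH: "integrable M (\<lambda>\<omega>. D (?p \<omega>) * h \<omega>)" if "integrable M h" for h :: "'a \<Rightarrow> real"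
    by (rule Bochner_Integration.integrable_bound[OF integrable_mult_right[OF integrable_norm[OF that], of "2 * B"]])
      (use that borel_measurable_integrable[OF intM[of D, OF D]] borel_measurable_integrable[OF that]
        in \<open>auto simp: abs_mult B0 intro!: mult_mono order.trans[OF D] always_eventually\<close>)
  have \<xi>i: "integrable M (\<lambda>\<omega>. of_bool (\<xi> m \<omega>) :: real)"
    by (rule M.integrable_const_bound[of _ 1]) auto
  have \<zeta>D: "integrable N (\<lambda>\<omega>. D (?r \<omega>) * of_bool (\<zeta> m \<omega>))"
  proof (rule N.integrable_const_bound[of _ "2 * B"])
    show "AE \<omega> in N. norm (D (?r \<omega>) * of_bool (\<zeta> m \<omega>)) \<le> 2 * B"
      using D order.trans[OF abs_ge_zero D] by (intro always_eventually) (auto simp: abs_mult)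
    show "(\<lambda>\<omega>. D (?r \<omega>) * of_bool (\<zeta> m \<omega>)) \<in> borel_measurable N"
      using borel_measurable_integrable[OF intN[of D, OF D]] by measurable
  qed
  have "(\<integral>\<omega>. G (map (\<lambda>i. \<xi> i \<omega>) [0..<Suc m]) \<partial>M) =
      (\<integral>\<omega>. D (?p \<omega>) * of_bool (\<xi> m \<omega>) \<partial>M) + (\<integral>\<omega>. G (?p \<omega> @ [False]) \<partial>M)"
    unfolding split by (rule Bochner_Integration.integral_add[OF DH[OF \<xi>i] intM[of "\<lambda>l. G (l @ [False])", OF G_False]])
  also have "(\<integral>\<omega>. D (?p \<omega>) * of_bool (\<xi> m \<omega>) \<partial>M) = (\<integral>\<omega>. D (?p \<omega>) * H m \<omega> \<partial>M)"
    by (rule Suc.prems(4)[OF _ D]) simp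
  also have "(\<integral>\<omega>. D (?p \<omega>) * H m \<omega> \<partial>M) =
      (\<integral>\<omega>. D (?p \<omega>) * (H m \<omega> - q) \<partial>M) + (\<integral>\<omega>. q * D (?p \<omega>) \<partial>M)"
    by (subst Bochner_Integration.integral_add[symmetric])
      (use DH[of "\<lambda>\<omega>. H m \<omega> - q"] Hm intM[of D, OF D] in \<open>auto simp: algebra_simps\<close>)
  finally have EM: "(\<integral>\<omega>. G (map (\<lambda>i. \<xi> i \<omega>) [0..<Suc m]) \<partial>M) =
      (\<integral>\<omega>. D (?p \<omega>) * (H m \<omega> - q) \<partial>M) + (\<integral>\<omega>. G' (?p \<omega>) \<partial>M)"
    unfolding G'_def using intM[of D, OF D] intM[of "\<lambda>l. G (l @ [False])", OF G_False] by simp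
  have "(\<integral>\<omega>. G (map (\<lambda>i. \<zeta> i \<omega>) [0..<Suc m]) \<partial>N) =
      (\<integral>\<omega>. D (?r \<omega>) * of_bool (\<zeta> m \<omega>) \<partial>N) + (\<integral>\<omega>. G (?r \<omega> @ [False]) \<partial>N)"
    unfolding split by (rule Bochner_Integration.integral_add[OF \<zeta>D intN[of "\<lambda>l. G (l @ [False])", OF G_False]])
  also have "(\<integral>\<omega>. D (?r \<omega>) * of_bool (\<zeta> m \<omega>) \<partial>N) = (\<integral>\<omega>. D (?r \<omega>) \<partial>N) * q"
    by (rule Suc.prems(5)[OF _ D]) simp
  finally have EN: "(\<integral>\<omega>. G (map (\<lambda>i. \<zeta> i \<omega>) [0..<Suc m]) \<partial>N) = (\<integral>\<omega>. G' (?r \<omega>) \<partial>N)"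
    unfolding G'_def using intN[of D, OF D] intN[of "\<lambda>l. G (l @ [False])", OF G_False] by simp
  have "\<bar>\<integral>\<omega>. D (?p \<omega>) * (H m \<omega> - q) \<partial>M\<bar> \<le> (\<integral>\<omega>. \<bar>D (?p \<omega>) * (H m \<omega> - q)\<bar> \<partial>M)"
    by (rule integral_abs_bound)
  also have "\<dots> \<le> (\<integral>\<omega>. 2 * B * \<bar>H m \<omega> - q\<bar> \<partial>M)"
  proof (rule integral_mono)
    show "integrable M (\<lambda>\<omega>. \<bar>D (?p \<omega>) * (H m \<omega> - q)\<bar>)"
      using DH[of "\<lambda>\<omega>. H m \<omega> - q"] Hm by auto
    show "\<bar>D (?p \<omega>) * (H m \<omega> - q)\<bar> \<le> 2 * B * \<bar>H m \<omega> - q\<bar>" for \<omega>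
      by (simp only: abs_mult) (intro mult_right_mono D abs_ge_zero)
  qed (use Hm in auto)
  also have "\<dots> = 2 * B * (\<integral>\<omega>. \<bar>H m \<omega> - q\<bar> \<partial>M)" by simp
  finally have step: "\<bar>\<integral>\<omega>. D (?p \<omega>) * (H m \<omega> - q) \<partial>M\<bar> \<le> 2 * B * (\<integral>\<omega>. \<bar>H m \<omega> - q\<bar> \<partial>M)" .
  have IH: "\<bar>(\<integral>\<omega>. G' (?p \<omega>) \<partial>M) - (\<integral>\<omega>. G' (?r \<omega>) \<partial>N)\<bar>
      \<le> 2 * B * (\<Sum>k<m. \<integral>\<omega>. \<bar>H k \<omega> - q\<bar> \<partial>M)"
  proof (rule Suc.IH)
    show "(\<integral>\<omega>. \<phi> (map (\<lambda>i. \<xi> i \<omega>) [0..<k]) * of_bool (\<xi> k \<omega>) \<partial>M) =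
        (\<integral>\<omega>. \<phi> (map (\<lambda>i. \<xi> i \<omega>) [0..<k]) * H k \<omega> \<partial>M)"
      if "k < m" "\<And>l. \<bar>\<phi> l\<bar> \<le> c" for k \<phi> c
      by (rule Suc.prems(4)[OF _ that(2)]) (use that in simp)
    show "(\<integral>\<omega>. \<phi> (map (\<lambda>i. \<zeta> i \<omega>) [0..<k]) * of_bool (\<zeta> k \<omega>) \<partial>N) =
        (\<integral>\<omega>. \<phi> (map (\<lambda>i. \<zeta> i \<omega>) [0..<k]) \<partial>N) * q"
      if "k < m" "\<And>l. \<bar>\<phi> l\<bar> \<le> c" for k \<phi> c
      by (rule Suc.prems(5)[OF _ that(2)]) (use that in simp)
  qed (use Suc.prems G' in auto)
  show ?case
    unfolding EM EN using step IH by (simp add: algebra_simps)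
qed

section \<open>The Poisson process on a lattice of cells\<close>

lemma poisson_process_props:
  assumes P: "poisson_process 1 N \<eta>"
  shows "prob_space N" "\<eta> \<in> N \<rightarrow>\<^sub>M borel_of vague_topology"
    "A \<in> sets borel_halfline \<Longrightarrow> bounded A \<Longrightarrow>
       measure N {\<omega> \<in> space N. emeasure (\<eta> \<omega>) A = of_nat k} =
       exp (- measure lborel A) * measure lborel A ^ k / fact k"
    "finite (I :: nat set) \<Longrightarrow> disjoint_family_on C I \<Longrightarrow>
       (\<And>i. i \<in> I \<Longrightarrow> C i \<in> sets borel_halfline \<and> bounded (C i)) \<Longrightarrow>
       prob_space.indep_vars N (\<lambda>_. borel) (\<lambda>i \<omega>. emeasure (\<eta> \<omega>) (C i)) I"
  using P unfolding poisson_process_def by auto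

lemma poisson_measurable:
  assumes P: "poisson_process 1 N \<eta>" and A: "A \<in> sets borel_halfline" "bounded A"
  shows "(\<lambda>\<omega>. emeasure (\<eta> \<omega>) A) \<in> borel_measurable N"
proof -
  interpret N: prob_space N by (rule poisson_process_props[OF P])
  have "N.indep_vars (\<lambda>_. borel) (\<lambda>i \<omega>. emeasure (\<eta> \<omega>) ((\<lambda>_. A) i)) {0::nat}"
    by (rule poisson_process_props(4)[OF P]) (use A in \<open>auto simp: disjoint_family_on_def\<close>)
  then show ?thesis unfolding N.indep_vars_def by simp
qed

text \<open>The occupied cells of the Poisson process are the reference sequence for \<open>bernoulli_comparison\<close>,
  with \<open>q\<close> the probability that a Poisson variable of mean \<open>\<delta>\<close> is not \<open>0\<close>.\<close>

lemma poisson_cells_bernoulli: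
  fixes \<phi> :: "bool list \<Rightarrow> real"
  assumes P: "poisson_process 1 N \<eta>" and \<delta>: "0 < \<delta>" and \<phi>: "\<And>l. \<bar>\<phi> l\<bar> \<le> c"
  defines "\<zeta> \<equiv> \<lambda>k \<omega>. emeasure (\<eta> \<omega>) (cell \<delta> k) \<noteq> 0"
  shows "(\<integral>\<omega>. \<phi> (map (\<lambda>i. \<zeta> i \<omega>) [0..<k]) * of_bool (\<zeta> k \<omega>) \<partial>N) =
      (\<integral>\<omega>. \<phi> (map (\<lambda>i. \<zeta> i \<omega>) [0..<k]) \<partial>N) * (1 - exp (- \<delta>))"
proof -
  interpret N: prob_space N by (rule poisson_process_props[OF P])
  have [measurable]: "(\<lambda>\<omega>. emeasure (\<eta> \<omega>) (cell \<delta> i)) \<in> borel_measurable N" for i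
    by (rule poisson_measurable[OF P cell_sets[OF \<delta>]]) simp
  have ind_e: "N.indep_vars (\<lambda>_. borel) (\<lambda>i \<omega>. emeasure (\<eta> \<omega>) (cell \<delta> i)) {..k}"
  proof (rule poisson_process_props(4)[OF P])
    show "disjoint_family_on (cell \<delta>) {..k}"
      unfolding disjoint_family_on_def using cell_unique[OF \<delta>] by blast
  qed (use cell_sets[OF \<delta>] in auto)
  have \<zeta>_meas: "Measurable.pred N (\<zeta> k)"
    unfolding \<zeta>_def by measurable
  from ind_e have ind: "N.indep_vars (\<lambda>_. count_space UNIV) \<zeta> {..k}"
    unfolding \<zeta>_def by (rule N.indep_vars_compose2) measurable
  have "(\<integral>\<omega>. of_bool (\<zeta> k \<omega>) \<partial>N) = measure N {\<omega> \<in> space N. \<zeta> k \<omega>}"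
    by (rule integral_of_bool)
  also have "\<dots> = 1 - measure N {\<omega> \<in> space N. \<not> \<zeta> k \<omega>}"
    by (subst N.prob_neg) (simp_all add: pred_def[symmetric] \<zeta>_meas)
  also have "measure N {\<omega> \<in> space N. \<not> \<zeta> k \<omega>} = exp (- \<delta>)"
    using poisson_process_props(3)[OF P cell_sets[OF \<delta>, of k] bounded_cell, of 0] \<delta>
    by (simp add: \<zeta>_def algebra_simps)
  finally have q: "(\<integral>\<omega>. of_bool (\<zeta> k \<omega>) \<partial>N) = 1 - exp (- \<delta>)" .
  show ?thesis
    unfolding q[symmetric]
    by (rule N.expectation_map_list_times[OF ind, where \<psi> = of_bool and C = 1]) (use \<phi> in auto)
qed

text \<open>The probability is \<open>1 - (1 + \<delta>) * exp (- \<delta>)\<close>, and \<open>exp (- \<delta>) \<ge> 1 - \<delta>\<close>.\<close>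

lemma poisson_at_most_one:
  assumes P: "poisson_process 1 N \<eta>" and \<delta>: "0 < \<delta>"
  shows "measure N {\<omega> \<in> space N. 1 < emeasure (\<eta> \<omega>) (cell \<delta> k)} \<le> \<delta>\<^sup>2"
proof -
  interpret N: prob_space N by (rule poisson_process_props[OF P])
  let ?e = "\<lambda>\<omega>. emeasure (\<eta> \<omega>) (cell \<delta> k)"
  have [measurable]: "?e \<in> borel_measurable N"
    by (rule poisson_measurable[OF P cell_sets[OF \<delta>]]) simp
  have p: "measure N {\<omega> \<in> space N. ?e \<omega> = of_nat j} = exp (- \<delta>) * \<delta> ^ j / fact j" for j
    using poisson_process_props(3)[OF P cell_sets[OF \<delta>, of k] bounded_cell, of j]
    by (simp only: measure_cell[OF \<delta>])
  have ev: "{\<omega> \<in> space N. ?e \<omega> = of_nat j} \<in> sets N" for j by measurable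
  let ?A = "{\<omega> \<in> space N. ?e \<omega> = of_nat 0} \<union> {\<omega> \<in> space N. ?e \<omega> = of_nat 1}"
  have "measure N ?A = exp (- \<delta>) + exp (- \<delta>) * \<delta>"
  proof -
    have "measure N ?A = measure N {\<omega> \<in> space N. ?e \<omega> = of_nat 0} + measure N {\<omega> \<in> space N. ?e \<omega> = of_nat 1}"
      by (rule N.finite_measure_Union[OF ev ev]) auto
    then show ?thesis unfolding p by simp
  qed
  moreover have "measure N {\<omega> \<in> space N. 1 < ?e \<omega>} \<le> measure N (space N - ?A)"
    by (rule N.finite_measure_mono[OF _ sets.compl_sets[OF sets.Un[OF ev ev]]]) auto
  moreover have "measure N (space N - ?A) = 1 - measure N ?A"
    by (rule N.prob_compl[OF sets.Un[OF ev ev]])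
  moreover have "(1 - \<delta>) * (1 + \<delta>) \<le> exp (- \<delta>) * (1 + \<delta>)"
    using exp_ge_add_one_self[of "- \<delta>"] \<delta> by (intro mult_right_mono) auto
  ultimately show ?thesis by (simp add: algebra_simps power2_eq_square)
qed

text \<open>The interval \<open>{0<..K}\<close> has \<open>K * Suc n\<close> cells of length \<open>1 / Suc n\<close>, and each holds two or more points
  with probability at most \<open>1 / (Suc n)^2\<close>; the total \<open>K / Suc n\<close> tends to \<open>0\<close>.\<close>

lemma poisson_AE_cells_simple:
  assumes P: "poisson_process 1 N \<eta>"
  shows "AE \<omega> in N. \<forall>K. \<exists>n. \<forall>i<K * Suc n. emeasure (\<eta> \<omega>) (cell (1 / real (Suc n)) i) \<le> 1"
  unfolding AE_all_countable
proof
  fix K :: nat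
  interpret N: prob_space N by (rule poisson_process_props[OF P])
  have [measurable]: "(\<lambda>\<omega>. emeasure (\<eta> \<omega>) (cell (1 / real (Suc n)) i)) \<in> borel_measurable N" for n i
    by (rule poisson_measurable[OF P cell_sets]) simp_all
  let ?bad = "\<lambda>n i. {\<omega> \<in> space N. 1 < emeasure (\<eta> \<omega>) (cell (1 / real (Suc n)) i)}"
  let ?B = "\<Inter>n. \<Union>i<K * Suc n. ?bad n i"
  have bad: "?bad n i \<in> sets N" for n i by measurable
  have Un: "(\<Union>i<K * Suc n. ?bad n i) \<in> sets N" for n
    by (intro sets.finite_UN finite_lessThan bad)
  have B: "?B \<in> sets N"
    by (rule sets.countable_INT') (use Un in auto)
  have "measure N ?B \<le> real K / real (Suc n)" for n
  proof -
    have "measure N ?B \<le> measure N (\<Union>i<K * Suc n. ?bad n i)"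
      by (rule N.finite_measure_mono[OF _ Un]) auto
    also have "\<dots> \<le> (\<Sum>i<K * Suc n. measure N (?bad n i))"
      by (rule N.finite_measure_subadditive_finite) (use bad in auto)
    also have "\<dots> \<le> (\<Sum>i<K * Suc n. (1 / real (Suc n))\<^sup>2)"
      by (rule sum_mono) (rule poisson_at_most_one[OF P], simp)
    also have "\<dots> = real K / real (Suc n)"
      by (simp add: power2_eq_square field_simps del: of_nat_Suc mult_Suc_right)
    finally show ?thesis .
  qed
  moreover have "(\<lambda>n. real K / real (Suc n)) \<longlonglongrightarrow> 0"
    using tendsto_mult[OF tendsto_const LIMSEQ_inverse_real_of_nat, of "real K"]
    by (simp add: divide_inverse)
  ultimately have "measure N ?B \<le> 0"
    by (intro LIMSEQ_le_const) (auto simp del: of_nat_Suc)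
  then have "?B \<in> null_sets N"
    using B by (auto simp: null_sets_def N.emeasure_eq_measure measure_nonneg antisym)
  then show "AE \<omega> in N. \<exists>n. \<forall>i<K * Suc n. emeasure (\<eta> \<omega>) (cell (1 / real (Suc n)) i) \<le> 1"
    by (rule AE_I') (auto simp: not_le)
qed

text \<open>A double point would put at least two points into the cell around it, for every mesh.\<close>

lemma poisson_AE_simple:
  assumes P: "poisson_process 1 N \<eta>"
  shows "AE \<omega> in N. \<exists>(I :: nat set) x. \<eta> \<omega> = dirac_sum I x \<and> locally_finite I x \<and>
    (\<forall>i\<in>I. 0 < x i) \<and> inj_on x I"
proof -
  interpret N: prob_space N by (rule poisson_process_props[OF P])
  have sets0: "{0} \<in> sets borel_halfline" by (simp add: sets_restrict_space_iff)
  have [measurable]: "(\<lambda>\<omega>. emeasure (\<eta> \<omega>) {0}) \<in> borel_measurable N"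
    by (rule poisson_measurable[OF P sets0]) simp
  have "measure N {\<omega> \<in> space N. emeasure (\<eta> \<omega>) {0} = 0} = 1"
    using poisson_process_props(3)[OF P sets0, of 0] by simp
  then have zero: "AE \<omega> in N. emeasure (\<eta> \<omega>) {0} = 0"
    by (subst (asm) N.prob_Collect_eq_1) auto
  show ?thesis
    using zero poisson_AE_cells_simple[OF P] AE_space
  proof eventually_elim
    case (elim \<omega>)
    have "\<eta> \<omega> \<in> point_measures"
      using measurable_space[OF poisson_process_props(2)[OF P] elim(3)]
      by (simp add: borel_of_def space_measure_of_conv topspace_vague_topology)
    then obtain I x where I: "\<eta> \<omega> = dirac_sum (I :: nat set) x" "locally_finite I x"
      by (rule point_measuresE)
    have pos: "0 < x i" if i: "i \<in> I" for i
    proof (rule ccontr)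
      assume "\<not> 0 < x i"
      then have "x i = 0" using I(2) i by (force simp: locally_finite_def)
      moreover have "finite {i \<in> I. x i \<in> {0}}" by (rule locally_finite_bounded[OF I(2)]) simp
      ultimately have "card {i \<in> I. x i \<in> {0}} \<noteq> 0" using i by auto
      then show False
        using elim(1) emeasure_dirac_sum[OF I(2) sets0] by (simp add: I(1))
    qed
    have "inj_on x I"
    proof (rule inj_onI, rule ccontr)
      fix i j assume ij: "i \<in> I" "j \<in> I" "x i = x j" "i \<noteq> j"
      define K where "K = nat \<lceil>x i\<rceil>"
      obtain n where n: "\<And>k. k < K * Suc n \<Longrightarrow> emeasure (\<eta> \<omega>) (cell (1 / real (Suc n)) k) \<le> 1"
        using elim(2) by blast
      define \<delta> where "\<delta> = 1 / real (Suc n)"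
      have \<delta>: "0 < \<delta>" by (simp add: \<delta>_def)
      obtain k where k: "x i \<in> cell \<delta> k" using cell_exists[OF \<delta> pos[OF ij(1)]] .
      have "real k * \<delta> < real K" using k unfolding K_def greaterThanAtMost_iff by linarith
      then have "real k < real K * real (Suc n)"
        by (simp add: \<delta>_def field_simps del: of_nat_Suc)
      then have kK: "k < K * Suc n" by (metis of_nat_less_iff of_nat_mult)
      let ?C = "{i \<in> I. x i \<in> cell \<delta> k}"
      have fin: "finite ?C" by (rule locally_finite_bounded[OF I(2)]) simp
      have "card {i, j} \<le> card ?C"
        by (rule card_mono[OF fin]) (use ij k in auto)
      then have "2 \<le> card ?C" using ij(4) by simp
      moreover have "(of_nat (card ?C) :: ennreal) \<le> of_nat 1"
        using n[OF kK] emeasure_dirac_sum[OF I(2) cell_sets[OF \<delta>, of k]]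
        unfolding I(1) \<delta>_def[symmetric] by simp
      then have "card ?C \<le> 1" unfolding of_nat_le_iff .
      ultimately show False by simp
    qed
    with I pos show ?case by blast
  qed
qed

section \<open>A criterion for convergence to the Poisson process\<close>

lemma borel_measurable_continuous_map:
  assumes "continuous_map T euclideanreal F"
  shows "F \<in> borel_measurable (borel_of T)"
proof (rule borel_measurableI)
  fix S :: "real set" assume "open S"
  then have "openin T {x \<in> topspace T. F x \<in> S}"
    using assms by (simp add: continuous_map_def)
  moreover have "F -` S \<inter> topspace T = {x \<in> topspace T. F x \<in> S}" by auto
  moreover have "{U. openin T U} \<subseteq> Pow (topspace T)" by (auto dest: openin_subset)
  ultimately show "F -` S \<inter> space (borel_of T) \<in> sets (borel_of T)"
    unfolding borel_of_def by (simp add: space_measure_of_conv)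
qed

lemma (in prob_space) integrable_bounded_continuous_map:
  assumes F: "continuous_map T euclideanreal F" and B: "\<And>x. x \<in> topspace T \<Longrightarrow> \<bar>F x\<bar> \<le> B"
    and Y: "Y \<in> M \<rightarrow>\<^sub>M borel_of T"
  shows "integrable M (\<lambda>\<omega>. F (Y \<omega>))"
proof (rule integrable_const_bound[of _ B])
  show "(\<lambda>\<omega>. F (Y \<omega>)) \<in> borel_measurable M"
    by (rule measurable_compose[OF Y borel_measurable_continuous_map[OF F]])
  have "Y \<omega> \<in> topspace T" if "\<omega> \<in> space M" for \<omega>
    using measurable_space[OF Y that] by (simp add: borel_of_def space_measure_of_conv)
  then show "AE \<omega> in M. norm (F (Y \<omega>)) \<le> B" using B by (intro AE_I2) simp
qed

text \<open>The least upper bound for \<open>F\<close> that can be given when only the first \<open>length l\<close> sites of a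
  lattice configuration are known.\<close>

definition cylinder_sup :: "(real measure \<Rightarrow> real) \<Rightarrow> real \<Rightarrow> bool list \<Rightarrow> real" where
  "cylinder_sup F \<delta> l = Sup {F (lattice_points \<delta> S) | S. \<forall>k<length l. k \<in> S \<longleftrightarrow> l ! k}"

lemma cylinder_sup:
  assumes \<delta>: "0 < \<delta>" and B: "\<And>\<mu>. \<mu> \<in> point_measures \<Longrightarrow> \<bar>F \<mu>\<bar> \<le> B"
  shows "\<forall>k<length l. k \<in> S \<longleftrightarrow> l ! k \<Longrightarrow> F (lattice_points \<delta> S) \<le> cylinder_sup F \<delta> l"
    and "\<bar>cylinder_sup F \<delta> l\<bar> \<le> B"
    and "0 < \<epsilon> \<Longrightarrow> \<exists>S. (\<forall>k<length l. k \<in> S \<longleftrightarrow> l ! k) \<and> cylinder_sup F \<delta> l < F (lattice_points \<delta> S) + \<epsilon>"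
proof -
  let ?V = "{F (lattice_points \<delta> S) | S. \<forall>k<length l. k \<in> S \<longleftrightarrow> l ! k}"
  have V: "\<bar>v\<bar> \<le> B" if "v \<in> ?V" for v
    using that B lattice_points_in_point_measures[OF \<delta>] by auto
  then have bdd: "bdd_above ?V" by (intro bdd_aboveI[of _ B]) (auto simp: abs_le_iff)
  show upper: "F (lattice_points \<delta> S) \<le> cylinder_sup F \<delta> l" if "\<forall>k<length l. k \<in> S \<longleftrightarrow> l ! k" for S
    unfolding cylinder_sup_def by (rule cSup_upper[OF _ bdd]) (use that in blast)
  have ex: "\<forall>k<length l. k \<in> {k. l ! k} \<longleftrightarrow> l ! k" by simp
  then have ne: "?V \<noteq> {}" by blast
  have "cylinder_sup F \<delta> l \<le> B"
    unfolding cylinder_sup_def by (rule cSup_least[OF ne]) (use V in \<open>simp add: abs_le_iff\<close>)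
  moreover have "- B \<le> cylinder_sup F \<delta> l"
    using upper[OF ex] B[OF lattice_points_in_point_measures[OF \<delta>, of "{k. l ! k}"]] by linarith
  ultimately show "\<bar>cylinder_sup F \<delta> l\<bar> \<le> B" by linarith
  assume \<epsilon>: "0 < \<epsilon>"
  have "\<exists>v\<in>?V. cylinder_sup F \<delta> l - \<epsilon> < v"
    unfolding cylinder_sup_def by (rule less_cSupD[OF ne]) (use \<epsilon> in simp)
  then obtain v where v: "v \<in> ?V" "cylinder_sup F \<delta> l - \<epsilon> < v" ..
  then obtain S where S: "\<forall>k<length l. k \<in> S \<longleftrightarrow> l ! k" "v = F (lattice_points \<delta> S)" by blast
  moreover have "cylinder_sup F \<delta> l < F (lattice_points \<delta> S) + \<epsilon>"
    using v(2) S(2) by linarith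
  ultimately show "\<exists>S. (\<forall>k<length l. k \<in> S \<longleftrightarrow> l ! k) \<and> cylinder_sup F \<delta> l < F (lattice_points \<delta> S) + \<epsilon>"
    by blast
qed

text \<open>Choose configurations that nearly attain the suprema. In a growing window they agree with the
  occupied cells of the given point measure, and what they do beyond the window escapes every
  test function; so they converge vaguely to the given measure, whatever was chosen there.\<close>

lemma cylinder_sup_tendsto:
  fixes I :: "nat set"
  assumes F: "continuous_map vague_topology euclideanreal F"
    and B: "\<And>\<mu>. \<mu> \<in> point_measures \<Longrightarrow> \<bar>F \<mu>\<bar> \<le> B"
    and \<delta>: "\<And>n. 0 < \<delta> n" "\<delta> \<longlonglongrightarrow> 0"
    and m: "filterlim (\<lambda>n. real (m n) * \<delta> n) at_top sequentially"
    and x: "locally_finite I x" "\<And>i. i \<in> I \<Longrightarrow> 0 < x i" "inj_on x I"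
  shows "(\<lambda>n. cylinder_sup F (\<delta> n)
      (map (\<lambda>k. emeasure (dirac_sum I x) (cell (\<delta> n) k) \<noteq> 0) [0..<m n])) \<longlonglongrightarrow> F (dirac_sum I x)"
proof -
  let ?l = "\<lambda>n. map (\<lambda>k. emeasure (dirac_sum I x) (cell (\<delta> n) k) \<noteq> 0) [0..<m n]"
  have ex: "\<forall>n. \<exists>S. (\<forall>k<m n. k \<in> S \<longleftrightarrow> emeasure (dirac_sum I x) (cell (\<delta> n) k) \<noteq> 0) \<and>
      cylinder_sup F (\<delta> n) (?l n) < F (lattice_points (\<delta> n) S) + 1 / real (Suc n)"
  proof
    fix n
    show "\<exists>S. (\<forall>k<m n. k \<in> S \<longleftrightarrow> emeasure (dirac_sum I x) (cell (\<delta> n) k) \<noteq> 0) \<and>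
      cylinder_sup F (\<delta> n) (?l n) < F (lattice_points (\<delta> n) S) + 1 / real (Suc n)"
      using cylinder_sup(3)[OF \<delta>(1)[of n], where F = F and B = B and l = "?l n" and \<epsilon> = "1 / real (Suc n)", OF B]
      by simp
  qed
  obtain S where S': "\<forall>n. (\<forall>k<m n. k \<in> S n \<longleftrightarrow> emeasure (dirac_sum I x) (cell (\<delta> n) k) \<noteq> 0) \<and>
      cylinder_sup F (\<delta> n) (?l n) < F (lattice_points (\<delta> n) (S n)) + 1 / real (Suc n)"
    by (rule exE[OF choice[OF ex]])
  have S: "k \<in> S n \<longleftrightarrow> emeasure (dirac_sum I x) (cell (\<delta> n) k) \<noteq> 0" if "k < m n" for n k
    using spec[OF S', of n, THEN conjunct1] that by blast
  have sup: "cylinder_sup F (\<delta> n) (?l n) < F (lattice_points (\<delta> n) (S n)) + 1 / real (Suc n)" for n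
    using spec[OF S', of n, THEN conjunct2] .
  have occupied: "emeasure (dirac_sum I x) (cell (\<delta> n) k) \<noteq> 0 \<longleftrightarrow> (\<exists>i\<in>I. x i \<in> cell (\<delta> n) k)" for n k
  proof -
    have "finite {i \<in> I. x i \<in> cell (\<delta> n) k}" by (rule locally_finite_bounded[OF x(1)]) simp
    then show ?thesis
      unfolding emeasure_dirac_sum[OF x(1) cell_sets[OF \<delta>(1)] bounded_cell] by auto
  qed
  have lim: "(\<lambda>n. F (lattice_points (\<delta> n) (S n))) \<longlonglongrightarrow> F (dirac_sum I x)"
  proof (rule vague_continuous_tendsto[OF F])
    show "(\<lambda>n. \<integral>y. g y \<partial>lattice_points (\<delta> n) (S n)) \<longlonglongrightarrow> (\<integral>y. g y \<partial>dirac_sum I x)"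
      if "g \<in> test_functions" for g
      by (rule lattice_points_vague_limit[OF x \<delta> m _ that]) (use S occupied in auto)
  qed (use lattice_points_in_point_measures[OF \<delta>(1)] point_measuresI[OF x(1)] in auto)
  show ?thesis
  proof (rule tendsto_sandwich[OF _ _ lim])
    show "\<forall>\<^sub>F n in sequentially. F (lattice_points (\<delta> n) (S n)) \<le> cylinder_sup F (\<delta> n) (?l n)"
      by (intro always_eventually allI cylinder_sup(1)[OF \<delta>(1) B]) (use S in simp_all)
    show "\<forall>\<^sub>F n in sequentially. cylinder_sup F (\<delta> n) (?l n) \<le>
        F (lattice_points (\<delta> n) (S n)) + 1 / real (Suc n)"
      by (intro always_eventually allI less_imp_le sup)
    show "(\<lambda>n. F (lattice_points (\<delta> n) (S n)) + 1 / real (Suc n)) \<longlonglongrightarrow> F (dirac_sum I x)"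
      using tendsto_add[OF lim LIMSEQ_inverse_real_of_nat] by (simp add: inverse_eq_divide)
  qed
qed

text \<open>If the bound failed for infinitely many \<open>n\<close>, one could choose the \<open>k\<close>-th of them so large that
  in the window of length \<open>k + 1\<close> the comparison error is below \<open>1 / (k + 1)\<close>. Along this sequence
  the mesh tends to \<open>0\<close> while the window grows, so dominated convergence for
  \<open>cylinder_sup\<close> of the occupied cells of \<open>\<eta>\<close> contradicts the failure.\<close>

lemma poisson_limit_upper:
  fixes \<xi> :: "nat \<Rightarrow> nat \<Rightarrow> 'a \<Rightarrow> bool"
  assumes M: "prob_space M" and P: "poisson_process 1 N \<eta>"
    and Y: "\<And>n. Y n \<in> M \<rightarrow>\<^sub>M borel_of vague_topology"
    and \<delta>: "\<And>n. 1 \<le> n \<Longrightarrow> 0 < \<delta> n" "\<delta> \<longlonglongrightarrow> 0"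
    and \<xi>: "\<And>n k. 1 \<le> n \<Longrightarrow> Measurable.pred M (\<xi> n k)"
    and Y_eq: "\<And>n \<omega>. 1 \<le> n \<Longrightarrow> \<omega> \<in> space M \<Longrightarrow> Y n \<omega> = lattice_points (\<delta> n) {k. \<xi> n k \<omega>}"
    and H: "\<And>n k. 1 \<le> n \<Longrightarrow> integrable M (H n k)"
    and cond: "\<And>n k \<phi> c. 1 \<le> n \<Longrightarrow> (\<And>l. \<bar>\<phi> l\<bar> \<le> c) \<Longrightarrow>
      (\<integral>\<omega>. \<phi> (map (\<lambda>i. \<xi> n i \<omega>) [0..<k]) * of_bool (\<xi> n k \<omega>) \<partial>M) =
      (\<integral>\<omega>. \<phi> (map (\<lambda>i. \<xi> n i \<omega>) [0..<k]) * H n k \<omega> \<partial>M)"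
    and err: "\<And>b. 0 < b \<Longrightarrow>
      (\<lambda>n. \<Sum>k<nat \<lceil>b / \<delta> n\<rceil>. \<integral>\<omega>. \<bar>H n k \<omega> - (1 - exp (- \<delta> n))\<bar> \<partial>M) \<longlonglongrightarrow> 0"
    and F: "continuous_map vague_topology euclideanreal F"
    and B: "\<And>\<mu>. \<mu> \<in> point_measures \<Longrightarrow> \<bar>F \<mu>\<bar> \<le> B" and \<epsilon>: "0 < (\<epsilon> :: real)"
  shows "\<forall>\<^sub>F n in sequentially. (\<integral>\<omega>. F (Y n \<omega>) \<partial>M) < (\<integral>\<omega>. F (\<eta> \<omega>) \<partial>N) + \<epsilon>"
proof (rule ccontr)
  interpret M: prob_space M by fact
  interpret N: prob_space N by (rule poisson_process_props[OF P])
  let ?err = "\<lambda>b n. \<Sum>k<nat \<lceil>b / \<delta> n\<rceil>. \<integral>\<omega>. \<bar>H n k \<omega> - (1 - exp (- \<delta> n))\<bar> \<partial>M"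
  assume "\<not> ?thesis"
  then have bad: "\<exists>n\<ge>k. \<not> (\<integral>\<omega>. F (Y n \<omega>) \<partial>M) < (\<integral>\<omega>. F (\<eta> \<omega>) \<partial>N) + \<epsilon>" for k
    unfolding eventually_sequentially by blast
  have "\<exists>n. Suc k \<le> n \<and> ?err (real (Suc k)) n < 1 / real (Suc k) \<and>
      (\<integral>\<omega>. F (\<eta> \<omega>) \<partial>N) + \<epsilon> \<le> (\<integral>\<omega>. F (Y n \<omega>) \<partial>M)" for k
  proof -
    have "\<forall>\<^sub>F n in sequentially. ?err (real (Suc k)) n < 1 / real (Suc k)"
      by (rule order_tendstoD(2)[OF err]) simp_all
    then obtain n0 where "\<And>n. n0 \<le> n \<Longrightarrow> ?err (real (Suc k)) n < 1 / real (Suc k)"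
      unfolding eventually_sequentially by blast
    then show ?thesis using bad[of "max n0 (Suc k)"] by (auto simp: not_less)
  qed
  then obtain s where s: "\<And>k. Suc k \<le> s k" "\<And>k. ?err (real (Suc k)) (s k) < 1 / real (Suc k)"
    "\<And>k. (\<integral>\<omega>. F (\<eta> \<omega>) \<partial>N) + \<epsilon> \<le> (\<integral>\<omega>. F (Y (s k) \<omega>) \<partial>M)"
    by metis
  have s1: "1 \<le> s k" for k using s(1)[of k] by simp
  define d where "d k = \<delta> (s k)" for k
  define m where "m k = nat \<lceil>real (Suc k) / d k\<rceil>" for k
  have d: "0 < d k" for k unfolding d_def by (rule \<delta>(1)[OF s1])
  have s_top: "filterlim s sequentially sequentially"
    by (rule filterlim_at_top_mono[OF filterlim_Suc]) (use s(1) in simp)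
  have d0: "d \<longlonglongrightarrow> 0"
    unfolding d_def using filterlim_compose[OF \<delta>(2) s_top] .
  have md: "real (Suc k) \<le> real (m k) * d k" for k
  proof -
    have "real (Suc k) / d k \<le> real (m k)" unfolding m_def by linarith
    then show ?thesis using d[of k] by (simp add: field_simps)
  qed
  have m_top: "filterlim (\<lambda>k. real (m k) * d k) at_top sequentially"
    by (rule filterlim_at_top_mono[OF filterlim_compose[OF filterlim_real_sequentially filterlim_Suc]])
      (use md in simp)
  define \<zeta> where "\<zeta> k i \<omega> \<longleftrightarrow> emeasure (\<eta> \<omega>) (cell (d k) i) \<noteq> 0" for k i \<omega>
  define G where "G k = cylinder_sup F (d k)" for k
  have GB: "\<bar>G k l\<bar> \<le> B" for k l unfolding G_def by (rule cylinder_sup(2)[OF d B])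
  have \<zeta>m: "Measurable.pred N (\<zeta> k i)" for k i
  proof -
    have [measurable]: "(\<lambda>\<omega>. emeasure (\<eta> \<omega>) (cell (d k) i)) \<in> borel_measurable N"
      by (rule poisson_measurable[OF P cell_sets[OF d]]) simp
    show ?thesis unfolding \<zeta>_def by measurable
  qed
  have lim: "(\<lambda>k. \<integral>\<omega>. G k (map (\<lambda>i. \<zeta> k i \<omega>) [0..<m k]) \<partial>N) \<longlonglongrightarrow> (\<integral>\<omega>. F (\<eta> \<omega>) \<partial>N)"
  proof (rule integral_dominated_convergence[where w = "\<lambda>_. B"])
    show "(\<lambda>\<omega>. F (\<eta> \<omega>)) \<in> borel_measurable N"
      by (rule measurable_compose[OF poisson_process_props(2)[OF P] borel_measurable_continuous_map[OF F]])
    show "(\<lambda>\<omega>. G k (map (\<lambda>i. \<zeta> k i \<omega>) [0..<m k])) \<in> borel_measurable N" for k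
      by (rule borel_measurable_integrable[OF N.integrable_map_list[OF \<zeta>m GB]])
    show "AE \<omega> in N. (\<lambda>k. G k (map (\<lambda>i. \<zeta> k i \<omega>) [0..<m k])) \<longlonglongrightarrow> F (\<eta> \<omega>)"
      using poisson_AE_simple[OF P]
    proof eventually_elim
      case (elim \<omega>)
      then obtain I :: "nat set" and x where *: "\<eta> \<omega> = dirac_sum I x" "locally_finite I x"
        "\<And>i. i \<in> I \<Longrightarrow> 0 < x i" "inj_on x I" by blast
      show ?case
        unfolding G_def \<zeta>_def *(1) by (rule cylinder_sup_tendsto[OF F B d d0 m_top *(2,3,4)])
    qed
  qed (use GB in auto)
  have "(\<integral>\<omega>. F (\<eta> \<omega>) \<partial>N) + \<epsilon> \<le> (\<integral>\<omega>. G k (map (\<lambda>i. \<zeta> k i \<omega>) [0..<m k]) \<partial>N) + 2 * B * (1 / real (Suc k))"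
    for k
  proof -
    have B0: "0 \<le> B" using order.trans[OF abs_ge_zero GB] .
    let ?p = "\<lambda>\<omega>. map (\<lambda>i. \<xi> (s k) i \<omega>) [0..<m k]"
    have "(\<integral>\<omega>. F (\<eta> \<omega>) \<partial>N) + \<epsilon> \<le> (\<integral>\<omega>. F (Y (s k) \<omega>) \<partial>M)" by (rule s(3))
    also have "\<dots> \<le> (\<integral>\<omega>. G k (?p \<omega>) \<partial>M)"
    proof (rule integral_mono)
      show "integrable M (\<lambda>\<omega>. F (Y (s k) \<omega>))"
        by (rule M.integrable_bounded_continuous_map[OF F _ Y]) (use B in \<open>simp add: topspace_vague_topology\<close>)
      show "integrable M (\<lambda>\<omega>. G k (?p \<omega>))"
        by (rule M.integrable_map_list[OF \<xi>[OF s1] GB])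
      show "F (Y (s k) \<omega>) \<le> G k (?p \<omega>)" if "\<omega> \<in> space M" for \<omega>
        unfolding Y_eq[OF s1 that] G_def d_def[symmetric] by (rule cylinder_sup(1)[OF d B]) simp_all
    qed
    also have "\<dots> \<le> (\<integral>\<omega>. G k (map (\<lambda>i. \<zeta> k i \<omega>) [0..<m k]) \<partial>N) +
        2 * B * (\<Sum>i<m k. \<integral>\<omega>. \<bar>H (s k) i \<omega> - (1 - exp (- d k))\<bar> \<partial>M)"
    proof -
      have "\<bar>(\<integral>\<omega>. G k (?p \<omega>) \<partial>M) - (\<integral>\<omega>. G k (map (\<lambda>i. \<zeta> k i \<omega>) [0..<m k]) \<partial>N)\<bar>
          \<le> 2 * B * (\<Sum>i<m k. \<integral>\<omega>. \<bar>H (s k) i \<omega> - (1 - exp (- d k))\<bar> \<partial>M)"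
      proof (rule bernoulli_comparison[OF M N.prob_space_axioms \<xi>[OF s1] \<zeta>m H[OF s1] cond[OF s1] _ _ _ GB])
        show "(\<integral>\<omega>. \<phi> (map (\<lambda>i. \<zeta> k i \<omega>) [0..<j]) * of_bool (\<zeta> k j \<omega>) \<partial>N) =
            (\<integral>\<omega>. \<phi> (map (\<lambda>i. \<zeta> k i \<omega>) [0..<j]) \<partial>N) * (1 - exp (- d k))"
          if "\<And>l. \<bar>\<phi> l\<bar> \<le> c" for j c and \<phi> :: "bool list \<Rightarrow> real"
          unfolding \<zeta>_def by (rule poisson_cells_bernoulli[OF P d that])
      qed (use d[of k] in auto)
      then show ?thesis by linarith
    qed
    also have "\<dots> \<le> (\<integral>\<omega>. G k (map (\<lambda>i. \<zeta> k i \<omega>) [0..<m k]) \<partial>N) + 2 * B * (1 / real (Suc k))"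
      using less_imp_le[OF s(2)[of k]] B0 unfolding m_def d_def by (intro add_left_mono mult_left_mono) simp_all
    finally show ?thesis .
  qed
  moreover have "(\<lambda>k. (\<integral>\<omega>. G k (map (\<lambda>i. \<zeta> k i \<omega>) [0..<m k]) \<partial>N) + 2 * B * (1 / real (Suc k)))
      \<longlonglongrightarrow> (\<integral>\<omega>. F (\<eta> \<omega>) \<partial>N) + 2 * B * 0"
    by (intro tendsto_add lim tendsto_mult tendsto_const LIMSEQ_inverse_real_of_nat[unfolded inverse_eq_divide])
  ultimately have "(\<integral>\<omega>. F (\<eta> \<omega>) \<partial>N) + \<epsilon> \<le> (\<integral>\<omega>. F (\<eta> \<omega>) \<partial>N) + 2 * B * 0"
    by (intro LIMSEQ_le_const) auto
  with \<epsilon> show False by simp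
qed

text \<open>The upper bound for \<open>F\<close> and for \<open>- F\<close>. Here \<open>H n k\<close> plays the role of the conditional
  probability that site \<open>k\<close> is occupied, given the sites before it. The index \<open>n = 0\<close> is left out of
  the lattice description because the time scale degenerates there.\<close>

lemma poisson_convergence_criterion:
  fixes \<xi> :: "nat \<Rightarrow> nat \<Rightarrow> 'a \<Rightarrow> bool"
  assumes M: "prob_space M" and P: "poisson_process 1 N \<eta>"
    and Y: "\<And>n. Y n \<in> M \<rightarrow>\<^sub>M borel_of vague_topology"
    and \<delta>: "\<And>n. 1 \<le> n \<Longrightarrow> 0 < \<delta> n" "\<delta> \<longlonglongrightarrow> 0"
    and \<xi>: "\<And>n k. 1 \<le> n \<Longrightarrow> Measurable.pred M (\<xi> n k)"
    and Y_eq: "\<And>n \<omega>. 1 \<le> n \<Longrightarrow> \<omega> \<in> space M \<Longrightarrow> Y n \<omega> = lattice_points (\<delta> n) {k. \<xi> n k \<omega>}"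
    and H: "\<And>n k. 1 \<le> n \<Longrightarrow> integrable M (H n k)"
    and cond: "\<And>n k \<phi> c. 1 \<le> n \<Longrightarrow> (\<And>l. \<bar>\<phi> l\<bar> \<le> c) \<Longrightarrow>
      (\<integral>\<omega>. \<phi> (map (\<lambda>i. \<xi> n i \<omega>) [0..<k]) * of_bool (\<xi> n k \<omega>) \<partial>M) =
      (\<integral>\<omega>. \<phi> (map (\<lambda>i. \<xi> n i \<omega>) [0..<k]) * H n k \<omega> \<partial>M)"
    and err: "\<And>b. 0 < b \<Longrightarrow>
      (\<lambda>n. \<Sum>k<nat \<lceil>b / \<delta> n\<rceil>. \<integral>\<omega>. \<bar>H n k \<omega> - (1 - exp (- \<delta> n))\<bar> \<partial>M) \<longlonglongrightarrow> 0"
  shows "converges_in_distribution vague_topology M Y N \<eta>"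
  unfolding converges_in_distribution_def
proof (intro conjI allI impI)
  show "Y n \<in> M \<rightarrow>\<^sub>M borel_of vague_topology" for n by (rule Y)
  show "\<eta> \<in> N \<rightarrow>\<^sub>M borel_of vague_topology" by (rule poisson_process_props[OF P])
  fix F :: "real measure \<Rightarrow> real"
  assume "continuous_map vague_topology euclideanreal F \<and> bounded (F ` topspace vague_topology)"
  then obtain B where F: "continuous_map vague_topology euclideanreal F"
    and B: "\<And>\<mu>. \<mu> \<in> point_measures \<Longrightarrow> \<bar>F \<mu>\<bar> \<le> B"
    by (auto simp: bounded_real topspace_vague_topology)
  have upper: "\<forall>\<^sub>F n in sequentially. (\<integral>\<omega>. F (Y n \<omega>) \<partial>M) < (\<integral>\<omega>. F (\<eta> \<omega>) \<partial>N) + \<epsilon>"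
    if "continuous_map vague_topology euclideanreal F" "\<And>\<mu>. \<mu> \<in> point_measures \<Longrightarrow> \<bar>F \<mu>\<bar> \<le> B" "0 < \<epsilon>"
    for F \<epsilon>
    by (rule poisson_limit_upper[where Y = Y and \<delta> = \<delta> and \<xi> = \<xi> and H = H]) (fact assms that)+
  have F': "continuous_map vague_topology euclideanreal (\<lambda>\<mu>. - F \<mu>)"
    using F by (rule continuous_map_minus)
  show "(\<lambda>n. \<integral>\<omega>. F (Y n \<omega>) \<partial>M) \<longlonglongrightarrow> (\<integral>\<omega>. F (\<eta> \<omega>) \<partial>N)"
  proof (rule order_tendstoI)
    fix a assume "a < (\<integral>\<omega>. F (\<eta> \<omega>) \<partial>N)"
    then have "\<forall>\<^sub>F n in sequentially. (\<integral>\<omega>. - F (Y n \<omega>) \<partial>M) <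
        (\<integral>\<omega>. - F (\<eta> \<omega>) \<partial>N) + ((\<integral>\<omega>. F (\<eta> \<omega>) \<partial>N) - a)"
      by (intro upper[OF F']) (use B in auto)
    then show "\<forall>\<^sub>F n in sequentially. a < (\<integral>\<omega>. F (Y n \<omega>) \<partial>M)"
      by eventually_elim simp
  next
    fix a assume "(\<integral>\<omega>. F (\<eta> \<omega>) \<partial>N) < a"
    then have "\<forall>\<^sub>F n in sequentially. (\<integral>\<omega>. F (Y n \<omega>) \<partial>M) <
        (\<integral>\<omega>. F (\<eta> \<omega>) \<partial>N) + (a - (\<integral>\<omega>. F (\<eta> \<omega>) \<partial>N))"
      by (intro upper[OF F]) (use B in auto)
    then show "\<forall>\<^sub>F n in sequentially. (\<integral>\<omega>. F (Y n \<omega>) \<partial>M) < a"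
      by eventually_elim simp
  qed
qed

section \<open>Bounds for binomial and multinomial probabilities\<close>

lemma power_le_fact_exp:
  fixes x :: real
  assumes "0 \<le> x"
  shows "x ^ k * exp (- x) \<le> fact k"
proof -
  have sums: "(\<lambda>n. x ^ n /\<^sub>R fact n) sums exp x" by (rule exp_converges)
  have "(\<Sum>n\<in>{k}. x ^ n /\<^sub>R fact n) \<le> (\<Sum>n. x ^ n /\<^sub>R fact n)"
    by (rule sum_le_suminf[OF sums_summable[OF sums]]) (use assms in auto)
  then have "x ^ k / fact k \<le> exp x"
    using sums_unique[OF sums] by (simp add: divide_inverse mult.commute)
  then show ?thesis by (simp add: exp_minus field_simps)
qed

text \<open>From \<open>(1 - p) * exp p \<ge> (1 - p) * (1 + p) = 1 - p^2\<close> and the Bernoulli inequality.\<close>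

lemma one_minus_power_exp_lower:
  fixes p :: real
  assumes "0 \<le> p" "p \<le> 1"
  shows "exp (- real n * p) * (1 - real n * p\<^sup>2) \<le> (1 - p) ^ n"
proof -
  have "1 - real n * p\<^sup>2 \<le> (1 - p\<^sup>2) ^ n"
    using Bernoulli_inequality[of "- (p\<^sup>2)" n] assms by (simp add: power_le_one)
  also have "(1 - p\<^sup>2) ^ n = ((1 - p) * (1 + p)) ^ n"
    by (simp add: algebra_simps power2_eq_square)
  also have "\<dots> \<le> ((1 - p) * exp p) ^ n"
    by (intro power_mono mult_left_mono exp_ge_add_one_self) (use assms in auto)
  also have "\<dots> = (1 - p) ^ n * exp (real n * p)"
    by (simp add: power_mult_distrib exp_of_nat_mult)
  finally have "exp (- real n * p) * (1 - real n * p\<^sup>2) \<le>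
      exp (- real n * p) * ((1 - p) ^ n * exp (real n * p))"
    by (intro mult_left_mono) auto
  also have "\<dots> = (1 - p) ^ n"
    by (simp add: exp_minus field_simps)
  finally show ?thesis .
qed

lemma binomial_times_fact_lower:
  assumes "a \<le> n"
  shows "(n - a) ^ a \<le> (n choose a) * fact a"
proof -
  have "(n - a) ^ k \<le> (n choose k) * fact k" if "k \<le> a" for k
    using that
  proof (induction k)
    case (Suc k)
    have "Suc k * (n choose Suc k) = (n - k) * (n choose k)"
      using binomial_absorption[of k n] binomial_absorb_comp[of n k] by simp
    then have "(n choose Suc k) * fact (Suc k) = (n - k) * ((n choose k) * fact k)"
      by (metis (no_types, lifting) fact_Suc mult.assoc mult.commute of_nat_id)
    moreover have "(n - a) * (n - a) ^ k \<le> (n - k) * ((n choose k) * fact k)"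
      using Suc by (intro mult_mono) auto
    ultimately show ?case by simp
  qed simp
  then show ?thesis by simp
qed

text \<open>Poisson approximation from below. The relative error \<open>n * p^2 + a^2 / n\<close> may exceed \<open>1\<close>, and then the
  claim is trivial. So the estimate holds for large \<open>p\<close> too and can be summed over all boxes.\<close>

lemma binomial_poisson_lower:
  fixes p :: real
  assumes p: "0 \<le> p" "p \<le> 1" and n: "1 \<le> n"
  shows "(real n * p) ^ a / fact a * exp (- real n * p) * (1 - real n * p\<^sup>2 - (real a)\<^sup>2 / real n)
    \<le> real (n choose a) * p ^ a * (1 - p) ^ (n - a)"
proof (cases "0 \<le> 1 - real n * p\<^sup>2 - (real a)\<^sup>2 / real n \<and> a \<le> n")
  case False
  then have "1 - real n * p\<^sup>2 - (real a)\<^sup>2 / real n \<le> 0"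
  proof (cases "a \<le> n")
    case False
    then have "real n * real n \<le> real a * real a" by (intro mult_mono) auto
    then have "real n \<le> (real a)\<^sup>2 / real n" using n by (simp add: field_simps power2_eq_square)
    moreover have "0 \<le> real n * p\<^sup>2" by simp
    ultimately show ?thesis using n by linarith
  qed (use False in auto)
  then have "(real n * p) ^ a / fact a * exp (- real n * p) * (1 - real n * p\<^sup>2 - (real a)\<^sup>2 / real n) \<le> 0"
    by (intro mult_nonneg_nonpos) (use p in auto)
  also have "0 \<le> real (n choose a) * p ^ a * (1 - p) ^ (n - a)" using p by auto
  finally show ?thesis .
next
  case True
  define u where "u = real n * p\<^sup>2"
  define w where "w = (real a)\<^sup>2 / real n"
  have uw: "0 \<le> u" "0 \<le> w" "u + w \<le> 1" using True p by (auto simp: u_def w_def)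
  have "real n ^ a * (1 - w) \<le> real n ^ a * (1 - real a / real n) ^ a"
  proof (rule mult_left_mono)
    have "real a / real n \<le> 1" using True n by simp
    then have "1 + real a * (- (real a / real n)) \<le> (1 + - (real a / real n)) ^ a"
      by (intro Bernoulli_inequality) simp
    then show "1 - w \<le> (1 - real a / real n) ^ a"
      by (simp add: w_def power2_eq_square)
  qed simp
  also have "\<dots> = real (n - a) ^ a"
  proof -
    have "1 - real a / real n = real (n - a) / real n"
      using True n by (simp add: of_nat_diff field_simps)
    then show ?thesis using n by (simp add: power_divide)
  qed
  also have "\<dots> \<le> real ((n choose a) * fact a)"
    using binomial_times_fact_lower[of a n] True by (metis of_nat_mono of_nat_power)
  finally have c: "real n ^ a / fact a * (1 - w) \<le> real (n choose a)"
    by (simp add: field_simps)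
  have e: "exp (- real n * p) * (1 - u) \<le> (1 - p) ^ (n - a)"
    using one_minus_power_exp_lower[OF p, of n] power_decreasing[of "n - a" n "1 - p"] p
    by (simp add: u_def)
  have "1 - u - w \<le> (1 - w) * (1 - u)" using uw by (simp add: algebra_simps)
  then have "(real n * p) ^ a / fact a * exp (- real n * p) * (1 - u - w) \<le>
      (real n * p) ^ a / fact a * exp (- real n * p) * ((1 - w) * (1 - u))"
    by (intro mult_left_mono) (use p in auto)
  also have "\<dots> = (real n ^ a / fact a * (1 - w)) * p ^ a * (exp (- real n * p) * (1 - u))"
    by (simp add: power_mult_distrib)
  also have "\<dots> \<le> real (n choose a) * p ^ a * (1 - p) ^ (n - a)"
    by (intro mult_mono c e order.refl) (use uw p in auto)
  finally show ?thesis by (simp add: u_def w_def)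
qed

lemma binomial_poisson_upper:
  fixes p :: real
  assumes p: "0 \<le> p" "p \<le> 1"
  shows "real (n choose a) * p ^ a * (1 - p) ^ (n - a)
    \<le> (real n * p) ^ a / fact a * exp (- (real n - real a) * p)"
proof (cases "a \<le> n")
  case True
  have c: "real (n choose a) \<le> real n ^ a / fact a"
    using binomial_fact_pow[of n a] by (simp add: field_simps) (metis of_nat_fact of_nat_le_iff of_nat_mult of_nat_power mult.commute)
  have "(1 - p) ^ (n - a) \<le> exp (- p) ^ (n - a)"
    using exp_ge_add_one_self[of "- p"] p by (intro power_mono) auto
  also have "\<dots> = exp (- (real n - real a) * p)"
    using True by (simp add: exp_of_nat_mult[symmetric] of_nat_diff algebra_simps)
  finally have e: "(1 - p) ^ (n - a) \<le> exp (- (real n - real a) * p)" .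
  have "real (n choose a) * p ^ a * (1 - p) ^ (n - a) \<le>
      (real n ^ a / fact a) * p ^ a * exp (- (real n - real a) * p)"
    by (intro mult_mono c e order.refl) (use p in auto)
  then show ?thesis by (simp add: power_mult_distrib)
next
  case False
  then have "real (n choose a) * p ^ a * (1 - p) ^ (n - a) = 0" by simp
  also have "0 \<le> (real n * p) ^ a / fact a * exp (- (real n - real a) * p)" using p by auto
  finally show ?thesis .
qed

text \<open>A product of two Poisson weights, with the exponent lowered from \<open>n\<close> to the number \<open>n - a - b\<close> of
  balls outside the two boxes. With this exponent the bound is preserved by each throw without any
  error term.\<close>

definition poisson_pair_bound :: "real \<Rightarrow> real \<Rightarrow> nat \<Rightarrow> nat \<Rightarrow> nat \<Rightarrow> real" where
  "poisson_pair_bound p q n a b = (real n * p) ^ a / fact a * ((real n * q) ^ b / fact b) *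
     exp (- (real n - real a - real b) * (p + q))"

lemma power_add_one_lower: "real n ^ a + real a * real n ^ (a - 1) \<le> real (Suc n) ^ a"
proof (induction a)
  case (Suc a)
  show ?case
  proof (cases a)
    case (Suc b)
    have "real n ^ Suc a + real (Suc a) * real n ^ a = real n * (real n ^ a + real a * real n ^ (a - 1)) + real n ^ a"
      by (simp add: Suc algebra_simps)
    also have "\<dots> \<le> real n * (real n ^ a + real a * real n ^ (a - 1)) + (real n ^ a + real a * real n ^ (a - 1))"
      by simp
    also have "\<dots> = real (Suc n) * (real n ^ a + real a * real n ^ (a - 1))"
      by (simp add: algebra_simps)
    also have "\<dots> \<le> real (Suc n) * real (Suc n) ^ a"
      by (intro mult_left_mono Suc.IH) simp
    finally show ?thesis by simp
  qed simp
qed simp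

text \<open>After division by the common factor this is
  \<open>a * n^(a-1) * n^b + b * n^a * n^(b-1) + n^a * n^b \<le> (n + 1)^a * (n + 1)^b\<close>; the last ball
  falls outside both boxes with probability \<open>1 - p - q \<le> exp (- (p + q))\<close>.\<close>

lemma poisson_pair_bound_step:
  fixes p q :: real
  assumes p: "0 \<le> p" "0 \<le> q" "p + q \<le> 1"
  shows "(if a = 0 then 0 else p * poisson_pair_bound p q n (a - 1) b) +
    (if b = 0 then 0 else q * poisson_pair_bound p q n a (b - 1)) +
    (1 - p - q) * poisson_pair_bound p q n a b \<le> poisson_pair_bound p q (Suc n) a b"
proof -
  define E where "E = exp (- (real (Suc n) - real a - real b) * (p + q))"
  define K where "K = p ^ a * q ^ b / (fact a * fact b) * E"
  have K: "0 \<le> K" using p by (simp add: K_def E_def)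
  have 1: "(if a = 0 then 0 else p * poisson_pair_bound p q n (a - 1) b) =
      K * (real a * real n ^ (a - 1) * real n ^ b)"
  proof (cases a)
    case (Suc c)
    have "E = exp (- (real n - real c - real b) * (p + q))"
      by (simp add: E_def Suc)
    then show ?thesis
      by (simp add: poisson_pair_bound_def Suc K_def power_mult_distrib field_simps del: of_nat_Suc)
  qed simp
  have 2: "(if b = 0 then 0 else q * poisson_pair_bound p q n a (b - 1)) =
      K * (real n ^ a * (real b * real n ^ (b - 1)))"
  proof (cases b)
    case (Suc c)
    have "E = exp (- (real n - real a - real c) * (p + q))"
      by (simp add: E_def Suc)
    then show ?thesis
      by (simp add: poisson_pair_bound_def Suc K_def power_mult_distrib field_simps del: of_nat_Suc)
  qed simp
  have "(1 - p - q) * poisson_pair_bound p q n a b \<le> exp (- (p + q)) * poisson_pair_bound p q n a b"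
  proof (rule mult_right_mono)
    show "1 - p - q \<le> exp (- (p + q))"
      using exp_ge_add_one_self[of "- (p + q)"] by linarith
  qed (use p in \<open>simp add: poisson_pair_bound_def\<close>)
  also have "\<dots> = (real n * p) ^ a / fact a * ((real n * q) ^ b / fact b) *
      (exp (- (real n - real a - real b) * (p + q)) * exp (- (p + q)))"
    by (simp add: poisson_pair_bound_def)
  also have "exp (- (real n - real a - real b) * (p + q)) * exp (- (p + q)) = E"
    unfolding E_def exp_add[symmetric] by (simp add: algebra_simps)
  also have "(real n * p) ^ a / fact a * ((real n * q) ^ b / fact b) * E = K * (real n ^ a * real n ^ b)"
    by (simp add: K_def power_mult_distrib field_simps)
  finally have 3: "(1 - p - q) * poisson_pair_bound p q n a b \<le> K * (real n ^ a * real n ^ b)" .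
  have "real a * real n ^ (a - 1) * real n ^ b + real n ^ a * (real b * real n ^ (b - 1)) +
      real n ^ a * real n ^ b \<le>
      (real n ^ a + real a * real n ^ (a - 1)) * (real n ^ b + real b * real n ^ (b - 1))"
    by (simp add: algebra_simps)
  also have "\<dots> \<le> real (Suc n) ^ a * real (Suc n) ^ b"
    by (intro mult_mono power_add_one_lower) auto
  finally have "K * (real a * real n ^ (a - 1) * real n ^ b + real n ^ a * (real b * real n ^ (b - 1)) +
      real n ^ a * real n ^ b) \<le> K * (real (Suc n) ^ a * real (Suc n) ^ b)"
    by (rule mult_left_mono[OF _ K])
  also have "\<dots> = poisson_pair_bound p q (Suc n) a b"
    by (simp add: poisson_pair_bound_def K_def E_def power_mult_distrib field_simps del: of_nat_Suc)
  finally show ?thesis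
    unfolding 1 2 using 3 by (simp add: algebra_simps)
qed

section \<open>Occupancy numbers\<close>

lemma occupancy_0 [simp]: "occupancy X j 0 \<omega> = 0"
  by (simp add: occupancy_def)

lemma occupancy_Suc: "occupancy X j (Suc n) \<omega> = occupancy X j n \<omega> + of_bool (X (Suc n) \<omega> = j)"
proof (cases "X (Suc n) \<omega> = j")
  case True
  then have "{i \<in> {1..Suc n}. X i \<omega> = j} = insert (Suc n) {i \<in> {1..n}. X i \<omega> = j}"
    by (auto simp: le_Suc_eq)
  then show ?thesis using True by (simp add: occupancy_def)
next
  case False
  then have "{i \<in> {1..Suc n}. X i \<omega> = j} = {i \<in> {1..n}. X i \<omega> = j}"
    by (auto simp: le_Suc_eq)
  then show ?thesis using False by (simp add: occupancy_def)
qed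

context occupancy_scheme
begin

definition past :: "nat \<Rightarrow> 'a \<Rightarrow> nat list" where
  "past n \<omega> = map (\<lambda>i. X i \<omega>) [1..<Suc n]"

lemma occupancy_past: "occupancy X j n \<omega> = count_list (past n \<omega>) j"
  by (induction n) (auto simp: past_def occupancy_Suc)

lemma measurable_X [measurable]: "1 \<le> i \<Longrightarrow> X i \<in> M \<rightarrow>\<^sub>M count_space UNIV"
  using balls_indep by (auto simp: indep_vars_def)

lemma measurable_past [measurable]: "past n \<in> M \<rightarrow>\<^sub>M count_space UNIV"
  unfolding past_def by (rule measurable_map_list) (auto intro: measurable_X)

lemma measurable_occupancy [measurable]: "occupancy X j n \<in> M \<rightarrow>\<^sub>M count_space UNIV"
proof -
  have "(\<lambda>\<omega>. count_list (past n \<omega>) j) \<in> M \<rightarrow>\<^sub>M count_space UNIV"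
    by (rule measurable_compose[OF measurable_past]) simp
  then show ?thesis by (simp flip: occupancy_past)
qed

lemma integrable_past:
  fixes \<phi> :: "nat list \<Rightarrow> real"
  assumes "\<And>l. \<bar>\<phi> l\<bar> \<le> B"
  shows "integrable M (\<lambda>\<omega>. \<phi> (past n \<omega>))"
  by (rule integrable_const_bound[of _ B, OF _ measurable_compose[OF measurable_past]])
    (use assms in auto)

lemma p_summable: "summable p" and p_suminf: "(\<Sum>j. p j) = 1"
  using p_sums by (auto simp: sums_iff)

lemma p_pair_le_1: "j \<noteq> k \<Longrightarrow> p j + p k \<le> 1"
  using sum_le_suminf[OF p_summable, of "{j, k}"] p_pos by (simp add: p_suminf less_imp_le)

lemma p_le_1: "p j \<le> 1"
  using sum_le_suminf[OF p_summable, of "{j}"] p_pos by (simp add: p_suminf less_imp_le)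

lemma expectation_past_next_ball:
  fixes \<phi> :: "nat list \<Rightarrow> real"
  assumes \<phi>: "\<And>l. \<bar>\<phi> l\<bar> \<le> B"
  shows "expectation (\<lambda>\<omega>. \<phi> (past n \<omega>) * of_bool (X (Suc n) \<omega> = j)) =
    expectation (\<lambda>\<omega>. \<phi> (past n \<omega>)) * p j"
proof -
  have "expectation (\<lambda>\<omega>. of_bool (X (Suc n) \<omega> = j)) = p j"
    by (simp add: integral_of_bool balls_distr)
  moreover have "expectation (\<lambda>\<omega>. \<phi> (past n \<omega>) * of_bool (X (Suc n) \<omega> = j)) =
      expectation (\<lambda>\<omega>. \<phi> (past n \<omega>)) * expectation (\<lambda>\<omega>. of_bool (X (Suc n) \<omega> = j))"
    unfolding past_def
    by (rule expectation_map_list_times[OF balls_indep, where B = B and C = 1 and \<psi> = "\<lambda>c. of_bool (c = j)"])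
      (use \<phi> in auto)
  ultimately show ?thesis by simp
qed

definition occ_prob :: "nat \<Rightarrow> nat \<Rightarrow> nat \<Rightarrow> real" where
  "occ_prob a n j = expectation (\<lambda>\<omega>. of_bool (occupancy X j n \<omega> = a))"

definition pair_prob :: "nat \<Rightarrow> nat \<Rightarrow> nat \<Rightarrow> nat \<Rightarrow> nat \<Rightarrow> real" where
  "pair_prob a b n j k =
     expectation (\<lambda>\<omega>. of_bool (occupancy X j n \<omega> = a) * of_bool (occupancy X k n \<omega> = b))"

text \<open>Condition on the last ball.\<close>

lemma occ_prob_binomial: "occ_prob a n j = real (n choose a) * p j ^ a * (1 - p j) ^ (n - a)"
proof (induction n arbitrary: a)
  case 0
  show ?case by (cases a) (simp_all add: occ_prob_def prob_space)
next
  case (Suc n)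
  let ?A = "\<lambda>a l. of_bool (count_list l j = a) :: real"
  let ?B = "\<lambda>l. if a = 0 then 0 else ?A (a - 1) l"
  have int: "integrable M (\<lambda>\<omega>. \<phi> (past n \<omega>) * of_bool (X (Suc n) \<omega> = j))"
    if "\<And>l. \<bar>\<phi> l\<bar> \<le> 1" for \<phi> :: "nat list \<Rightarrow> real"
    by (rule integrable_const_bound[of _ 1]) (use that in auto)
  have "(of_bool (occupancy X j (Suc n) \<omega> = a) :: real) =
      ?B (past n \<omega>) * of_bool (X (Suc n) \<omega> = j) + (?A a (past n \<omega>) - ?A a (past n \<omega>) * of_bool (X (Suc n) \<omega> = j))"
    for \<omega>
    by (auto simp: occupancy_Suc occupancy_past)
  then have "occ_prob a (Suc n) j = expectation (\<lambda>\<omega>. ?B (past n \<omega>) * of_bool (X (Suc n) \<omega> = j)) +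
      (expectation (\<lambda>\<omega>. ?A a (past n \<omega>)) - expectation (\<lambda>\<omega>. ?A a (past n \<omega>) * of_bool (X (Suc n) \<omega> = j)))"
    unfolding occ_prob_def
    using int[of ?B] int[of "?A a"] integrable_past[of "?A a" 1 n] by simp
  also have "\<dots> = (if a = 0 then 0 else occ_prob (a - 1) n j) * p j + occ_prob a n j * (1 - p j)"
    by (subst (1 2) expectation_past_next_ball[where B = 1])
      (auto simp: occ_prob_def occupancy_past algebra_simps)
  finally have rec: "occ_prob a (Suc n) j =
      (if a = 0 then 0 else occ_prob (a - 1) n j) * p j + occ_prob a n j * (1 - p j)" .
  show ?case
  proof (cases a)
    case 0
    then show ?thesis unfolding rec Suc.IH by simp
  next
    case (Suc b)
    show ?thesis
    proof (cases "Suc b \<le> n")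
      case True
      then have "n - b = Suc (n - Suc b)" by simp
      then show ?thesis unfolding rec Suc.IH unfolding Suc by (simp add: algebra_simps)
    next
      case False
      then show ?thesis unfolding rec Suc.IH unfolding Suc by (cases "b = n") (auto simp: algebra_simps binomial_eq_0)
    qed
  qed
qed

lemma pair_prob_upper:
  assumes jk: "j \<noteq> k"
  shows "pair_prob a b n j k \<le> poisson_pair_bound (p j) (p k) n a b"
proof (induction n arbitrary: a b)
  case 0
  show ?case
    using p_pos[of j] p_pos[of k]
    by (cases a; cases b) (simp_all add: pair_prob_def poisson_pair_bound_def prob_space)
next
  case (Suc n)
  let ?A = "\<lambda>a b l. of_bool (count_list l j = a) * of_bool (count_list l k = b) :: real"
  let ?B = "\<lambda>l. if a = 0 then 0 else ?A (a - 1) b l"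
  let ?C = "\<lambda>l. if b = 0 then 0 else ?A a (b - 1) l"
  let ?J = "\<lambda>\<omega>. of_bool (X (Suc n) \<omega> = j) :: real" and ?K = "\<lambda>\<omega>. of_bool (X (Suc n) \<omega> = k) :: real"
  have int: "integrable M (\<lambda>\<omega>. \<phi> (past n \<omega>) * of_bool (X (Suc n) \<omega> = i))"
    if "\<And>l. \<bar>\<phi> l\<bar> \<le> 1" for \<phi> :: "nat list \<Rightarrow> real" and i
    by (rule integrable_const_bound[of _ 1]) (use that in auto)
  have "(of_bool (occupancy X j (Suc n) \<omega> = a) * of_bool (occupancy X k (Suc n) \<omega> = b) :: real) =
      ?B (past n \<omega>) * ?J \<omega> + ?C (past n \<omega>) * ?K \<omega> +
      (?A a b (past n \<omega>) - ?A a b (past n \<omega>) * ?J \<omega> - ?A a b (past n \<omega>) * ?K \<omega>)" for \<omega>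
    using jk by (auto simp: occupancy_Suc occupancy_past)
  then have "pair_prob a b (Suc n) j k =
      expectation (\<lambda>\<omega>. ?B (past n \<omega>) * ?J \<omega>) + expectation (\<lambda>\<omega>. ?C (past n \<omega>) * ?K \<omega>) +
      (expectation (\<lambda>\<omega>. ?A a b (past n \<omega>)) - expectation (\<lambda>\<omega>. ?A a b (past n \<omega>) * ?J \<omega>) -
       expectation (\<lambda>\<omega>. ?A a b (past n \<omega>) * ?K \<omega>))"
    unfolding pair_prob_def
    using int[of ?B j] int[of ?C k] int[of "?A a b" j] int[of "?A a b" k] integrable_past[of "?A a b" 1 n]
    by simp
  also have "\<dots> = (if a = 0 then 0 else p j * pair_prob (a - 1) b n j k) +
      (if b = 0 then 0 else p k * pair_prob a (b - 1) n j k) + (1 - p j - p k) * pair_prob a b n j k"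
    by (subst (1 2 3 4) expectation_past_next_ball[where B = 1])
      (auto simp: pair_prob_def occupancy_past algebra_simps)
  also have "\<dots> \<le> (if a = 0 then 0 else p j * poisson_pair_bound (p j) (p k) n (a - 1) b) +
      (if b = 0 then 0 else p k * poisson_pair_bound (p j) (p k) n a (b - 1)) +
      (1 - p j - p k) * poisson_pair_bound (p j) (p k) n a b"
    using p_pair_le_1[OF jk] p_pos[of j] p_pos[of k]
    by (intro add_mono) (auto intro!: mult_left_mono Suc.IH)
  also have "\<dots> \<le> poisson_pair_bound (p j) (p k) (Suc n) a b"
    using p_pair_le_1[OF jk] p_pos[of j] p_pos[of k] by (intro poisson_pair_bound_step) auto
  finally show ?case .
qed

section \<open>The intensity of records\<close>

definition phi_term :: "nat \<Rightarrow> real \<Rightarrow> nat \<Rightarrow> real" where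
  "phi_term r t j = exp (- t * p j) * (t * p j) ^ r / fact r"

lemma phi_term_nonneg: "0 \<le> t \<Longrightarrow> 0 \<le> phi_term r t j"
  using p_pos[of j] by (simp add: phi_term_def)

lemma phi_term_le_1:
  assumes "0 \<le> t"
  shows "phi_term r t j \<le> 1"
  using power_le_fact_exp[of "t * p j" r] assms p_pos[of j]
  by (simp add: phi_term_def field_simps)

lemma phi_term_times: "t * p j * phi_term r t j = real (Suc r) * phi_term (Suc r) t j"
  by (simp add: phi_term_def field_simps del: of_nat_Suc)

lemma phi_term_le:
  assumes "0 \<le> t" "1 \<le> r"
  shows "phi_term r t j \<le> t * p j"
proof -
  obtain a where r: "r = Suc a" using assms(2) by (cases r) auto
  have "phi_term r t j \<le> real r * phi_term r t j"
    using mult_right_mono[of 1 "real r" "phi_term r t j"] assms phi_term_nonneg by simp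
  also have "\<dots> = t * p j * phi_term a t j" by (simp add: r phi_term_times)
  also have "\<dots> \<le> t * p j * 1"
    using assms p_pos[of j] by (intro mult_left_mono phi_term_le_1) auto
  finally show ?thesis by simp
qed

lemma Phi_sums:
  assumes "0 \<le> t" "1 \<le> r"
  shows "phi_term r t sums Phi p r t"
proof -
  have "summable (phi_term r t)"
    by (rule summable_comparison_test'[OF summable_mult[OF p_summable, of t], of 0])
      (use assms phi_term_nonneg phi_term_le in auto)
  then show ?thesis
    unfolding Phi_def phi_term_def[abs_def, symmetric]
    by (simp add: phi_term_def[abs_def] sums_iff)
qed

lemma Phi_pos:
  assumes "0 < t" "1 \<le> r"
  shows "0 < Phi p r t"
proof -
  have "0 < suminf (phi_term r t)"
    by (rule suminf_pos[OF sums_summable[OF Phi_sums]])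
      (use assms p_pos in \<open>auto simp: phi_term_def\<close>)
  then show ?thesis using Phi_sums[of t r] assms by (simp add: sums_iff)
qed

lemma Phi_le:
  assumes "0 \<le> t" "1 \<le> r"
  shows "Phi p r t \<le> t"
  using sums_le[OF _ Phi_sums[OF assms] sums_mult[OF p_sums, of t]] phi_term_le[OF assms] by simp

text \<open>The conditional probability, given the first \<open>n\<close> balls, that the next ball falls in a box with
  exactly \<open>a\<close> balls and so is a record of order \<open>a + 1\<close>.\<close>

definition hazard :: "nat \<Rightarrow> nat \<Rightarrow> 'a \<Rightarrow> real" where
  "hazard a n \<omega> = (\<Sum>j. p j * of_bool (occupancy X j n \<omega> = a))"

lemma summable_hazard: "summable (\<lambda>j. p j * of_bool (occupancy X j n \<omega> = a))"
  by (rule summable_comparison_test'[OF p_summable, of 0]) (use p_pos in \<open>auto simp: less_imp_le\<close>)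

lemma hazard_bounds: "0 \<le> hazard a n \<omega>" "hazard a n \<omega> \<le> 1"
proof -
  show "0 \<le> hazard a n \<omega>"
    unfolding hazard_def by (rule suminf_nonneg[OF summable_hazard]) (use p_pos in \<open>auto simp: less_imp_le\<close>)
  show "hazard a n \<omega> \<le> 1"
    unfolding hazard_def p_suminf[symmetric]
    by (rule suminf_le[OF _ summable_hazard p_summable]) (use p_pos in \<open>auto simp: less_imp_le\<close>)
qed

lemma measurable_hazard [measurable]: "hazard a n \<in> borel_measurable M"
  unfolding hazard_def[abs_def] by measurable

lemma integrable_hazard: "integrable M (hazard a n)"
  by (rule integrable_const_bound[of _ 1]) (use hazard_bounds in auto)

text \<open>Interchange of sum and expectation; the terms are dominated by \<open>p j * B\<close>.\<close>

lemma expectation_times_hazard: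
  assumes Y [measurable]: "Y \<in> borel_measurable M" and B: "\<And>\<omega>. \<bar>Y \<omega>\<bar> \<le> B"
  shows "(\<lambda>j. p j * expectation (\<lambda>\<omega>. Y \<omega> * of_bool (occupancy X j n \<omega> = a))) sums
    expectation (\<lambda>\<omega>. Y \<omega> * hazard a n \<omega>)"
proof -
  let ?f = "\<lambda>j \<omega>. p j * (Y \<omega> * of_bool (occupancy X j n \<omega> = a))"
  have B0: "0 \<le> B" using order.trans[OF abs_ge_zero B] .
  have le: "\<bar>?f j \<omega>\<bar> \<le> p j * B" for j \<omega>
    using B[of \<omega>] p_pos[of j] B0 by (auto simp: abs_mult intro!: mult_left_mono)
  have int: "integrable M (?f j)" for j
    by (rule integrable_const_bound[of _ "p j * B"]) (use le in auto)
  have sumB: "summable (\<lambda>j. p j * B)" by (rule summable_mult2[OF p_summable])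
  have sum1: "AE \<omega> in M. summable (\<lambda>j. norm (?f j \<omega>))"
    by (intro always_eventually allI summable_comparison_test'[OF sumB, of 0]) (use le in simp)
  have sum2: "summable (\<lambda>j. expectation (\<lambda>\<omega>. norm (?f j \<omega>)))"
  proof (rule summable_comparison_test'[OF sumB, of 0])
    fix j
    have "expectation (\<lambda>\<omega>. norm (?f j \<omega>)) \<le> expectation (\<lambda>_. p j * B)"
      by (rule integral_mono) (use le int in auto)
    then show "norm (expectation (\<lambda>\<omega>. norm (?f j \<omega>))) \<le> p j * B"
      by (simp add: prob_space)
  qed
  have "Y \<omega> * hazard a n \<omega> = (\<Sum>j. ?f j \<omega>)" for \<omega>
    unfolding hazard_def by (subst suminf_mult[OF summable_hazard, symmetric]) (simp add: mult_ac)
  then have "expectation (\<lambda>\<omega>. Y \<omega> * hazard a n \<omega>) = (\<Sum>j. expectation (?f j))"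
    using integral_suminf[OF int sum1 sum2] by simp
  then show ?thesis
    using summable_integral[OF int sum1 sum2] by (simp add: sums_iff)
qed

text \<open>The hazard is the conditional probability of a record: split by the box that receives the next ball,
  which is independent of the past.\<close>

lemma expectation_past_record:
  fixes \<phi> :: "nat list \<Rightarrow> real"
  assumes \<phi>: "\<And>l. \<bar>\<phi> l\<bar> \<le> B"
  shows "expectation (\<lambda>\<omega>. \<phi> (past n \<omega>) * of_bool (occupancy X (X (Suc n) \<omega>) n \<omega> = a)) =
    expectation (\<lambda>\<omega>. \<phi> (past n \<omega>) * hazard a n \<omega>)"
proof -
  let ?\<psi> = "\<lambda>j l. \<phi> l * of_bool (count_list l j = a)"
  let ?f = "\<lambda>j \<omega>. ?\<psi> j (past n \<omega>) * of_bool (X (Suc n) \<omega> = j)"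
  have B0: "0 \<le> B" using order.trans[OF abs_ge_zero \<phi>] .
  have \<psi>: "\<bar>?\<psi> j l\<bar> \<le> B" for j l using \<phi>[of l] B0 by auto
  have step: "expectation (?f j) = p j * expectation (\<lambda>\<omega>. ?\<psi> j (past n \<omega>))" for j
    using expectation_past_next_ball[of "?\<psi> j", OF \<psi>] by (simp add: mult.commute)
  have meas: "(\<lambda>\<omega>. \<phi>' (past n \<omega>)) \<in> borel_measurable M" for \<phi>' :: "nat list \<Rightarrow> real"
    by (rule measurable_compose[OF measurable_past]) simp
  have int: "integrable M (?f j)" for j
    by (rule integrable_const_bound[of _ B]) (use \<psi> B0 meas in auto)
  have sum1: "AE \<omega> in M. summable (\<lambda>j. norm (?f j \<omega>))"
    by (intro always_eventually allI, rule summable_finite[of "{X (Suc n) _}"]) auto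
  have sum2: "summable (\<lambda>j. expectation (\<lambda>\<omega>. norm (?f j \<omega>)))"
  proof (rule summable_comparison_test'[OF summable_mult[OF p_summable, of B], of 0])
    fix j
    have "expectation (\<lambda>\<omega>. norm (?f j \<omega>)) =
        expectation (\<lambda>\<omega>. \<bar>?\<psi> j (past n \<omega>)\<bar> * of_bool (X (Suc n) \<omega> = j))"
      by (simp add: abs_mult)
    also have "\<dots> = expectation (\<lambda>\<omega>. \<bar>?\<psi> j (past n \<omega>)\<bar>) * p j"
      by (rule expectation_past_next_ball[where \<phi> = "\<lambda>l. \<bar>?\<psi> j l\<bar>" and B = B]) (use \<psi> in simp)
    also have "\<dots> \<le> expectation (\<lambda>_. B) * p j"
      using integrable_past[of "\<lambda>l. \<bar>?\<psi> j l\<bar>" B n] \<psi> p_pos[of j]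
      by (intro mult_right_mono integral_mono) auto
    finally show "norm (expectation (\<lambda>\<omega>. norm (?f j \<omega>))) \<le> B * p j"
      by (simp add: prob_space)
  qed
  have "\<phi> (past n \<omega>) * of_bool (occupancy X (X (Suc n) \<omega>) n \<omega> = a) = (\<Sum>j. ?f j \<omega>)" for \<omega>
    by (subst suminf_finite[of "{X (Suc n) \<omega>}"]) (auto simp: occupancy_past)
  then have "expectation (\<lambda>\<omega>. \<phi> (past n \<omega>) * of_bool (occupancy X (X (Suc n) \<omega>) n \<omega> = a)) =
      (\<Sum>j. expectation (?f j))"
    using integral_suminf[OF int sum1 sum2] by simp
  also have "\<dots> = (\<Sum>j. p j * expectation (\<lambda>\<omega>. \<phi> (past n \<omega>) * of_bool (occupancy X j n \<omega> = a)))"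
    by (simp only: step occupancy_past)
  also have "\<dots> = expectation (\<lambda>\<omega>. \<phi> (past n \<omega>) * hazard a n \<omega>)"
    by (rule sums_unique[OF expectation_times_hazard, symmetric]) (use \<phi> meas in auto)
  finally show ?thesis .
qed

section \<open>Concentration of the hazard\<close>

text \<open>The errors of \<open>binomial_poisson_lower\<close> add up to a constant, uniformly in \<open>n\<close>. With \<open>x = n * p j\<close>, the
  first one contributes \<open>x^2 / n * phi_term\<close>, which is at most a constant times \<open>p j\<close> because
  \<open>x * phi_term\<close> is bounded; the second one contributes \<open>a^2 / n * Phi \<le> a^2\<close>.\<close>

lemma hazard_mean_lower:
  assumes n: "1 \<le> n"
  shows "Phi p (Suc a) (real n) - (real (Suc (Suc a)) * real (Suc (Suc (Suc a))) + (real a)\<^sup>2)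
    \<le> real n / real (Suc a) * expectation (hazard a n)"
proof -
  let ?r = "Suc a" and ?t = "real n"
  define c where "c = real (Suc (Suc a)) * real (Suc (Suc (Suc a)))"
  have t: "0 < ?t" using n by simp
  have mean: "(\<lambda>j. p j * occ_prob a n j) sums expectation (hazard a n)"
    using expectation_times_hazard[of "\<lambda>_. 1" 1 n a] by (simp add: occ_prob_def)
  have le: "phi_term ?r ?t j - c * p j - (real a)\<^sup>2 / ?t * phi_term ?r ?t j \<le> ?t / real ?r * (p j * occ_prob a n j)"
    for j
  proof -
    have p: "0 \<le> p j" "p j \<le> 1" using p_pos[of j] p_le_1[of j] by auto
    have g: "?t * p j / real ?r * ((?t * p j) ^ a / fact a * exp (- ?t * p j)) = phi_term ?r ?t j"
      by (simp add: phi_term_def field_simps del: of_nat_Suc)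
    have "?t * (p j)\<^sup>2 * phi_term ?r ?t j = p j * (?t * p j * phi_term ?r ?t j)"
      by (simp add: power2_eq_square)
    also have "\<dots> = p j * (real (Suc ?r) * phi_term (Suc ?r) ?t j)"
      unfolding phi_term_times ..
    also have "\<dots> \<le> p j * (real (Suc ?r) * 1)"
      using p t by (intro mult_left_mono phi_term_le_1) auto
    also have "\<dots> \<le> c * p j"
      using p unfolding c_def by (simp add: algebra_simps)
    finally have x: "?t * (p j)\<^sup>2 * phi_term ?r ?t j \<le> c * p j" .
    have "phi_term ?r ?t j - c * p j - (real a)\<^sup>2 / ?t * phi_term ?r ?t j \<le>
        phi_term ?r ?t j * (1 - ?t * (p j)\<^sup>2 - (real a)\<^sup>2 / ?t)"
      using x by (simp add: algebra_simps)
    also have "\<dots> = ?t * p j / real ?r *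
        ((?t * p j) ^ a / fact a * exp (- ?t * p j) * (1 - ?t * (p j)\<^sup>2 - (real a)\<^sup>2 / ?t))"
      unfolding g[symmetric] by (simp only: mult.assoc)
    also have "\<dots> \<le> ?t * p j / real ?r * occ_prob a n j"
      unfolding occ_prob_binomial by (intro mult_left_mono binomial_poisson_lower p n) (use p in auto)
    finally show ?thesis by simp
  qed
  have "Phi p ?r ?t - c * 1 - (real a)\<^sup>2 / ?t * Phi p ?r ?t \<le> ?t / real ?r * expectation (hazard a n)"
    by (rule sums_le[OF le sums_diff[OF sums_diff[OF Phi_sums sums_mult[OF p_sums]]
          sums_mult[OF Phi_sums]] sums_mult[OF mean]]) (use t in auto)
  moreover have "(real a)\<^sup>2 / ?t * Phi p ?r ?t \<le> (real a)\<^sup>2 / ?t * ?t"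
    by (intro mult_left_mono Phi_le) auto
  ultimately show ?thesis using t by (simp add: c_def)
qed

text \<open>For distinct boxes the bound on the joint probability is a product \<open>W j * W k\<close>, so their sum is at
  most the square of \<open>S\<close>, the sum of all \<open>p j * W j\<close>. Rescaled, \<open>S\<close> exceeds \<open>Phi p (Suc a)\<close> by at most a
  constant: the shifted exponent costs a factor \<open>exp (2 * a * p j) \<le> 1 + const * p j\<close>. The
  diagonal carries one more factor \<open>n * p j\<close> and is therefore of the order of the next \<open>Phi\<close>.\<close>

lemma hazard_second_moment_upper:
  assumes n: "1 \<le> n"
  shows "(real n / real (Suc a))\<^sup>2 * expectation (\<lambda>\<omega>. (hazard a n \<omega>)\<^sup>2) \<le>
    (Phi p (Suc a) (real n) + 2 * real a * exp (2 * real a))\<^sup>2 +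
    exp (real a) * real (Suc (Suc a)) * Phi p (Suc (Suc a)) (real n)"
proof -
  let ?r = "Suc a" and ?t = "real n"
  have t: "0 < ?t" using n by simp
  define W where "W j = (?t * p j) ^ a / fact a * exp (- (?t - 2 * real a) * p j)" for j
  define c where "c = 2 * real a * exp (2 * real a)"
  have p0: "0 \<le> p j" for j using p_pos[of j] by simp
  have W0: "0 \<le> W j" for j using p0[of j] by (simp add: W_def)
  have W_phi: "?t / real ?r * (p j * W j) = phi_term ?r ?t j * exp (2 * real a * p j)" for j
  proof -
    have "exp (- (?t - 2 * real a) * p j) = exp (- ?t * p j) * exp (2 * real a * p j)"
      unfolding exp_add[symmetric] by (simp add: algebra_simps)
    then show ?thesis by (simp add: W_def phi_term_def field_simps del: of_nat_Suc)
  qed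
  have W_upper: "?t / real ?r * (p j * W j) \<le> phi_term ?r ?t j + c * p j" for j
  proof -
    define y where "y = 2 * real a * p j"
    have y: "0 \<le> y" "y \<le> 2 * real a"
      using p0[of j] p_le_1[of j] by (auto simp: y_def intro: mult_left_le)
    have "(1 - y) * exp y \<le> exp (- y) * exp y"
      using exp_ge_add_one_self[of "- y"] by (intro mult_right_mono) auto
    then have "exp y \<le> 1 + y * exp y" by (simp add: exp_minus algebra_simps)
    also have "\<dots> \<le> 1 + y * exp (2 * real a)"
      using y by (intro add_left_mono mult_left_mono) auto
    finally have "phi_term ?r ?t j * exp y \<le> phi_term ?r ?t j * (1 + y * exp (2 * real a))"
      using t by (intro mult_left_mono phi_term_nonneg) auto
    also have "\<dots> \<le> phi_term ?r ?t j + 1 * (y * exp (2 * real a))"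
      using phi_term_le_1[of ?t ?r j] t y by (simp only: distrib_left mult_1_right)
        (intro add_left_mono mult_right_mono; simp)
    finally show ?thesis unfolding W_phi y_def c_def by (simp add: mult_ac)
  qed
  have Phi_c: "(\<lambda>j. phi_term ?r ?t j + c * p j) sums (Phi p ?r ?t + c)"
    using sums_add[OF Phi_sums[of ?t ?r] sums_mult[OF p_sums, of c]] t by simp
  have sumW': "summable (\<lambda>j. ?t / real ?r * (p j * W j))"
    by (rule summable_comparison_test'[OF sums_summable[OF Phi_c], of 0])
      (use W_upper W0 p0 t in \<open>auto simp del: of_nat_Suc\<close>)
  then have sumW: "summable (\<lambda>j. p j * W j)"
    using summable_mult[OF sumW', of "real ?r / ?t"] t by (simp add: field_simps del: of_nat_Suc)
  define S where "S = (\<Sum>j. p j * W j)"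
  have S0: "0 \<le> S" unfolding S_def by (rule suminf_nonneg[OF sumW]) (use W0 p0 in auto)
  have S: "?t / real ?r * S \<le> Phi p ?r ?t + c"
    unfolding S_def suminf_mult[OF sumW, symmetric]
    by (rule sums_le[OF W_upper summable_sums[OF sumW'] Phi_c])
  have pair: "expectation (\<lambda>\<omega>. of_bool (occupancy X j n \<omega> = a) * of_bool (occupancy X k n \<omega> = a)) \<le>
      W j * W k + (if k = j then occ_prob a n j else 0)" for j k
  proof (cases "j = k")
    case True
    have "occ_prob a n k = expectation (\<lambda>\<omega>. of_bool (occupancy X k n \<omega> = a) * of_bool (occupancy X k n \<omega> = a))"
      unfolding occ_prob_def by (rule Bochner_Integration.integral_cong) auto
    then show ?thesis using True W0[of k] by simp
  next
    case False
    have "pair_prob a a n j k \<le> poisson_pair_bound (p j) (p k) n a a" by (rule pair_prob_upper[OF False])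
    also have "\<dots> = W j * W k"
    proof -
      have "exp (- (?t - real a - real a) * (p j + p k)) =
          exp (- (?t - 2 * real a) * p j) * exp (- (?t - 2 * real a) * p k)"
        unfolding exp_add[symmetric] by (simp add: algebra_simps)
      then show ?thesis by (simp add: poisson_pair_bound_def W_def)
    qed
    finally show ?thesis using False by (simp add: pair_prob_def)
  qed
  have single: "expectation (\<lambda>\<omega>. of_bool (occupancy X j n \<omega> = a) * hazard a n \<omega>) \<le>
      W j * S + p j * occ_prob a n j" for j
  proof (rule sums_le[OF _ expectation_times_hazard])
    show "(\<lambda>k. W j * (p k * W k) + (if k = j then p k * occ_prob a n k else 0)) sums (W j * S + p j * occ_prob a n j)"
      unfolding S_def by (intro sums_add sums_mult summable_sums sumW sums_single)
    show "p k * expectation (\<lambda>\<omega>. of_bool (occupancy X j n \<omega> = a) * of_bool (occupancy X k n \<omega> = a)) \<le>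
        W j * (p k * W k) + (if k = j then p k * occ_prob a n k else 0)" for k
      using mult_left_mono[OF pair[of j k] p0[of k]] by (auto simp: algebra_simps split: if_splits)
    show "\<bar>of_bool (occupancy X j n \<omega> = a)\<bar> \<le> (1::real)" for \<omega> by simp
  qed measurable
  define d where "d = exp (real a) * real (Suc ?r)"
  have diag: "(?t / real ?r)\<^sup>2 * ((p j)\<^sup>2 * occ_prob a n j) \<le> d * phi_term (Suc ?r) ?t j" for j
  proof -
    have "occ_prob a n j \<le> (?t * p j) ^ a / fact a * exp (- (?t - real a) * p j)"
      unfolding occ_prob_binomial by (rule binomial_poisson_upper) (use p0 p_le_1 in auto)
    also have "\<dots> \<le> (?t * p j) ^ a / fact a * (exp (- ?t * p j) * exp (real a))"
    proof (intro mult_left_mono)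
      have "- (?t - real a) * p j \<le> - ?t * p j + real a"
        using mult_left_le[OF p_le_1[of j], of "real a"] by (simp add: algebra_simps)
      then show "exp (- (?t - real a) * p j) \<le> exp (- ?t * p j) * exp (real a)"
        unfolding exp_add[symmetric] by simp
    qed (use p0 in simp)
    finally have o: "occ_prob a n j \<le> (?t * p j) ^ a / fact a * (exp (- ?t * p j) * exp (real a))" .
    have "(?t / real ?r)\<^sup>2 * ((p j)\<^sup>2 * occ_prob a n j) = (?t * p j / real ?r)\<^sup>2 * occ_prob a n j"
      by (simp add: power_mult_distrib power_divide)
    also have "\<dots> \<le> (?t * p j / real ?r)\<^sup>2 * ((?t * p j) ^ a / fact a * (exp (- ?t * p j) * exp (real a)))"
      by (rule mult_left_mono[OF o]) simp
    also have "\<dots> = (1 / real ?r) * (d * phi_term (Suc ?r) ?t j)"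
      by (simp add: d_def phi_term_def power2_eq_square field_simps del: of_nat_Suc)
    also have "\<dots> \<le> 1 * (d * phi_term (Suc ?r) ?t j)"
      using t by (intro mult_right_mono mult_nonneg_nonneg phi_term_nonneg) (auto simp: d_def)
    finally show ?thesis by simp
  qed
  have "(?t / real ?r)\<^sup>2 * expectation (\<lambda>\<omega>. hazard a n \<omega> * hazard a n \<omega>) \<le>
      (?t / real ?r * S) * (?t / real ?r * S) + d * Phi p (Suc ?r) ?t"
  proof (rule sums_le[OF _ sums_mult[OF expectation_times_hazard]])
    show "(\<lambda>j. (?t / real ?r * S) * (?t / real ?r * (p j * W j)) + d * phi_term (Suc ?r) ?t j) sums
        ((?t / real ?r * S) * (?t / real ?r * S) + d * Phi p (Suc ?r) ?t)"
      unfolding S_def by (intro sums_add sums_mult Phi_sums summable_sums sumW) (use t in auto)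
    show "(?t / real ?r)\<^sup>2 * (p j * expectation (\<lambda>\<omega>. hazard a n \<omega> * of_bool (occupancy X j n \<omega> = a))) \<le>
        (?t / real ?r * S) * (?t / real ?r * (p j * W j)) + d * phi_term (Suc ?r) ?t j" for j
    proof -
      have "(?t / real ?r)\<^sup>2 * (p j * expectation (\<lambda>\<omega>. hazard a n \<omega> * of_bool (occupancy X j n \<omega> = a))) \<le>
          (?t / real ?r)\<^sup>2 * (p j * (W j * S + p j * occ_prob a n j))"
        using single[of j] p0[of j] by (intro mult_left_mono) (auto simp: mult.commute)
      also have "\<dots> = (?t / real ?r * S) * (?t / real ?r * (p j * W j)) +
          (?t / real ?r)\<^sup>2 * ((p j)\<^sup>2 * occ_prob a n j)"
        by (simp add: power2_eq_square field_simps del: of_nat_Suc)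
      finally show ?thesis using diag[of j] by linarith
    qed
    show "\<bar>hazard a n \<omega>\<bar> \<le> 1" for \<omega> using hazard_bounds[of a n \<omega>] by simp
  qed measurable
  also have "(?t / real ?r * S) * (?t / real ?r * S) \<le> (Phi p ?r ?t + c) * (Phi p ?r ?t + c)"
    using S S0 t by (intro mult_mono) (auto intro: order.trans[OF _ S])
  finally show ?thesis by (simp add: power2_eq_square c_def d_def)
qed

text \<open>The leading terms \<open>Phi^2 - 2 * Phi * Phi + Phi^2\<close> cancel.\<close>

lemma hazard_L2_bound:
  "\<exists>C\<ge>0. \<forall>n\<ge>1. expectation (\<lambda>\<omega>. (real n / real (Suc a) * hazard a n \<omega> - Phi p (Suc a) (real n))\<^sup>2) \<le>
     C * (Phi p (Suc (Suc a)) (real n) + Phi p (Suc a) (real n) + 1)"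
proof -
  define c1 where "c1 = real (Suc (Suc a)) * real (Suc (Suc (Suc a))) + (real a)\<^sup>2"
  define c2 where "c2 = 2 * real a * exp (2 * real a)"
  define d where "d = exp (real a) * real (Suc (Suc a))"
  define C where "C = d + 2 * (c1 + c2) + c2\<^sup>2"
  have pos: "0 \<le> c1" "0 \<le> c2" "0 \<le> d" by (simp_all add: c1_def c2_def d_def)
  have "expectation (\<lambda>\<omega>. (real n / real (Suc a) * hazard a n \<omega> - Phi p (Suc a) (real n))\<^sup>2) \<le>
     C * (Phi p (Suc (Suc a)) (real n) + Phi p (Suc a) (real n) + 1)" if n: "1 \<le> n" for n
  proof -
    define w where "w = real n / real (Suc a)"
    define \<Phi> where "\<Phi> = Phi p (Suc a) (real n)"
    define \<Phi>' where "\<Phi>' = Phi p (Suc (Suc a)) (real n)"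
    have \<Phi>: "0 \<le> \<Phi>" "0 \<le> \<Phi>'" using Phi_pos[of "real n"] n by (auto simp: \<Phi>_def \<Phi>'_def less_imp_le)
    have sq: "integrable M (\<lambda>\<omega>. (hazard a n \<omega>)\<^sup>2)"
      by (rule integrable_const_bound[of _ 1])
        (use hazard_bounds[of a n] in \<open>auto intro: power_le_one\<close>)
    have "expectation (\<lambda>\<omega>. (w * hazard a n \<omega> - \<Phi>)\<^sup>2) =
        expectation (\<lambda>\<omega>. w\<^sup>2 * (hazard a n \<omega>)\<^sup>2 - 2 * \<Phi> * (w * hazard a n \<omega>) + \<Phi>\<^sup>2)"
      by (rule Bochner_Integration.integral_cong) (auto simp: power2_eq_square algebra_simps)
    also have "\<dots> = w\<^sup>2 * expectation (\<lambda>\<omega>. (hazard a n \<omega>)\<^sup>2) - 2 * \<Phi> * (w * expectation (hazard a n)) + \<Phi>\<^sup>2"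
      using sq integrable_hazard[of a n] by (simp add: prob_space)
    also have "\<dots> \<le> ((\<Phi> + c2)\<^sup>2 + d * \<Phi>') - 2 * \<Phi> * (\<Phi> - c1) + \<Phi>\<^sup>2"
      using hazard_second_moment_upper[OF n, of a] hazard_mean_lower[OF n, of a] \<Phi>(1)
      unfolding w_def[symmetric] \<Phi>_def[symmetric] \<Phi>'_def[symmetric] c1_def[symmetric]
        c2_def[symmetric] d_def[symmetric]
      by (intro add_right_mono diff_mono mult_left_mono) auto
    also have "\<dots> = d * \<Phi>' + 2 * (c1 + c2) * \<Phi> + c2\<^sup>2"
      by (simp add: power2_eq_square algebra_simps)
    also have "\<dots> \<le> C * \<Phi>' + C * \<Phi> + C * 1"
      by (intro add_mono mult_right_mono) (use pos \<Phi> in \<open>auto simp: C_def\<close>)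
    finally show ?thesis by (simp add: w_def \<Phi>_def \<Phi>'_def algebra_simps)
  qed
  moreover have "0 \<le> C" using pos by (simp add: C_def)
  ultimately show ?thesis by blast
qed

text \<open>The expected number of records per ball around time \<open>t\<close>; its inverse is the time scale
  \<open>record_scale\<close>, so it is also the mesh of the rescaled lattice.\<close>

definition intensity :: "nat \<Rightarrow> real \<Rightarrow> real" where
  "intensity r t = real r * Phi p r t / t"

text \<open>The \<open>L2\<close> bound, divided by \<open>Phi^2\<close>, tends to \<open>0\<close> by the two hypotheses; the \<open>L1\<close> norm is
  dominated through \<open>2 * c * \<bar>z\<bar> \<le> c^2 + z^2\<close>.\<close>

lemma hazard_L1_concentration:
  assumes top: "filterlim (Phi p (Suc a)) at_top at_top"
    and small: "((\<lambda>t. Phi p (Suc (Suc a)) t / (Phi p (Suc a) t)\<^sup>2) \<longlongrightarrow> 0) at_top"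
    and \<epsilon>: "0 < \<epsilon>"
  shows "\<forall>\<^sub>F n in sequentially.
    expectation (\<lambda>\<omega>. \<bar>hazard a n \<omega> - intensity (Suc a) (real n)\<bar>) \<le> \<epsilon> * intensity (Suc a) (real n)"
proof -
  obtain C where C: "0 \<le> C" "\<And>n. 1 \<le> n \<Longrightarrow>
      expectation (\<lambda>\<omega>. (real n / real (Suc a) * hazard a n \<omega> - Phi p (Suc a) (real n))\<^sup>2) \<le>
      C * (Phi p (Suc (Suc a)) (real n) + Phi p (Suc a) (real n) + 1)"
    using hazard_L2_bound[of a] by blast
  let ?P = "\<lambda>n. Phi p (Suc a) (real n)" and ?Q = "\<lambda>n. Phi p (Suc (Suc a)) (real n)"
  have top': "filterlim ?P at_top sequentially"
    by (rule filterlim_compose[OF top filterlim_real_sequentially])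
  have inv: "(\<lambda>n. inverse (?P n)) \<longlonglongrightarrow> 0"
    by (rule filterlim_compose[OF tendsto_inverse_0_at_top[OF filterlim_ident] top'])
  have "(\<lambda>n. C * (?Q n / (?P n)\<^sup>2 + inverse (?P n) + inverse (?P n) * inverse (?P n))) \<longlonglongrightarrow> C * (0 + 0 + 0 * 0)"
    by (intro tendsto_mult tendsto_add tendsto_const inv
        filterlim_compose[OF small filterlim_real_sequentially])
  then have "(\<lambda>n. C * (?Q n / (?P n)\<^sup>2 + inverse (?P n) + inverse (?P n) * inverse (?P n))) \<longlonglongrightarrow> 0"
    by simp
  then have "\<forall>\<^sub>F n in sequentially. C * (?Q n / (?P n)\<^sup>2 + inverse (?P n) + inverse (?P n) * inverse (?P n)) < \<epsilon>\<^sup>2"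
    by (rule order_tendstoD(2)) (use \<epsilon> in simp)
  then show ?thesis
    using eventually_ge_at_top[of "1 :: nat"]
  proof eventually_elim
    case (elim n)
    define w where "w = real n / real (Suc a)"
    define \<Phi> where "\<Phi> = Phi p (Suc a) (real n)"
    have w: "0 < w" using elim(2) by (simp add: w_def)
    have \<Phi>: "0 < \<Phi>" using Phi_pos[of "real n" "Suc a"] elim(2) by (simp add: \<Phi>_def)
    have "C * (?Q n + \<Phi> + 1) / \<Phi>\<^sup>2 < \<epsilon>\<^sup>2"
      using elim(1) \<Phi> by (simp add: \<Phi>_def[symmetric] field_simps power2_eq_square)
    then have "C * (?Q n + \<Phi> + 1) \<le> \<epsilon>\<^sup>2 * \<Phi>\<^sup>2"
      using \<Phi> by (simp add: field_simps)
    then have sq: "expectation (\<lambda>\<omega>. (w * hazard a n \<omega> - \<Phi>)\<^sup>2) \<le> (\<epsilon> * \<Phi>)\<^sup>2"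
      using C(2)[OF elim(2)] by (simp add: w_def \<Phi>_def power_mult_distrib)
    define c where "c = \<epsilon> * \<Phi>"
    have c: "0 < c" using \<epsilon> \<Phi> by (simp add: c_def)
    have int: "integrable M (\<lambda>\<omega>. w * hazard a n \<omega> - \<Phi>)"
      using integrable_hazard[of a n] by simp
    have int2: "integrable M (\<lambda>\<omega>. (w * hazard a n \<omega> - \<Phi>)\<^sup>2)"
    proof (rule integrable_const_bound[of _ "(w + \<Phi>)\<^sup>2"])
      have "\<bar>w * hazard a n \<omega> - \<Phi>\<bar> \<le> w + \<Phi>" for \<omega>
      proof -
        have "0 \<le> w * hazard a n \<omega>" "w * hazard a n \<omega> \<le> w"
          using hazard_bounds[of a n \<omega>] w by (auto intro: mult_left_le)
        then show ?thesis using w \<Phi> by linarith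
      qed
      then have "(w * hazard a n \<omega> - \<Phi>)\<^sup>2 \<le> (w + \<Phi>)\<^sup>2" for \<omega>
        using power_mono[of "\<bar>w * hazard a n \<omega> - \<Phi>\<bar>" "w + \<Phi>" 2] by simp
      then show "AE \<omega> in M. norm ((w * hazard a n \<omega> - \<Phi>)\<^sup>2) \<le> (w + \<Phi>)\<^sup>2" by simp
    qed measurable
    have "2 * c * expectation (\<lambda>\<omega>. \<bar>w * hazard a n \<omega> - \<Phi>\<bar>) =
        expectation (\<lambda>\<omega>. 2 * c * \<bar>w * hazard a n \<omega> - \<Phi>\<bar>)" by simp
    also have "\<dots> \<le> expectation (\<lambda>\<omega>. c\<^sup>2 + (w * hazard a n \<omega> - \<Phi>)\<^sup>2)"
    proof (rule integral_mono)
      show "2 * c * \<bar>w * hazard a n \<omega> - \<Phi>\<bar> \<le> c\<^sup>2 + (w * hazard a n \<omega> - \<Phi>)\<^sup>2" for \<omega>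
        using sum_squares_bound[of c "\<bar>w * hazard a n \<omega> - \<Phi>\<bar>"] by simp
    qed (use int int2 in auto)
    also have "\<dots> = c\<^sup>2 + expectation (\<lambda>\<omega>. (w * hazard a n \<omega> - \<Phi>)\<^sup>2)"
      using int2 by (simp add: prob_space)
    also have "\<dots> \<le> 2 * c * c" using sq unfolding c_def[symmetric] by (simp add: power2_eq_square)
    finally have "c * expectation (\<lambda>\<omega>. \<bar>w * hazard a n \<omega> - \<Phi>\<bar>) \<le> c * c" by simp
    then have L1: "expectation (\<lambda>\<omega>. \<bar>w * hazard a n \<omega> - \<Phi>\<bar>) \<le> \<epsilon> * \<Phi>"
      unfolding c_def[symmetric] using mult_le_cancel_left_pos[OF c] by blast
    have "\<bar>hazard a n \<omega> - intensity (Suc a) (real n)\<bar> = \<bar>w * hazard a n \<omega> - \<Phi>\<bar> / w" for \<omega>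
    proof -
      have "hazard a n \<omega> - intensity (Suc a) (real n) = (w * hazard a n \<omega> - \<Phi>) / w"
        using w by (simp add: intensity_def w_def \<Phi>_def field_simps del: of_nat_Suc)
      then show ?thesis using w by (simp add: abs_divide)
    qed
    then have "expectation (\<lambda>\<omega>. \<bar>hazard a n \<omega> - intensity (Suc a) (real n)\<bar>) =
        expectation (\<lambda>\<omega>. \<bar>w * hazard a n \<omega> - \<Phi>\<bar>) / w" by simp
    also have "\<dots> \<le> \<epsilon> * \<Phi> / w" using L1 w by (simp add: divide_right_mono)
    also have "\<dots> = \<epsilon> * intensity (Suc a) (real n)"
      by (simp add: intensity_def w_def \<Phi>_def)
    finally show ?case .
  qed
qed

section \<open>Regular variation of the intensity\<close>

text \<open>Each term loses at most the factor \<open>exp (- (t - s) * p j) \<ge> 1 - (t - s) * p j\<close>, and a factor \<open>p j\<close>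
  turns a term of \<open>Phi p r s\<close> into one of \<open>Phi p (Suc r) s\<close>.\<close>

lemma Phi_forward_lower:
  assumes s: "0 < s" "s \<le> t" and r: "1 \<le> r"
  shows "Phi p r s - (t - s) / s * (real (Suc r) * Phi p (Suc r) s) \<le> Phi p r t"
proof (rule sums_le[OF _ sums_diff[OF Phi_sums sums_mult[OF sums_mult[OF Phi_sums]]] Phi_sums])
  fix j
  have p: "0 < p j" by (rule p_pos)
  have "(1 - (t - s) * p j) * phi_term r s j \<le> exp (- (t - s) * p j) * phi_term r s j"
    using exp_ge_add_one_self[of "- (t - s) * p j"] s
    by (intro mult_right_mono phi_term_nonneg) (auto simp: algebra_simps)
  also have "\<dots> = (exp (- (t - s) * p j) * exp (- s * p j)) * (s * p j) ^ r / fact r"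
    by (simp add: phi_term_def)
  also have "exp (- (t - s) * p j) * exp (- s * p j) = exp (- t * p j)"
    unfolding exp_add[symmetric] by (simp add: algebra_simps)
  also have "exp (- t * p j) * (s * p j) ^ r / fact r \<le> phi_term r t j"
    unfolding phi_term_def using s p by (intro divide_right_mono mult_left_mono power_mono) auto
  finally have "(1 - (t - s) * p j) * phi_term r s j \<le> phi_term r t j" .
  moreover have "(1 - (t - s) * p j) * phi_term r s j = phi_term r s j - (t - s) / s * (s * p j * phi_term r s j)"
    using s(1) by (simp add: field_simps)
  ultimately have "phi_term r s j - (t - s) / s * (s * p j * phi_term r s j) \<le> phi_term r t j" by simp
  then show "phi_term r s j - (t - s) / s * (real (Suc r) * phi_term (Suc r) s j) \<le> phi_term r t j"
    unfolding phi_term_times .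
qed (use s r in auto)

text \<open>Going back from \<open>t\<close> to \<open>s\<close>, each term gains at least \<open>exp ((t - s) * p j) \<ge> 1 + (t - s) * p j\<close>, up to
  the factor \<open>(s / t)^r\<close>. So a large \<open>Phi p (Suc r) t\<close> makes \<open>Phi p r\<close> large shortly before \<open>t\<close>. Dropping
  the second summand bounds the growth of \<open>Phi p r\<close>.\<close>

lemma Phi_backward_lower:
  assumes s: "0 < s" "s \<le> t" and r: "1 \<le> r"
  shows "Phi p r t + (t - s) / t * (real (Suc r) * Phi p (Suc r) t) \<le> (t / s) ^ r * Phi p r s"
proof (rule sums_le[OF _ sums_add[OF Phi_sums sums_mult[OF sums_mult[OF Phi_sums]]] sums_mult[OF Phi_sums]])
  fix j
  have p: "0 < p j" by (rule p_pos)
  have "phi_term r t j + (t - s) / t * (t * p j * phi_term r t j) = (1 + (t - s) * p j) * phi_term r t j"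
    using less_le_trans[OF s] by (simp add: field_simps)
  also have "\<dots> \<le> exp ((t - s) * p j) * phi_term r t j"
    using s by (intro mult_right_mono exp_ge_add_one_self phi_term_nonneg) auto
  also have "\<dots> = (exp ((t - s) * p j) * exp (- t * p j)) * (t * p j) ^ r / fact r"
    by (simp add: phi_term_def)
  also have "exp ((t - s) * p j) * exp (- t * p j) = exp (- s * p j)"
    unfolding exp_add[symmetric] by (simp add: algebra_simps)
  also have "exp (- s * p j) * (t * p j) ^ r / fact r = (t / s) ^ r * phi_term r s j"
    using s by (simp add: phi_term_def power_mult_distrib power_divide)
  finally show "phi_term r t j + (t - s) / t * (real (Suc r) * phi_term (Suc r) t j) \<le> (t / s) ^ r * phi_term r s j"
    unfolding phi_term_times .
qed (use s r in auto)

lemma Phi_isCont: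
  assumes s: "0 < s" and r: "1 \<le> r"
  shows "isCont (Phi p r) s"
proof -
  have lim: "((\<lambda>t. phi_term r t j) \<longlongrightarrow> phi_term r s j) (at s)" for j
    unfolding phi_term_def by (intro tendsto_intros) auto
  have ev: "\<forall>\<^sub>F t in at s. 0 < t \<and> t < s + 1"
    using s by (intro eventually_conj order_tendstoD[OF tendsto_ident_at]) auto
  have "\<forall>\<^sub>F t in at s. \<forall>j. norm (phi_term r t j) \<le> (s + 1) * p j"
    using ev
  proof eventually_elim
    case (elim t)
    show ?case
    proof
      fix j
      have "phi_term r t j \<le> t * p j" using elim r by (intro phi_term_le) auto
      also have "\<dots> \<le> (s + 1) * p j" using elim p_pos[of j] by (intro mult_right_mono) auto
      finally show "norm (phi_term r t j) \<le> (s + 1) * p j" using elim phi_term_nonneg by simp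
    qed
  qed
  then have "\<forall>\<^sub>F (j, t) in at_top \<times>\<^sub>F at s. \<forall>j. norm (phi_term r t j) \<le> (s + 1) * p j"
    unfolding eventually_prod_filter
    by (intro exI[of _ "\<lambda>_. True"] exI[of _ "\<lambda>t. \<forall>j. norm (phi_term r t j) \<le> (s + 1) * p j"]) auto
  then have bound: "\<forall>\<^sub>F (j, t) in at_top \<times>\<^sub>F at s. norm (phi_term r t j) \<le> (s + 1) * p j"
    by (rule eventually_mono) auto
  have "((\<lambda>t. \<Sum>j. phi_term r t j) \<longlongrightarrow> (\<Sum>j. phi_term r s j)) (at s)"
    using tannerys_theorem[OF lim bound summable_mult[OF p_summable]] by simp
  then show ?thesis
    unfolding isCont_def Phi_def phi_term_def .
qed

text \<open>The terms \<open>p j * (x^a * exp (- x) / fact a)\<close> with \<open>x = n * p j\<close> are dominated by \<open>p j\<close> and tend to \<open>0\<close>.\<close>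

lemma intensity_tendsto_0: "(\<lambda>n. intensity (Suc a) (real n)) \<longlonglongrightarrow> 0"
proof -
  have "((\<lambda>x :: real. x ^ a * exp (- x)) \<longlongrightarrow> 0) at_top"
    using tendsto_power_div_exp_0[of a] by (simp add: exp_minus divide_inverse)
  moreover have "filterlim (\<lambda>n. real n * p j) at_top sequentially" for j
    by (rule filterlim_at_top_mult_tendsto_pos[OF tendsto_const p_pos filterlim_real_sequentially,
          simplified mult.commute])
  ultimately have lim0: "(\<lambda>n. (real n * p j) ^ a * exp (- (real n * p j))) \<longlonglongrightarrow> 0" for j
    by (rule filterlim_compose)
  have lim: "(\<lambda>n. p j * ((real n * p j) ^ a * exp (- (real n * p j)) / fact a)) \<longlonglongrightarrow> 0" for j
    using tendsto_mult_left[OF tendsto_divide[OF lim0[of j] tendsto_const[of "fact a"]], of "p j"] by simp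
  have le: "norm (p j * ((real n * p j) ^ a * exp (- (real n * p j)) / fact a)) \<le> p j" for j n
  proof -
    have "(real n * p j) ^ a * exp (- (real n * p j)) / fact a \<le> 1"
      using power_le_fact_exp[of "real n * p j" a] p_pos[of j] by simp
    then have "p j * ((real n * p j) ^ a * exp (- (real n * p j)) / fact a) \<le> p j"
      using p_pos[of j] by (intro mult_left_le) auto
    then show ?thesis using p_pos[of j] by simp
  qed
  have bound: "\<forall>\<^sub>F (j, n) in at_top \<times>\<^sub>F sequentially.
      norm (p j * ((real n * p j) ^ a * exp (- (real n * p j)) / fact a)) \<le> p j"
    by (rule always_eventually) (use le in auto)
  have lim_sum: "(\<lambda>n. \<Sum>j. p j * ((real n * p j) ^ a * exp (- (real n * p j)) / fact a)) \<longlonglongrightarrow> (\<Sum>j. 0)"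
    using tannerys_theorem[OF lim bound p_summable] by simp
  have "(\<Sum>j. p j * ((real n * p j) ^ a * exp (- (real n * p j)) / fact a)) = intensity (Suc a) (real n)"
    if "1 \<le> n" for n
  proof -
    have "(\<lambda>j. real (Suc a) / real n * phi_term (Suc a) (real n) j) sums (real (Suc a) / real n * Phi p (Suc a) (real n))"
      by (intro sums_mult Phi_sums) auto
    moreover have "real (Suc a) / real n * phi_term (Suc a) (real n) j =
        p j * ((real n * p j) ^ a * exp (- (real n * p j)) / fact a)" for j
      using that by (simp add: phi_term_def field_simps del: of_nat_Suc)
    ultimately show ?thesis by (simp add: sums_iff intensity_def)
  qed
  then have "\<forall>\<^sub>F n in sequentially. (\<Sum>j. p j * ((real n * p j) ^ a * exp (- (real n * p j)) / fact a)) =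
      intensity (Suc a) (real n)"
    by (rule eventually_mono[OF eventually_ge_at_top])
  from Lim_transform_eventually[OF lim_sum this] show ?thesis by simp
qed

text \<open>Apply \<open>Phi_backward_lower\<close> to \<open>s\<close> and \<open>T s = s + record_scale p r s\<close>. By the first condition with
  \<open>\<theta> = 1\<close>, \<open>Phi p r\<close> has nearly the same value at both times, and this leaves no room for
  \<open>Phi p (Suc r) (T s)\<close> of the order \<open>(Phi p r (T s))^2\<close>: the ratio is at most \<open>Q s\<close>, which tends to \<open>0\<close>.
  Every large time is of the form \<open>T s\<close>, since \<open>T\<close> is continuous.\<close>

lemma second_condition_of_first:
  assumes r: "1 \<le> r" and top: "filterlim (Phi p r) at_top at_top"
    and first: "((\<lambda>t. Phi p r (t + record_scale p r t * 1) / Phi p r t) \<longlongrightarrow> 1) at_top"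
  shows "((\<lambda>t. Phi p (Suc r) t / (Phi p r t)\<^sup>2) \<longlongrightarrow> 0) at_top"
proof -
  define T where "T s = s + record_scale p r s" for s
  define R where "R s = Phi p r (T s) / Phi p r s" for s
  define \<delta> where "\<delta> s = 1 / (real r * Phi p r s)" for s
  define Q where "Q s = real r / real (Suc r) * (1 + \<delta> s) * inverse (R s) * ((1 + \<delta> s) ^ r * inverse (R s) - 1)" for s
  have R1: "(R \<longlongrightarrow> 1) at_top" using first by (simp add: R_def[abs_def] T_def)
  have "((\<lambda>s. inverse (real r) * inverse (Phi p r s)) \<longlongrightarrow> inverse (real r) * 0) at_top"
    by (intro tendsto_mult tendsto_const filterlim_compose[OF tendsto_inverse_0_at_top[OF filterlim_ident] top])
  then have \<delta>0: "(\<delta> \<longlongrightarrow> 0) at_top" by (simp add: \<delta>_def[abs_def] divide_inverse)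
  have "(Q \<longlongrightarrow> real r / real (Suc r) * (1 + 0) * inverse 1 * ((1 + 0) ^ r * inverse 1 - 1)) at_top"
    unfolding Q_def by (intro tendsto_intros R1 \<delta>0) auto
  then have Q0: "(Q \<longlongrightarrow> 0) at_top" by simp
  have T_scale: "T s = s * (1 + \<delta> s)" if "0 < s" for s
    using r Phi_pos[OF that r] by (simp add: T_def record_scale_def \<delta>_def field_simps)
  have \<delta>pos: "0 < \<delta> s" if "0 < s" for s
    using r Phi_pos[OF that r] by (simp add: \<delta>_def)
  have T_ge: "s \<le> T s" if "0 < s" for s
    unfolding T_scale[OF that] using \<delta>pos[OF that] that by simp
  have bound: "Phi p (Suc r) (T s) / (Phi p r (T s))\<^sup>2 \<le> Q s" if s: "0 < s" for s
  proof -
    define d where "d = \<delta> s"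
    define x where "x = Phi p r s"
    define y where "y = Phi p r (T s)"
    define z where "z = Phi p (Suc r) (T s)"
    have Tpos: "0 < T s" using T_ge[OF s] s by simp
    have d: "0 < d" and x: "0 < x" and y: "0 < y"
      using \<delta>pos[OF s] Phi_pos[OF s r] Phi_pos[OF Tpos r] by (auto simp: d_def x_def y_def)
    have d_x: "d = 1 / (real r * x)" by (simp add: d_def \<delta>_def x_def)
    have Ts: "T s = s * (1 + d)" using T_scale[OF s] by (simp add: d_def)
    have "T s - s = s * d" by (simp add: Ts algebra_simps)
    then have ratio: "T s / s = 1 + d" "(T s - s) / T s = d / (1 + d)"
      using s d by (simp_all add: Ts)
    have "y + d / (1 + d) * (real (Suc r) * z) \<le> (1 + d) ^ r * x"
      using Phi_backward_lower[OF s T_ge[OF s] r] unfolding ratio y_def z_def x_def .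
    then have "d / (1 + d) * (real (Suc r) * z) \<le> (1 + d) ^ r * x - y" by simp
    then have "real (Suc r) * z \<le> ((1 + d) ^ r * x - y) * ((1 + d) / d)"
      using d by (simp add: field_simps)
    also have "(1 + d) / d = (1 + d) * (real r * x)"
      using x r by (simp add: d_x)
    finally have "z \<le> ((1 + d) ^ r * x - y) * ((1 + d) * (real r * x)) / real (Suc r)"
      by (simp add: field_simps)
    then have "z / y\<^sup>2 \<le> ((1 + d) ^ r * x - y) * ((1 + d) * (real r * x)) / real (Suc r) / y\<^sup>2"
      by (intro divide_right_mono) auto
    also have "\<dots> = Q s"
      using x y unfolding Q_def R_def d_def[symmetric] x_def[symmetric] y_def[symmetric]
      by (simp add: field_simps power2_eq_square del: of_nat_Suc)
    finally show ?thesis by (simp add: z_def y_def)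
  qed
  show ?thesis
  proof (rule order_tendstoI)
    fix c :: real assume "c < 0"
    show "\<forall>\<^sub>F t in at_top. c < Phi p (Suc r) t / (Phi p r t)\<^sup>2"
      using eventually_gt_at_top[of 0]
    proof eventually_elim
      case (elim t)
      then have "0 < Phi p (Suc r) t / (Phi p r t)\<^sup>2"
        using Phi_pos[OF elim, of r] Phi_pos[OF elim, of "Suc r"] r by simp
      with \<open>c < 0\<close> show ?case by simp
    qed
  next
    fix c :: real assume "0 < c"
    then have "\<forall>\<^sub>F s in at_top. 0 < s \<and> Q s < c"
      by (intro eventually_conj eventually_gt_at_top order_tendstoD(2)[OF Q0])
    then obtain s0 where s0: "\<And>s. s0 \<le> s \<Longrightarrow> 0 < s \<and> Q s < c"
      unfolding eventually_at_top_linorder by blast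
    show "\<forall>\<^sub>F t in at_top. Phi p (Suc r) t / (Phi p r t)\<^sup>2 < c"
      using eventually_ge_at_top[of "T s0"]
    proof eventually_elim
      case (elim t)
      have s0_pos: "0 < s0" using s0 by blast
      have st: "s0 \<le> t" using T_ge[OF s0_pos] elim by simp
      have "continuous_on {s0..t} T"
      proof (rule continuous_at_imp_continuous_on, rule ballI)
        fix s assume "s \<in> {s0..t}"
        then have s: "0 < s" using s0_pos by simp
        show "isCont T s"
          unfolding T_def record_scale_def
          using Phi_pos[OF s r] r by (intro continuous_intros Phi_isCont s) auto
      qed
      then obtain s where s: "s0 \<le> s" "T s = t"
        using IVT'[of T s0 t t] elim st T_ge[of t] s0_pos by auto
      then show ?case using bound[of s] s0[of s] by simp
    qed
  qed
qed

text \<open>In a window of \<open>b\<close> time units the time changes by a relative amount of at most \<open>d s\<close>,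
  which tends to \<open>0\<close> because \<open>Phi p r\<close> tends to infinity, and by \<open>Phi_forward_lower\<close> the relative
  loss of \<open>Phi p r\<close> is at most \<open>e s\<close>, which tends to \<open>0\<close> by the second condition.\<close>

lemma intensity_window:
  assumes r: "1 \<le> r" and top: "filterlim (Phi p r) at_top at_top"
    and small: "((\<lambda>t. Phi p (Suc r) t / (Phi p r t)\<^sup>2) \<longlongrightarrow> 0) at_top"
    and b: "0 < b" and \<epsilon>: "0 < \<epsilon>"
  shows "\<forall>\<^sub>F s in at_top. \<forall>t. s \<le> t \<and> (t - s) * intensity r s \<le> b \<longrightarrow>
    \<bar>intensity r t - intensity r s\<bar> \<le> \<epsilon> * intensity r s"
proof -
  define d where "d s = b / (real r * Phi p r s)" for s
  define e where "e s = b / real r * real (Suc r) * (Phi p (Suc r) s / (Phi p r s)\<^sup>2)" for s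
  have "((\<lambda>s. b / real r * inverse (Phi p r s)) \<longlongrightarrow> b / real r * 0) at_top"
    by (intro tendsto_mult tendsto_const filterlim_compose[OF tendsto_inverse_0_at_top[OF filterlim_ident] top])
  then have d0: "(d \<longlongrightarrow> 0) at_top" by (simp add: d_def[abs_def] divide_inverse mult_ac)
  have "(e \<longlongrightarrow> b / real r * real (Suc r) * 0) at_top"
    unfolding e_def by (intro tendsto_mult tendsto_const small)
  then have e0: "(e \<longlongrightarrow> 0) at_top" by simp
  have "((\<lambda>s. (1 + d s) ^ r) \<longlongrightarrow> (1 + 0) ^ r) at_top" by (intro tendsto_intros d0)
  then have up: "\<forall>\<^sub>F s in at_top. (1 + d s) ^ r < 1 + \<epsilon>"
    by (rule order_tendstoD(2)) (use \<epsilon> in simp)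
  have low: "\<forall>\<^sub>F s in at_top. d s < \<epsilon> / 2" "\<forall>\<^sub>F s in at_top. e s < min 1 (\<epsilon> / 2)"
    by (rule order_tendstoD(2)[OF d0], use \<epsilon> in simp)
      (rule order_tendstoD(2)[OF e0], use \<epsilon> in simp)
  show ?thesis
    using up low eventually_gt_at_top[of 0]
  proof eventually_elim
    case (elim s)
    have s: "0 < s" by fact
    have P: "0 < Phi p r s" by (rule Phi_pos[OF s r])
    have P': "0 < Phi p (Suc r) s" by (rule Phi_pos[OF s]) simp
    have d: "0 < d s" and e: "0 < e s" using b r P P' by (auto simp: d_def e_def)
    have h: "0 < intensity r s" using r P s by (simp add: intensity_def)
    show ?case
    proof (intro allI impI)
      fix t assume t: "s \<le> t \<and> (t - s) * intensity r s \<le> b"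
      have ratio: "(t - s) / s \<le> d s"
        using t s P r by (simp add: d_def intensity_def field_simps)
      have ts: "t / s \<le> 1 + d s" using ratio s by (simp add: diff_divide_distrib)
      have tpos: "0 < t" using s t by simp
      have "Phi p r t \<le> Phi p r t + (t - s) / t * (real (Suc r) * Phi p (Suc r) t)"
        using t s Phi_pos[OF tpos, of "Suc r"] by simp
      also have "\<dots> \<le> (t / s) ^ r * Phi p r s"
        by (rule Phi_backward_lower[OF s _ r]) (use t in simp)
      also have "\<dots> \<le> (1 + d s) ^ r * Phi p r s"
        using ts t s P by (intro mult_right_mono power_mono) auto
      also have "\<dots> \<le> (1 + \<epsilon>) * Phi p r s"
        using elim(1) P by (intro mult_right_mono) auto
      finally have up1: "Phi p r t \<le> (1 + \<epsilon>) * Phi p r s" .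
      have "intensity r t \<le> real r * ((1 + \<epsilon>) * Phi p r s) / t"
        unfolding intensity_def using up1 tpos by (intro divide_right_mono mult_left_mono) auto
      also have "\<dots> \<le> real r * ((1 + \<epsilon>) * Phi p r s) / s"
        using t s P \<epsilon> by (intro divide_left_mono) auto
      finally have upper: "intensity r t \<le> (1 + \<epsilon>) * intensity r s"
        by (simp add: intensity_def mult_ac)
      have "Phi p r s * (1 - e s) = Phi p r s - d s * (real (Suc r) * Phi p (Suc r) s)"
        using P r by (simp add: e_def d_def field_simps power2_eq_square del: of_nat_Suc)
      also have "\<dots> \<le> Phi p r s - (t - s) / s * (real (Suc r) * Phi p (Suc r) s)"
        using ratio P' by (intro diff_left_mono mult_right_mono) auto
      also have "\<dots> \<le> Phi p r t"
        by (rule Phi_forward_lower[OF s _ r]) (use t in simp)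
      finally have low1: "Phi p r s * (1 - e s) \<le> Phi p r t" .
      have "1 - \<epsilon> \<le> (1 - e s) * (1 - d s)"
      proof -
        have "0 \<le> e s * d s" using d e by simp
        then show ?thesis using elim(2,3) by (simp add: algebra_simps)
      qed
      also have "\<dots> \<le> (1 - e s) * (s / t)"
      proof (rule mult_left_mono)
        have "(1 - d s) * t \<le> (1 - d s) * t + d s * (t - s)" using d t by simp
        moreover have "t - s \<le> d s * s" using ratio s by (simp add: field_simps)
        moreover have "(1 - d s) * t + d s * (t - s) = t - d s * s" by (simp add: algebra_simps)
        ultimately have "(1 - d s) * t \<le> s" by linarith
        then show "1 - d s \<le> s / t" using tpos by (simp add: field_simps)
      qed (use elim(3) in simp)
      finally have "(1 - \<epsilon>) * intensity r s \<le> (1 - e s) * (s / t) * intensity r s"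
        using h by (intro mult_right_mono) auto
      also have "\<dots> = real r * (Phi p r s * (1 - e s)) / t"
        using s by (simp add: intensity_def)
      also have "\<dots> \<le> intensity r t"
        unfolding intensity_def using low1 tpos by (intro divide_right_mono mult_left_mono) auto
      finally have "(1 - \<epsilon>) * intensity r s \<le> intensity r t" .
      with upper show "\<bar>intensity r t - intensity r s\<bar> \<le> \<epsilon> * intensity r s"
        by (simp add: abs_le_iff algebra_simps)
    qed
  qed
qed

text \<open>A window of \<open>b\<close> time units has about \<open>b / h\<close> sites, where \<open>h\<close> is the intensity at its beginning.
  At each site the hazard, its intensity, the value \<open>h\<close> and the Bernoulli parameter
  \<open>1 - exp (- h)\<close> differ by small multiples of \<open>h\<close>.\<close>

lemma hazard_window_error:
  assumes top: "filterlim (Phi p (Suc a)) at_top at_top"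
    and small: "((\<lambda>t. Phi p (Suc (Suc a)) t / (Phi p (Suc a) t)\<^sup>2) \<longlongrightarrow> 0) at_top"
    and b: "0 < b"
  shows "(\<lambda>n. \<Sum>k<nat \<lceil>b / intensity (Suc a) (real n)\<rceil>.
      expectation (\<lambda>\<omega>. \<bar>hazard a (n + k) \<omega> - (1 - exp (- intensity (Suc a) (real n)))\<bar>)) \<longlonglongrightarrow> 0"
proof -
  let ?h = "\<lambda>n. intensity (Suc a) (real n)"
  let ?E = "\<lambda>n. \<Sum>k<nat \<lceil>b / ?h n\<rceil>. expectation (\<lambda>\<omega>. \<bar>hazard a (n + k) \<omega> - (1 - exp (- ?h n))\<bar>)"
  have nonneg: "0 \<le> ?E n" for n by (intro sum_nonneg integral_nonneg) simp
  have key: "\<forall>\<^sub>F n in sequentially. ?E n \<le> 4 * \<epsilon> * (b + 1)" if \<epsilon>: "0 < \<epsilon>" "\<epsilon> \<le> 1" for \<epsilon>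
  proof -
    obtain N where N: "\<And>n. N \<le> n \<Longrightarrow> expectation (\<lambda>\<omega>. \<bar>hazard a n \<omega> - ?h n\<bar>) \<le> \<epsilon> * ?h n"
      using hazard_L1_concentration[OF top small \<epsilon>(1)] unfolding eventually_sequentially by blast
    have "\<forall>\<^sub>F n in sequentially. \<forall>t. real n \<le> t \<and> (t - real n) * ?h n \<le> b \<longrightarrow>
        \<bar>intensity (Suc a) t - ?h n\<bar> \<le> \<epsilon> * ?h n"
      using filterlim_real_sequentially[unfolded filterlim_iff, rule_format,
          OF intensity_window[OF _ top small b \<epsilon>(1)]] by simp
    moreover have "\<forall>\<^sub>F n in sequentially. ?h n < \<epsilon>"
      by (rule order_tendstoD(2)[OF intensity_tendsto_0 \<epsilon>(1)])
    ultimately show ?thesis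
      using eventually_ge_at_top[of N] eventually_ge_at_top[of "1::nat"]
    proof eventually_elim
      case (elim n)
      define h where "h = ?h n"
      have h: "0 < h" using Phi_pos[of "real n" "Suc a"] elim(4) by (simp add: h_def intensity_def)
      have "expectation (\<lambda>\<omega>. \<bar>hazard a (n + k) \<omega> - (1 - exp (- h))\<bar>) \<le> 4 * \<epsilon> * h"
        if k: "k < nat \<lceil>b / h\<rceil>" for k
      proof -
        have "real k < b / h" using k by linarith
        then have "real k * h \<le> b" using h by (simp add: field_simps)
        then have near: "\<bar>?h (n + k) - h\<bar> \<le> \<epsilon> * h"
          using elim(1)[rule_format, of "real (n + k)"] by (simp add: h_def)
        have "1 - h \<le> exp (- h)" using exp_ge_add_one_self[of "- h"] by simp
        moreover have "h - (1 - exp (- h)) \<le> h\<^sup>2"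
        proof -
          have "exp (- h) * (1 + h) \<le> exp (- h) * exp h"
            by (intro mult_left_mono exp_ge_add_one_self) simp
          then have "exp (- h) * (1 + h) \<le> 1" by (simp add: exp_minus)
          then have "exp (- h) \<le> 1 / (1 + h)" using h by (simp add: field_simps)
          also have "1 / (1 + h) \<le> 1 - h + h\<^sup>2" using h by (simp add: field_simps power2_eq_square)
          finally show ?thesis by simp
        qed
        moreover have "h\<^sup>2 \<le> \<epsilon> * h"
          using elim(2) h by (simp add: power2_eq_square h_def)
        ultimately have q: "\<bar>h - (1 - exp (- h))\<bar> \<le> \<epsilon> * h" by linarith
        have "?h (n + k) \<le> 2 * h" 
        proof -
          have "\<epsilon> * h \<le> 1 * h" using \<epsilon> h by (intro mult_right_mono) auto
          then show ?thesis using near by linarith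
        qed
        then have "expectation (\<lambda>\<omega>. \<bar>hazard a (n + k) \<omega> - ?h (n + k)\<bar>) \<le> \<epsilon> * (2 * h)"
          using order.trans[OF N[of "n + k"] mult_left_mono[of "?h (n + k)" "2 * h" \<epsilon>]] elim(3) \<epsilon>
          by simp
        moreover have "expectation (\<lambda>\<omega>. \<bar>hazard a (n + k) \<omega> - (1 - exp (- h))\<bar>) \<le>
            expectation (\<lambda>\<omega>. \<bar>hazard a (n + k) \<omega> - ?h (n + k)\<bar> + 2 * \<epsilon> * h)"
        proof (rule integral_mono)
          fix \<omega>
          show "\<bar>hazard a (n + k) \<omega> - (1 - exp (- h))\<bar> \<le> \<bar>hazard a (n + k) \<omega> - ?h (n + k)\<bar> + 2 * \<epsilon> * h"
            using near q by linarith
        qed (use integrable_hazard[of a "n + k"] in auto)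
        moreover have "expectation (\<lambda>\<omega>. \<bar>hazard a (n + k) \<omega> - ?h (n + k)\<bar> + 2 * \<epsilon> * h) =
            expectation (\<lambda>\<omega>. \<bar>hazard a (n + k) \<omega> - ?h (n + k)\<bar>) + 2 * \<epsilon> * h"
          using integrable_hazard[of a "n + k"] by (simp add: prob_space)
        ultimately show ?thesis by (simp add: algebra_simps)
      qed
      then have "?E n \<le> (\<Sum>k<nat \<lceil>b / h\<rceil>. 4 * \<epsilon> * h)"
        unfolding h_def by (intro sum_mono) simp
      also have "\<dots> = real (nat \<lceil>b / h\<rceil>) * (4 * \<epsilon> * h)" by simp
      also have "\<dots> \<le> (b / h + 1) * (4 * \<epsilon> * h)"
      proof (rule mult_right_mono)
        have "0 < b / h" using b h by simp
        then show "real (nat \<lceil>b / h\<rceil>) \<le> b / h + 1" by linarith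
      qed (use \<epsilon> h in simp)
      also have "\<dots> = 4 * \<epsilon> * (b + h)" using h by (simp add: field_simps)
      also have "\<dots> \<le> 4 * \<epsilon> * (b + 1)"
        using elim(2) \<epsilon> by (intro mult_left_mono) (auto simp: h_def)
      finally show ?case .
    qed
  qed
  show ?thesis
  proof (rule order_tendstoI)
    fix c :: real assume "c < 0"
    then show "\<forall>\<^sub>F n in sequentially. c < ?E n"
      using nonneg by (intro always_eventually allI) (rule less_le_trans)
  next
    fix c :: real assume c: "0 < c"
    define \<epsilon> where "\<epsilon> = min 1 (c / (8 * (b + 1)))"
    have \<epsilon>: "0 < \<epsilon>" "\<epsilon> \<le> 1" using b c by (auto simp: \<epsilon>_def)
    have "\<epsilon> \<le> c / (8 * (b + 1))" by (simp add: \<epsilon>_def)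
    then have "4 * \<epsilon> * (b + 1) \<le> c / 2" using b by (simp add: field_simps)
    then have "4 * \<epsilon> * (b + 1) < c" using c by linarith
    with key[OF \<epsilon>] show "\<forall>\<^sub>F n in sequentially. ?E n < c"
      by (auto elim: eventually_mono)
  qed
qed

end

section \<open>The record process on the lattice\<close>

lemma occupancy_mono: "m \<le> n \<Longrightarrow> occupancy X j m \<omega> \<le> occupancy X j n \<omega>"
  unfolding occupancy_def by (rule card_mono) auto

lemma record_time_eq:
  assumes m: "1 \<le> m" and j: "X m \<omega> = j" "occupancy X j m \<omega> = r"
  shows "record_time X r j \<omega> = m"
  unfolding record_time_def
proof (rule Least_equality)
  fix n assume n: "occupancy X j n \<omega> = r"
  show "m \<le> n"
  proof (rule ccontr)
    obtain l where l: "m = Suc l" using m by (cases m) auto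
    assume "\<not> m \<le> n"
    then have "occupancy X j n \<omega> \<le> occupancy X j l \<omega>" using l by (intro occupancy_mono) simp
    then show False using n j l occupancy_Suc[of X j l \<omega>] by simp
  qed
qed (use j in simp)

lemma record_time_record:
  assumes r: "1 \<le> r" and ex: "\<exists>n. occupancy X j n \<omega> = r"
  shows "1 \<le> record_time X r j \<omega>" "X (record_time X r j \<omega>) \<omega> = j"
    "occupancy X j (record_time X r j \<omega>) \<omega> = r"
proof -
  show occ: "occupancy X j (record_time X r j \<omega>) \<omega> = r"
    unfolding record_time_def by (rule LeastI_ex[OF ex])
  then show "1 \<le> record_time X r j \<omega>" using r by (cases "record_time X r j \<omega>") auto
  then obtain l where l: "record_time X r j \<omega> = Suc l" by (cases "record_time X r j \<omega>") auto
  then have "occupancy X j l \<omega> \<noteq> r"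
    using not_less_Least[of l "\<lambda>n. occupancy X j n \<omega> = r"] by (auto simp: record_time_def)
  then show "X (record_time X r j \<omega>) \<omega> = j"
    using occ occupancy_Suc[of X j l \<omega>] l by (auto split: if_splits)
qed

text \<open>A ball falls in one box only, so records of different boxes happen at different times and the box
  is recovered from its record time.\<close>

lemma bij_betw_record_time:
  assumes r: "1 \<le> r"
  shows "bij_betw (\<lambda>j. record_time X r j \<omega>) {j. \<exists>n. occupancy X j n \<omega> = r}
    {m. 1 \<le> m \<and> occupancy X (X m \<omega>) m \<omega> = r}"
proof (rule bij_betw_byWitness[where f' = "\<lambda>m. X m \<omega>"])
  show "\<forall>j\<in>{j. \<exists>n. occupancy X j n \<omega> = r}. X (record_time X r j \<omega>) \<omega> = j"
    by (intro ballI, elim CollectE) (rule record_time_record(2)[OF r])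
  show "\<forall>m\<in>{m. 1 \<le> m \<and> occupancy X (X m \<omega>) m \<omega> = r}. record_time X r (X m \<omega>) \<omega> = m"
    by (auto intro: record_time_eq)
  show "(\<lambda>j. record_time X r j \<omega>) ` {j. \<exists>n. occupancy X j n \<omega> = r}
      \<subseteq> {m. 1 \<le> m \<and> occupancy X (X m \<omega>) m \<omega> = r}"
  proof (rule image_subsetI, elim CollectE, rule CollectI)
    fix j assume j: "\<exists>n. occupancy X j n \<omega> = r"
    show "1 \<le> record_time X r j \<omega> \<and>
        occupancy X (X (record_time X r j \<omega>) \<omega>) (record_time X r j \<omega>) \<omega> = r"
      using record_time_record[OF r j] by simp
  qed
qed auto

lemma measure_records:
  assumes r: "1 \<le> r" and A: "A \<in> sets borel_halfline" "bounded A"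
  shows "measure (records X r \<omega>) A = real (card {m. 1 \<le> m \<and> occupancy X (X m \<omega>) m \<omega> = r \<and> real m \<in> A})"
proof -
  let ?J = "{j. \<exists>n. occupancy X j n \<omega> = r}" and ?K = "{m. 1 \<le> m \<and> occupancy X (X m \<omega>) m \<omega> = r}"
  have loc: "locally_finite ?K real"
    unfolding locally_finite_def
  proof (intro conjI ballI allI)
    fix b
    have "{i \<in> ?K. real i \<le> b} \<subseteq> {..nat \<lceil>b\<rceil>}" by auto linarith
    then show "finite {i \<in> ?K. real i \<le> b}" by (rule finite_subset) simp
  qed simp
  have "records X r \<omega> = dirac_sum ?K real"
    unfolding records_def dirac_sum_reindex[OF bij_betw_record_time[OF r] loc, symmetric]
    by (simp add: comp_def)
  then have "emeasure (records X r \<omega>) A = of_nat (card {m \<in> ?K. real m \<in> A})"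
    using emeasure_dirac_sum[OF loc A] by simp
  moreover have "{m \<in> ?K. real m \<in> A} = {m. 1 \<le> m \<and> occupancy X (X m \<omega>) m \<omega> = r \<and> real m \<in> A}"
    by auto
  ultimately show ?thesis by (simp add: measure_def)
qed

lemma counting_measure_cong:
  assumes "\<And>t. 0 \<le> t \<Longrightarrow> c t = c' t"
  shows "counting_measure c = counting_measure c'"
proof -
  have "(\<lambda>t. if t < 0 then 0 else c t) = (\<lambda>t. if t < 0 then 0 else c' t)"
    using assms by (auto simp: fun_eq_iff)
  then show ?thesis by (simp add: counting_measure_def)
qed

text \<open>The record by ball \<open>n + k + 1\<close> is counted by time \<open>t\<close> exactly if \<open>(k + 1) / f \<le> t\<close>, where \<open>f\<close> is the
  time scale.\<close>

lemma scaled_records_lattice: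
  assumes f: "0 < record_scale p (Suc a) (real n)"
  shows "counting_measure (scaled_records p X (Suc a) n \<omega>) =
    lattice_points (1 / record_scale p (Suc a) (real n))
      {k. occupancy X (X (Suc (n + k)) \<omega>) (n + k) \<omega> = a}"
proof -
  define f where "f = record_scale p (Suc a) (real n)"
  define S where "S = {k. occupancy X (X (Suc (n + k)) \<omega>) (n + k) \<omega> = a}"
  have f0: "0 < f" "0 < 1 / f" using f by (simp_all add: f_def)
  have "scaled_records p X (Suc a) n \<omega> t = real (card {k \<in> S. real (Suc k) * (1 / f) \<le> t})" for t
  proof -
    let ?A = "{real n<..real n + f * t}"
    let ?K = "{m. 1 \<le> m \<and> occupancy X (X m \<omega>) m \<omega> = Suc a \<and> real m \<in> ?A}"
    have A: "?A \<in> sets borel_halfline" "bounded ?A"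
    proof -
      have "?A \<subseteq> {0..}" by auto
      then show "?A \<in> sets borel_halfline" by (simp add: sets_restrict_space_iff)
      show "bounded ?A"
        by (rule bounded_subset[OF bounded_closed_interval[of "real n" "real n + f * t"]]) auto
    qed
    have "(\<lambda>k. Suc (n + k)) ` {k \<in> S. real (Suc k) * (1 / f) \<le> t} = ?K"
    proof (intro equalityI subsetI)
      fix m assume m: "m \<in> ?K"
      then obtain k where k: "m = Suc (n + k)"
        using less_imp_Suc_add[of n m] by auto
      then have "k \<in> S" "real (Suc k) * (1 / f) \<le> t"
        using m f0 occupancy_Suc[of X "X m \<omega>" "n + k" \<omega>] by (auto simp: S_def field_simps)
      then show "m \<in> (\<lambda>k. Suc (n + k)) ` {k \<in> S. real (Suc k) * (1 / f) \<le> t}" using k by auto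
    next
      fix m assume "m \<in> (\<lambda>k. Suc (n + k)) ` {k \<in> S. real (Suc k) * (1 / f) \<le> t}"
      then obtain k where "m = Suc (n + k)" "k \<in> S" "real (Suc k) * (1 / f) \<le> t" by auto
      then show "m \<in> ?K"
        using f0 occupancy_Suc[of X "X m \<omega>" "n + k" \<omega>] by (auto simp: S_def field_simps)
    qed
    then have "card ?K = card {k \<in> S. real (Suc k) * (1 / f) \<le> t}"
      by (subst card_image[symmetric, of "\<lambda>k. Suc (n + k)"]) (auto simp: inj_on_def)
    then show ?thesis
      unfolding scaled_records_def f_def[symmetric] measure_records[OF _ A] by (simp add: measure_records[OF _ A])
  qed
  then have "counting_measure (scaled_records p X (Suc a) n \<omega>) =
      counting_measure (\<lambda>t. real (card {k \<in> S. real (Suc k) * (1 / f) \<le> t}))"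
    by (intro counting_measure_cong)
  also have "\<dots> = lattice_points (1 / f) S"
    unfolding lattice_points_def by (rule counting_measure_of_points[OF locally_finite_lattice[OF f0(2)]])
  finally show ?thesis by (simp add: f_def S_def)
qed

text \<open>For \<open>n0 = 0\<close> the time scale is \<open>0 / 0 = 0\<close>, so the window \<open>{0<..0}\<close> is empty.\<close>

lemma scaled_records_0: "counting_measure (scaled_records p X r 0 \<omega>) = dirac_sum ({} :: nat set) (\<lambda>_. 0)"
proof -
  have "scaled_records p X r 0 \<omega> = (\<lambda>t. real (card {i \<in> {} :: nat set. (0 :: real) \<le> t}))"
    by (simp add: scaled_records_def record_scale_def fun_eq_iff)
  then show ?thesis
    using counting_measure_of_points[of "{} :: nat set" "\<lambda>_. 0"] by (simp add: locally_finite_def)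
qed

context occupancy_scheme
begin

abbreviation record_at :: "nat \<Rightarrow> nat \<Rightarrow> 'a \<Rightarrow> bool" where
  "record_at a m \<omega> \<equiv> occupancy X (X (Suc m) \<omega>) m \<omega> = a"

lemma past_nth: "i < n \<Longrightarrow> past n \<omega> ! i = X (Suc i) \<omega>"
  unfolding past_def by (subst nth_map) (auto simp del: upt_Suc)

lemma take_past: "m \<le> n \<Longrightarrow> take m (past n \<omega>) = past m \<omega>"
  unfolding past_def take_map by (cases "m = n") (auto simp: take_upt simp del: upt_Suc)

lemma record_at_past:
  assumes "m < n"
  shows "record_at a m \<omega> \<longleftrightarrow> count_list (take m (past n \<omega>)) (past n \<omega> ! m) = a"
  using assms by (simp add: occupancy_past past_nth take_past)

lemma measurable_record_at: "Measurable.pred M (record_at a m)"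
proof -
  have "(\<lambda>\<omega>. count_list (take m (past (Suc m) \<omega>)) (past (Suc m) \<omega> ! m) = a) \<in> M \<rightarrow>\<^sub>M count_space UNIV"
    by (rule measurable_compose[OF measurable_past]) simp
  then show ?thesis by (simp add: record_at_past[of m "Suc m"])
qed

text \<open>Whether ball \<open>n + i + 1\<close> is a record is a function of the first \<open>n + k\<close> balls if \<open>i < k\<close>.\<close>

lemma record_hazard:
  assumes \<phi>: "\<And>l. \<bar>\<phi> l\<bar> \<le> (c :: real)"
  shows "expectation (\<lambda>\<omega>. \<phi> (map (\<lambda>i. record_at a (n + i) \<omega>) [0..<k]) * of_bool (record_at a (n + k) \<omega>)) =
    expectation (\<lambda>\<omega>. \<phi> (map (\<lambda>i. record_at a (n + i) \<omega>) [0..<k]) * hazard a (n + k) \<omega>)"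
proof -
  define \<psi> :: "nat list \<Rightarrow> real" where "\<psi> l = \<phi> (map (\<lambda>i. count_list (take (n + i) l) (l ! (n + i)) = a) [0..<k])" for l
  have eq: "\<phi> (map (\<lambda>i. record_at a (n + i) \<omega>) [0..<k]) = \<psi> (past (n + k) \<omega>)" for \<omega>
    unfolding \<psi>_def by (intro arg_cong[of _ _ \<phi>] map_cong refl record_at_past) auto
  show ?thesis
    unfolding eq by (rule expectation_past_record[where B = c]) (simp add: \<psi>_def \<phi>)
qed

lemma scaled_records_converge:
  assumes top: "filterlim (Phi p (Suc a)) at_top at_top"
    and small: "((\<lambda>t. Phi p (Suc (Suc a)) t / (Phi p (Suc a) t)\<^sup>2) \<longlongrightarrow> 0) at_top"
    and P: "poisson_process 1 N \<eta>"
  shows "converges_in_distribution vague_topology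
    M (\<lambda>n0 \<omega>. counting_measure (scaled_records p X (Suc a) n0 \<omega>)) N \<eta>"
proof -
  let ?\<delta> = "\<lambda>n. intensity (Suc a) (real n)"
  have \<delta>_scale: "?\<delta> n = 1 / record_scale p (Suc a) (real n)" for n
    by (simp add: intensity_def record_scale_def)
  have \<delta>pos: "0 < ?\<delta> n" if "1 \<le> n" for n
    using Phi_pos[of "real n" "Suc a"] that by (simp add: intensity_def)
  have lattice: "counting_measure (scaled_records p X (Suc a) n \<omega>) =
      lattice_points (?\<delta> n) {k. record_at a (n + k) \<omega>}" if "1 \<le> n" for n \<omega>
    unfolding \<delta>_scale by (rule scaled_records_lattice)
      (use \<delta>pos[OF that] in \<open>simp add: \<delta>_scale zero_less_divide_iff\<close>)
  show ?thesis
  proof (rule poisson_convergence_criterion[OF prob_space_axioms P,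
        where \<delta> = ?\<delta> and \<xi> = "\<lambda>n k. record_at a (n + k)" and H = "\<lambda>n k. hazard a (n + k)"])
    show "(\<lambda>\<omega>. counting_measure (scaled_records p X (Suc a) n \<omega>)) \<in> M \<rightarrow>\<^sub>M borel_of vague_topology" for n
    proof (cases "1 \<le> n")
      case True
      show ?thesis
        unfolding lattice[OF True]
        by (rule measurable_lattice_points[OF \<delta>pos[OF True] measurable_record_at])
    next
      case False
      have "dirac_sum ({} :: nat set) (\<lambda>_. 0) \<in> point_measures"
        by (rule point_measuresI) (simp add: locally_finite_def)
      moreover have "n = 0" using False by simp
      ultimately show ?thesis
        unfolding \<open>n = 0\<close> scaled_records_0
        by (intro measurable_const) (simp add: borel_of_def space_measure_of_conv topspace_vague_topology)
    qed
    show "(\<lambda>n. \<Sum>k<nat \<lceil>b / ?\<delta> n\<rceil>.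
        expectation (\<lambda>\<omega>. \<bar>hazard a (n + k) \<omega> - (1 - exp (- ?\<delta> n))\<bar>)) \<longlonglongrightarrow> 0" if "0 < b" for b
      by (rule hazard_window_error[OF top small that])
    show "expectation (\<lambda>\<omega>. \<phi> (map (\<lambda>i. record_at a (n + i) \<omega>) [0..<k]) * of_bool (record_at a (n + k) \<omega>)) =
        expectation (\<lambda>\<omega>. \<phi> (map (\<lambda>i. record_at a (n + i) \<omega>) [0..<k]) * hazard a (n + k) \<omega>)"
      if "\<And>l. \<bar>\<phi> l\<bar> \<le> c" for n k c and \<phi> :: "bool list \<Rightarrow> real"
      by (rule record_hazard[OF that])
  qed (use \<delta>pos intensity_tendsto_0 measurable_record_at lattice integrable_hazard in auto)
qed

end

theorem theorem3:
  fixes M :: "'a measure" and p :: "nat \<Rightarrow> real" and X :: "nat \<Rightarrow> 'a \<Rightarrow> nat" and r :: nat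
    and N :: "'b measure" and \<eta> :: "'b \<Rightarrow> real measure"
  assumes "occupancy_scheme M p X"
    and "1 \<le> r"
    and "filterlim (Phi p r) at_top at_top"
    and "(\<forall>\<theta>>0. ((\<lambda>t. Phi p r (t + record_scale p r t * \<theta>) / Phi p r t) \<longlongrightarrow> 1) at_top)
         \<or> ((\<lambda>t. Phi p (r + 1) t / (Phi p r t)\<^sup>2) \<longlongrightarrow> 0) at_top"
    and "poisson_process 1 N \<eta>"
  shows "converges_in_distribution vague_topology
           M (\<lambda>n0 \<omega>. counting_measure (scaled_records p X r n0 \<omega>)) N \<eta>"
proof -
  interpret occupancy_scheme M p X by fact
  have small: "((\<lambda>t. Phi p (Suc r) t / (Phi p r t)\<^sup>2) \<longlongrightarrow> 0) at_top"
    using assms(4)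
  proof
    assume "\<forall>\<theta>>0. ((\<lambda>t. Phi p r (t + record_scale p r t * \<theta>) / Phi p r t) \<longlongrightarrow> 1) at_top"
    then have "((\<lambda>t. Phi p r (t + record_scale p r t * 1) / Phi p r t) \<longlongrightarrow> 1) at_top"
      using zero_less_one by blast
    then show ?thesis by (rule second_condition_of_first[OF assms(2,3)])
  qed simp
  obtain a where r: "r = Suc a" using assms(2) by (cases r) auto
  show ?thesis
    using scaled_records_converge[of a N \<eta>] assms(3,5) small unfolding r by blast
qed

end
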